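(* Assume that ${\rm conv}(A)$ is a simplex. For $\beta\in\mathbf k^d$ consider the following two equivalent conditions. (i) Whenever $\tau_1,\dots,\tau_l$ are faces of the simplex and $\lambda\in\mathbf k(A\cap\tau_1\cap\cdots\cap\tau_l)$ belongs to $E_{\tau_i}(\beta)$ for all $i=1,\dots,l$, then $\lambda\in E_{\tau_1\cap\cdots\cap\tau_l}(\beta)$. (ii) Whenever $\tau_1,\tau_2$ are faces of the simplex and $\lambda\in\mathbf k(A\cap\tau_1\cap\tau_2)$ belongs to $E_{\tau_i}(\beta)$ for $i=1,2$, then $\lambda\in E_{\tau_1\cap\tau_2}(\beta)$. Then the exceptional set $\mathcal E(A)=\{\beta\in\mathbf k^d : {\rm rank}(M_A(\beta))>{\rm vol}(A)\}$ is the set of parameters $\beta\in\mathbf k^d$ which do not satisfy these equivalent conditions.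
   Context: Let $\mathbf N=\{0,1,2,\dots\}$ and let $\mathbf k$ be a field of characteristic zero. Let $A=(a_1,\dots,a_n)=(a_{ij})$ be a $d\times n$ integer matrix of rank $d$ whose columns all lie on one hyperplane of $\mathbf Q^d$ not containing the origin; $A$ also denotes the set of its columns, and $\mathbf NA$, $\mathbf ZA$ the monoid and the group they generate. $I_A=\langle \partial^u-\partial^v : u,v\in\mathbf N^n,\ Au=Av\rangle\subset\mathbf k[\partial_1,\dots,\partial_n]$. For $\beta\in\mathbf k^d$, $H_A(\beta)$ is the left ideal of the Weyl algebra $D=\mathbf k\langle x_1,\dots,x_n,\partial_1,\dots,\partial_n\rangle$ generated by $I_A$ and $\sum_{j}a_{ij}x_j\partial_j-\beta_i$ ($i=1,\dots,d$); $M_A(\beta)=D/H_A(\beta)$, and ${\rm rank}(M_A(\beta))=\dim_{\mathbf k(x)}\mathbf k(x)\otimes_{\mathbf k[x]}M_A(\beta)$ is its holonomic rank. ${\rm vol}(A)$ is the normalized volume of ${\rm conv}(A)$; in the simplex case ${\rm vol}(A)=[\mathbf ZA:\sum_{j\in V}\mathbf Za_j]$, where $V$ is the set of indices of the vertices of ${\rm conv}(A)$. For a face $\tau$ of the simplex ${\rm conv}(A)$ (including $\emptyset$ and ${\rm conv}(A)$; equivalently, a face of the cone $\mathbf Q_{\ge0}A$), $\mathbf Z(A\cap\tau)$ and $\mathbf k(A\cap\tau)$ are the additive group and the $\mathbf k$-vector space generated by $A\cap\tau$ (both $\{0\}$ if $\tau=\emptyset$), and $E_\tau(\beta)=\{\lambda\in\mathbf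 k(A\cap\tau)/\mathbf Z(A\cap\tau) : \beta-\lambda\in\mathbf NA+\mathbf Z(A\cap\tau)\}$. A vector $\lambda\in\mathbf k(A\cap\tau)$ is said to belong to $E_\tau(\beta)$ if its class modulo $\mathbf Z(A\cap\tau)$ does. *)

theory Defs
  imports
    "HOL-Analysis.Analysis"
    "HOL-Library.Poly_Mapping"
    "HOL-Computational_Algebra.Fraction_Field"
    "HOL-Algebra.QuotRing"
    "Jordan_Normal_Form.Missing_VectorSpace"
begin

section \<open>Modules, quotients and base change\<close>

definition ring_of :: "'a::{plus,times,zero,one} ring" where
  "ring_of = \<lparr>carrier = UNIV, monoid.mult = (*), one = 1, zero = 0, add = (+)\<rparr>"

text \<open>The multiplicative fields \<open>monoid.mult\<close> and \<open>one\<close> of a module record carry no meaning;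
  in the records below they are filled with arbitrary values.\<close>

definition regular_module :: "'r ring \<Rightarrow> ('r, 'r) module" where
  "regular_module R =
    \<lparr>carrier = carrier R, monoid.mult = monoid.mult R, one = one R,
     zero = zero R, add = add R, smult = monoid.mult R\<rparr>"

definition quotient_module :: "('r, 'm) module \<Rightarrow> 'm set \<Rightarrow> ('r, 'm set) module" where
  "quotient_module M N =
    \<lparr>carrier = a_rcosets\<^bsub>M\<^esub> N, monoid.mult = (\<lambda>X Y. N), one = N,
     zero = N, add = set_add M, smult = (\<lambda>r X. \<Union>x\<in>X. N +>\<^bsub>M\<^esub> (r \<odot>\<^bsub>M\<^esub> x))\<rparr>"

definition restrict_scalars :: "('r \<Rightarrow> 's) \<Rightarrow> ('s, 'm) module \<Rightarrow> ('r, 'm) module" where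
  "restrict_scalars \<phi> M =
    \<lparr>carrier = carrier M, monoid.mult = monoid.mult M, one = one M,
     zero = zero M, add = add M, smult = (\<lambda>r. smult M (\<phi> r))\<rparr>"

definition free_module :: "'m set \<Rightarrow> ('s::comm_ring_1, 'm \<Rightarrow>\<^sub>0 's) module" where
  "free_module B =
    \<lparr>carrier = {v. Poly_Mapping.keys v \<subseteq> B}, monoid.mult = (\<lambda>v w. 0), one = 0,
     zero = 0, add = (+), smult = (\<lambda>s. Poly_Mapping.map ((*) s))\<rparr>"

text \<open>For a ring homomorphism \<open>\<phi> : R \<rightarrow> S\<close> of commutative rings and an \<open>R\<close>-module \<open>M\<close>, the
  \<open>S\<close>-module \<open>S \<otimes>\<^sub>R M\<close>: it is generated by the symbols \<open>1 \<otimes> m\<close> (the basis vectors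
  \<open>single m 1\<close>), subject to additivity in \<open>m\<close> and \<open>1 \<otimes> r m = \<phi>(r) (1 \<otimes> m)\<close>.\<close>

definition base_change_relations ::
  "('r \<Rightarrow> 's::comm_ring_1) \<Rightarrow> ('r, 'm) module \<Rightarrow> ('m \<Rightarrow>\<^sub>0 's) set" where
  "base_change_relations \<phi> M =
     {Poly_Mapping.single (m \<oplus>\<^bsub>M\<^esub> m') 1 - Poly_Mapping.single m 1 - Poly_Mapping.single m' 1
       | m m'. m \<in> carrier M \<and> m' \<in> carrier M} \<union>
     {Poly_Mapping.single (r \<odot>\<^bsub>M\<^esub> m) 1 - Poly_Mapping.single m (\<phi> r)
       | r m. m \<in> carrier M}"

definition base_change ::
  "('r \<Rightarrow> 's::comm_ring_1) \<Rightarrow> ('r, 'm) module \<Rightarrow> ('s, ('m \<Rightarrow>\<^sub>0 's) set) module" where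
  "base_change \<phi> M =
     quotient_module (free_module (carrier M))
       (LinearCombinations.module.span ring_of (free_module (carrier M))
         (base_change_relations \<phi> M))"

definition left_ideal_generated :: "('r, 'b) ring_scheme \<Rightarrow> 'r set \<Rightarrow> 'r set" where
  "left_ideal_generated R S =
     \<Inter>{J. additive_subgroup J R \<and> (\<forall>r\<in>carrier R. \<forall>a\<in>J. r \<otimes>\<^bsub>R\<^esub> a \<in> J) \<and> S \<subseteq> J}"


section \<open>The Weyl algebra\<close>

text \<open>Words form a free monoid, written additively because the product of \<open>Poly_Mapping\<close> is
  convolution along addition of the keys.\<close>

datatype 'a free_monoid = Word "'a list"

instantiation free_monoid :: (type) monoid_add
begin

definition zero_free_monoid :: "'a free_monoid" where
  "zero_free_monoid = Word []"

fun plus_free_monoid :: "'a free_monoid \<Rightarrow> 'a free_monoid \<Rightarrow> 'a free_monoid" where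
  "plus_free_monoid (Word u) (Word v) = Word (u @ v)"

instance
proof
  fix a b c :: "'a free_monoid"
  show "a + b + c = a + (b + c)" by (cases a; cases b; cases c) simp
  show "0 + a = a" by (cases a) (simp add: zero_free_monoid_def)
  show "a + 0 = a" by (cases a) (simp add: zero_free_monoid_def)
qed

end

datatype 'n weyl_gen = GenX 'n | GenD 'n

type_synonym ('n, 'k) free_alg = "'n weyl_gen free_monoid \<Rightarrow>\<^sub>0 'k"

type_synonym ('n, 'k) mpoly = "('n \<Rightarrow>\<^sub>0 nat) \<Rightarrow>\<^sub>0 'k"

definition free_gen :: "'n weyl_gen \<Rightarrow> ('n, 'k::field) free_alg" where
  "free_gen g = Poly_Mapping.single (Word [g]) 1"

definition free_const :: "'k::field \<Rightarrow> ('n, 'k) free_alg" where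
  "free_const c = Poly_Mapping.single 0 c"

definition weyl_relations :: "('n, 'k::field) free_alg set" where
  "weyl_relations =
     {free_gen (GenX i) * free_gen (GenX j) - free_gen (GenX j) * free_gen (GenX i) | i j. True} \<union>
     {free_gen (GenD i) * free_gen (GenD j) - free_gen (GenD j) * free_gen (GenD i) | i j. True} \<union>
     {free_gen (GenD i) * free_gen (GenX j) - free_gen (GenX j) * free_gen (GenD i)
        - (if i = j then 1 else 0) | i j. True}"

definition weyl_ideal :: "('n, 'k::field) free_alg set" where
  "weyl_ideal = Idl\<^bsub>ring_of\<^esub> weyl_relations"

definition weyl_algebra :: "('n, 'k::field) free_alg set ring" where
  "weyl_algebra = ring_of Quot weyl_ideal"

definition weyl_class :: "('n, 'k::field) free_alg \<Rightarrow> ('n, 'k) free_alg set" where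
  "weyl_class a = weyl_ideal +>\<^bsub>ring_of\<^esub> a"

text \<open>\<open>poly_in GenX p\<close> is \<open>p(x\<^sub>1,\<dots>,x\<^sub>n)\<close> and \<open>poly_in GenD p\<close> is
  \<open>p(\<partial>\<^sub>1,\<dots>,\<partial>\<^sub>n)\<close>, as elements of the free algebra.  The order on \<open>'n\<close> fixes the order of
  the factors in a monomial; in the Weyl algebra it is irrelevant.\<close>

definition monomial_in ::
  "('n \<Rightarrow> 'n weyl_gen) \<Rightarrow> ('n::{finite,linorder} \<Rightarrow>\<^sub>0 nat) \<Rightarrow> ('n, 'k::field) free_alg" where
  "monomial_in g u =
     prod_list (map (\<lambda>j. free_gen (g j) ^ Poly_Mapping.lookup u j) (sorted_list_of_set UNIV))"

definition poly_in ::
  "('n \<Rightarrow> 'n weyl_gen) \<Rightarrow> ('n::{finite,linorder}, 'k::field) mpoly \<Rightarrow> ('n, 'k) free_alg" where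
  "poly_in g p = (\<Sum>u\<in>Poly_Mapping.keys p. free_const (Poly_Mapping.lookup p u) * monomial_in g u)"


section \<open>A-hypergeometric systems\<close>

definition toric_ideal :: "int ^ 'n::{finite,linorder} ^ 'd \<Rightarrow> ('n, 'k::field) mpoly set" where
  "toric_ideal A = Idl\<^bsub>ring_of\<^esub>
     {Poly_Mapping.single u 1 - Poly_Mapping.single v 1 | u v.
        A *v (\<chi> j. int (Poly_Mapping.lookup u j)) = A *v (\<chi> j. int (Poly_Mapping.lookup v j))}"

definition euler_op ::
  "int ^ 'n::{finite,linorder} ^ 'd \<Rightarrow> 'k ^ 'd \<Rightarrow> 'd \<Rightarrow> ('n, 'k::field) free_alg" where
  "euler_op A \<beta> i =
     (\<Sum>j\<in>UNIV. free_const (of_int (A $ i $ j)) * free_gen (GenX j) * free_gen (GenD j))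
       - free_const (\<beta> $ i)"

definition hypergeometric_ideal ::
  "int ^ 'n::{finite,linorder} ^ 'd \<Rightarrow> 'k ^ 'd \<Rightarrow> ('n, 'k::field) free_alg set set" where
  "hypergeometric_ideal A \<beta> = left_ideal_generated weyl_algebra
     (weyl_class ` (poly_in GenD ` toric_ideal A \<union> range (euler_op A \<beta>)))"

definition hypergeometric_module ::
  "int ^ 'n::{finite,linorder} ^ 'd \<Rightarrow> 'k ^ 'd
     \<Rightarrow> (('n, 'k::field) free_alg set, ('n, 'k) free_alg set set) module" where
  "hypergeometric_module A \<beta> =
     quotient_module (regular_module weyl_algebra) (hypergeometric_ideal A \<beta>)"

text \<open>The holonomic rank of a left module over the Weyl algebra:
  \<open>k[x]\<close> acts through \<open>k[x] \<rightarrow> D\<close>, and \<open>k(x)\<close> is the fraction field of \<open>k[x]\<close>.\<close>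

definition holonomic_rank ::
  "(('n::{finite,linorder}, 'k::field) free_alg set, 'm) module \<Rightarrow> nat" where
  "holonomic_rank M =
     vectorspace.dim (ring_of :: ('n, 'k) mpoly fract ring)
       (base_change (\<lambda>p. Fract p 1) (restrict_scalars (\<lambda>p. weyl_class (poly_in GenX p)) M))"


section \<open>The configuration A\<close>

definition acol :: "int ^ 'n ^ 'd \<Rightarrow> 'n \<Rightarrow> 'a::ring_1 ^ 'd" where
  "acol A j = (\<chi> i. of_int (A $ i $ j))"

definition conv_A :: "int ^ 'n ^ 'd \<Rightarrow> (real ^ 'd) set" where
  "conv_A A = convex hull (range (acol A))"

definition cols_in :: "int ^ 'n ^ 'd \<Rightarrow> (real ^ 'd) set \<Rightarrow> 'n set" where
  "cols_in A \<tau> = {j. acol A j \<in> \<tau>}"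

definition NA :: "int ^ 'n ^ 'd \<Rightarrow> ('a::ring_1 ^ 'd) set" where
  "NA A = {\<Sum>j\<in>UNIV. of_nat (c j) *s acol A j | c. True}"

definition Zspan :: "int ^ 'n ^ 'd \<Rightarrow> 'n set \<Rightarrow> ('a::ring_1 ^ 'd) set" where
  "Zspan A J = {\<Sum>j\<in>J. of_int (c j) *s acol A j | c. True}"

definition kspan :: "int ^ 'n ^ 'd \<Rightarrow> 'n set \<Rightarrow> ('k::field ^ 'd) set" where
  "kspan A J = vec.span (acol A ` J)"

text \<open>The normalized volume of \<open>conv(A)\<close>, where a unimodular simplex of the lattice \<open>\<int>A\<close> has
  volume 1.  As the columns lie on a hyperplane off the origin, this is the normalized volume of
  the pyramid over \<open>conv(A)\<close> with apex 0, that is, \<open>d!\<close> times its Lebesgue measure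
  divided by the covolume \<open>[\<int>\<^sup>d : \<int>A]\<close> of \<open>\<int>A\<close>.\<close>

definition ZA_index :: "int ^ 'n ^ 'd \<Rightarrow> nat" where
  "ZA_index A = card (range (\<lambda>v :: int ^ 'd. (+) v ` Zspan A UNIV))"

definition normalized_vol :: "int ^ 'n ^ 'd \<Rightarrow> real" where
  "normalized_vol A =
     fact CARD('d) * measure lebesgue (convex hull (insert 0 (conv_A A))) / real (ZA_index A)"

definition exceptional_set :: "int ^ 'n::{finite,linorder} ^ 'd \<Rightarrow> ('k::field ^ 'd) set" where
  "exceptional_set A =
     {\<beta>. real (holonomic_rank (hypergeometric_module A \<beta>)) > normalized_vol A}"

text \<open>The class of \<open>\<lambda>\<close> modulo \<open>\<int>(A \<inter> \<tau>)\<close>.\<close>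

definition Zclass :: "int ^ 'n ^ 'd \<Rightarrow> (real ^ 'd) set \<Rightarrow> 'k::field ^ 'd \<Rightarrow> ('k ^ 'd) set" where
  "Zclass A \<tau> v = (+) v ` Zspan A (cols_in A \<tau>)"

definition E_face :: "int ^ 'n ^ 'd \<Rightarrow> (real ^ 'd) set \<Rightarrow> 'k::field ^ 'd \<Rightarrow> ('k ^ 'd) set set" where
  "E_face A \<tau> \<beta> =
     {Zclass A \<tau> v | v. v \<in> kspan A (cols_in A \<tau>) \<and>
        (\<exists>a\<in>NA A. \<exists>z\<in>Zspan A (cols_in A \<tau>). \<beta> - v = a + z)}"

text \<open>In the first condition \<open>l \<ge> 1\<close>: an empty intersection of faces is not meant.\<close>

definition condition_i :: "int ^ 'n ^ 'd \<Rightarrow> 'k::field ^ 'd \<Rightarrow> bool" where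
  "condition_i A \<beta> \<longleftrightarrow>
     (\<forall>(l::nat) (\<tau> :: nat \<Rightarrow> (real ^ 'd) set) v.
        l \<ge> 1 \<longrightarrow> (\<forall>i\<in>{1..l}. \<tau> i face_of conv_A A) \<longrightarrow>
        v \<in> kspan A (cols_in A (\<Inter>i\<in>{1..l}. \<tau> i)) \<longrightarrow>
        (\<forall>i\<in>{1..l}. Zclass A (\<tau> i) v \<in> E_face A (\<tau> i) \<beta>) \<longrightarrow>
        Zclass A (\<Inter>i\<in>{1..l}. \<tau> i) v \<in> E_face A (\<Inter>i\<in>{1..l}. \<tau> i) \<beta>)"

definition condition_ii :: "int ^ 'n ^ 'd \<Rightarrow> 'k::field ^ 'd \<Rightarrow> bool" where
  "condition_ii A \<beta> \<longleftrightarrow>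
     (\<forall>\<tau>\<^sub>1 \<tau>\<^sub>2 v.
        \<tau>\<^sub>1 face_of conv_A A \<longrightarrow> \<tau>\<^sub>2 face_of conv_A A \<longrightarrow>
        v \<in> kspan A (cols_in A (\<tau>\<^sub>1 \<inter> \<tau>\<^sub>2)) \<longrightarrow>
        Zclass A \<tau>\<^sub>1 v \<in> E_face A \<tau>\<^sub>1 \<beta> \<longrightarrow> Zclass A \<tau>\<^sub>2 v \<in> E_face A \<tau>\<^sub>2 \<beta> \<longrightarrow>
        Zclass A (\<tau>\<^sub>1 \<inter> \<tau>\<^sub>2) v \<in> E_face A (\<tau>\<^sub>1 \<inter> \<tau>\<^sub>2) \<beta>)"

end

theory Submission
  imports Defs
begin

text \<open>The columns at the vertices of the simplex form a basis of the ambient space, and every column \<open>j\<close>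
has nonnegative rational coordinates \<open>\<kappa> j v\<close> of sum 1 in this basis.  Write \<open>bc v\<close> for the
coordinates of \<open>\<beta>\<close>, and \<open>kc \<alpha> v\<close> for those of the element of \<open>\<nat>A\<close> that is the sum of a multiset
\<open>\<alpha>\<close> of columns.  In \<open>M\<^sub>A(\<beta>)\<close> the class of the monomial \<open>\<partial>\<^sup>\<alpha>\<close> depends on this sum only, and
the Euler operators, rewritten in the basis of the vertices, say that
\<open>\<Sum>\<^sub>j \<kappa> j v x\<^sub>j \<partial>\<^sub>j \<partial>\<^sup>\<alpha> = (bc v - kc \<alpha> v) \<partial>\<^sup>\<alpha>\<close>.  At the point \<open>x0\<close> whose coordinates are 1 at the
vertices and 0 at the other columns, the left-hand side is \<open>\<partial>\<^sub>v \<partial>\<^sup>\<alpha>\<close>.  So near \<open>x0\<close> the system is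
a recursion along the vertices, which preserves the classes of \<open>\<nat>A\<close> modulo the lattice of the
vertices.  The number of these classes is the index of that lattice in \<open>\<int>A\<close>, that is, \<open>vol(A)\<close>
(\<open>normalized_vol_eq\<close>); it is the rank unless a factor \<open>bc v - kc \<alpha> v\<close> vanishes in an unfortunate way.

Let \<open>breaks \<beta> \<alpha>\<close> be the set of the vertices \<open>v\<close> for which \<open>bc v - kc \<alpha> v\<close> is a natural number:
those in whose direction the recursion that starts at \<open>\<alpha>\<close> meets a vanishing factor.  Call \<open>\<beta>\<close>
\<open>directed\<close> if in every class some element \<open>\<rho>\<close> has the largest set of this kind.

If \<open>\<beta>\<close> is directed, every \<open>\<alpha>\<close> of the class can be joined to \<open>\<rho>\<close> by adding vertices on both sides,
such that no factor on the side of \<open>\<alpha>\<close> vanishes.  Thus \<open>\<partial>\<^sup>\<alpha>\<close> is a multiple of \<open>\<partial>\<^sup>\<rho>\<close> up to a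
combination of monomials whose coefficients vanish at \<open>x0\<close>, and Nakayama's lemma over the local
ring of \<open>x0\<close> shows that the monomials \<open>\<partial>\<^sup>\<rho>\<close>, one for each class, span the generic fibre
(\<open>rank_le_classes\<close>).  Nakayama's lemma applies because finitely many monomials suffice from the
start: modulo the toric ideal some power of every \<open>\<partial>\<^sub>j\<close> is a product of vertices.

Conversely, a function on \<open>\<nat>A\<close> that satisfies the recursion is the family of derivatives at \<open>x0\<close>
of a formal power series solution.  If the set \<open>breaks \<beta> \<rho>\<close> is maximal in its class, there is such a
function whose support consists of the elements of the class that have the same set.  When \<open>\<beta>\<close> is
not directed, some class has two different maximal sets, so that there are more of these functions
than classes, and their supports are disjoint.  The corresponding monomials \<open>\<partial>\<^sup>\<rho>\<close> are linearly
independent over the rational functions: in a polynomial relation, the lowest derivative of the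
coefficients that does not vanish at \<open>x0\<close> is detected by the solutions (\<open>rank_gt_classes\<close>).

Finally, let \<open>\<tau>\<close> be the face with vertex set \<open>W\<close>.  A vector \<open>\<lambda>\<close> supported on \<open>W\<close> belongs to
\<open>E\<^sub>\<tau>(\<beta>)\<close> if and only if some element of \<open>\<nat>A\<close> has the coordinates of \<open>\<beta> - \<lambda>\<close> outside \<open>W\<close>, and on \<open>W\<close>
coordinates that exceed these by natural numbers.  So the sets \<open>E\<^sub>\<tau>(\<beta>)\<close> record which sets of
vertices are contained in a set \<open>breaks \<beta> \<alpha>\<close> with \<open>\<alpha>\<close> in a prescribed class, and both conditions
say that \<open>\<beta>\<close> is directed (\<open>conditions_iff\<close>).\<close>

section \<open>Dimension of a base change\<close>

lemma ring_of_simps [simp]: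
  "carrier ring_of = UNIV" "monoid.mult ring_of = (*)" "one ring_of = 1"
  "zero ring_of = 0" "add ring_of = (+)"
  by (simp_all add: ring_of_def)

lemma ring_ring_of: "Ring.ring (ring_of :: 'a::ring_1 ring)"
proof (rule ringI)
  show "abelian_group (ring_of :: 'a ring)"
  proof (rule abelian_groupI)
    fix x :: 'a
    show "\<exists>y\<in>carrier ring_of. y \<oplus>\<^bsub>ring_of\<^esub> x = \<zero>\<^bsub>ring_of\<^esub>"
      by (rule bexI[of _ "- x"]) simp_all
  qed (simp_all add: add.assoc add.commute)
  show "monoid (ring_of :: 'a ring)"
    by unfold_locales (simp_all add: mult.assoc)
qed (simp_all add: distrib_left distrib_right)

lemma cring_ring_of: "Ring.cring (ring_of :: 'a::comm_ring_1 ring)"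
proof -
  interpret R: Ring.ring "ring_of :: 'a ring" by (rule ring_ring_of)
  show ?thesis by unfold_locales (simp_all add: mult.commute)
qed

lemma field_ring_of: "Ring.field (ring_of :: 'a::field ring)"
proof -
  interpret R: Ring.cring "ring_of :: 'a ring" by (rule cring_ring_of)
  have "\<exists>b. a * b = 1 \<and> b * a = 1" if "a \<noteq> 0" for a :: 'a
    by (rule exI[of _ "inverse a"]) (use that in auto)
  then show ?thesis
    by (intro R.cring_fieldI) (auto simp: Units_def)
qed

lemma poly_mapping_sum_monomials:
  "(\<Sum>k\<in>Poly_Mapping.keys p. Poly_Mapping.single k (Poly_Mapping.lookup p k)) = p"
  by (rule poly_mapping_eqI) (auto simp: lookup_sum lookup_single when_def in_keys_iff)

lemma poly_mapping_induct [case_names single sum]: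
  fixes p :: "'a \<Rightarrow>\<^sub>0 'b::comm_monoid_add"
  assumes "\<And>k v. Q (Poly_Mapping.single k v)" "\<And>p q. Q p \<Longrightarrow> Q q \<Longrightarrow> Q (p + q)"
  shows "Q p"
proof -
  have zero: "Q 0" using assms(1)[of _ 0] by simp
  have "Q (\<Sum>k\<in>S. Poly_Mapping.single k (Poly_Mapping.lookup p k))" if "finite S" for S
    using that by (induction S rule: finite_induct) (auto intro: assms zero)
  from this[of "Poly_Mapping.keys p"] show ?thesis by (simp add: poly_mapping_sum_monomials)
qed

text \<open>Scalar multiplication on the free module with coefficients in \<open>'s\<close>.\<close>

definition pscale :: "'s::comm_ring_1 \<Rightarrow> ('m \<Rightarrow>\<^sub>0 's) \<Rightarrow> ('m \<Rightarrow>\<^sub>0 's)" where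
  "pscale s = Poly_Mapping.map ((*) s)"

lemma lookup_pscale [simp]: "Poly_Mapping.lookup (pscale s v) m = s * Poly_Mapping.lookup v m"
  by (simp add: pscale_def Poly_Mapping.map.rep_eq when_def)

lemma pscale_single [simp]: "pscale s (Poly_Mapping.single m c) = Poly_Mapping.single m (s * c)"
  by (rule poly_mapping_eqI) (simp add: lookup_single when_def)

lemma module_pscale: "Modules.module (pscale :: 's::comm_ring_1 \<Rightarrow> ('m \<Rightarrow>\<^sub>0 's) \<Rightarrow> _)"
  by unfold_locales (auto intro!: poly_mapping_eqI simp: lookup_add algebra_simps)

global_interpretation ps: Modules.module "pscale :: 's::comm_ring_1 \<Rightarrow> ('m \<Rightarrow>\<^sub>0 's) \<Rightarrow> _"
  by (rule module_pscale)

lemma free_module_simps [simp]: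
  "carrier (free_module B) = {v. Poly_Mapping.keys v \<subseteq> B}" "zero (free_module B) = 0"
  "add (free_module B) = (+)" "smult (free_module B) = pscale"
  by (simp_all add: free_module_def pscale_def fun_eq_iff)

lemma subspace_keys_subset:
  "ps.subspace {v :: 'm \<Rightarrow>\<^sub>0 's::comm_ring_1. Poly_Mapping.keys v \<subseteq> B}"
proof -
  have *: "Poly_Mapping.keys v \<subseteq> B \<longleftrightarrow> (\<forall>m. m \<notin> B \<longrightarrow> Poly_Mapping.lookup v m = 0)"
    for v :: "'m \<Rightarrow>\<^sub>0 's" by (auto simp: in_keys_iff)
  show ?thesis unfolding ps.subspace_def * by (auto simp: lookup_add)
qed

lemma module_free_module:
  "Module.module ring_of (free_module B :: ('s::comm_ring_1, 'm \<Rightarrow>\<^sub>0 's) module)"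
proof -
  have sub: "ps.subspace {v :: 'm \<Rightarrow>\<^sub>0 's. Poly_Mapping.keys v \<subseteq> B}" by (rule subspace_keys_subset)
  have neg: "\<exists>w\<in>carrier (free_module B). v \<oplus>\<^bsub>free_module B\<^esub> w = \<zero>\<^bsub>free_module B\<^esub>"
    if "v \<in> carrier (free_module B)" for v :: "'m \<Rightarrow>\<^sub>0 's"
    using ps.subspace_neg[OF sub, of v] that by (intro bexI[of _ "- v"]) auto
  show ?thesis
  proof (rule LinearCombinations.module_criteria[OF cring_ring_of])
    show "\<forall>(v :: 'm \<Rightarrow>\<^sub>0 's) w. v \<in> carrier (free_module B) \<and> w \<in> carrier (free_module B) \<longrightarrow>
        v \<oplus>\<^bsub>free_module B\<^esub> w \<in> carrier (free_module B)"
      using ps.subspace_add[OF sub] by simp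
    show "\<forall>c (v :: 'm \<Rightarrow>\<^sub>0 's). c \<in> carrier ring_of \<and> v \<in> carrier (free_module B) \<longrightarrow>
        c \<odot>\<^bsub>free_module B\<^esub> v \<in> carrier (free_module B)"
      using ps.subspace_scale[OF sub] by simp
  qed (use neg in \<open>simp_all add: ps.scale_left_distrib ps.scale_right_distrib ac_simps\<close>)
qed

lemma span_free_module:
  assumes "S \<subseteq> carrier (free_module B :: ('s::comm_ring_1, 'm \<Rightarrow>\<^sub>0 's) module)"
  shows "LinearCombinations.module.span ring_of (free_module B) S = ps.span S"
proof -
  interpret F: Module.module ring_of "free_module B" by (rule module_free_module)
  have sub: "ps.subspace {v :: 'm \<Rightarrow>\<^sub>0 's. Poly_Mapping.keys v \<subseteq> B}" by (rule subspace_keys_subset)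
  have fin: "finsum (free_module B) f A = sum f A"
    if "finite A" "f \<in> A \<rightarrow> carrier (free_module B)" for f :: "_ \<Rightarrow> _" and A
    using that by (induction A rule: finite_induct) auto
  have lc: "F.lincomb a A = (\<Sum>v\<in>A. pscale (a v) v)" if "finite A" "A \<subseteq> S" for a A
  proof -
    have "(\<lambda>v. pscale (a v) v) \<in> A \<rightarrow> carrier (free_module B)"
    proof
      fix v assume "v \<in> A"
      then have "v \<in> {v. Poly_Mapping.keys v \<subseteq> B}" using that assms by auto
      then show "pscale (a v) v \<in> carrier (free_module B)"
        using ps.subspace_scale[OF sub] by simp
    qed
    then show ?thesis
      unfolding F.lincomb_def using that by (simp add: fin)
  qed
  show ?thesis
    unfolding F.span_def ps.span_explicit
  proof (intro Collect_cong iffI; elim exE conjE)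
    fix v a A assume "v = F.lincomb a A" "finite A" "A \<subseteq> S"
    then show "\<exists>t r. v = (\<Sum>a\<in>t. pscale (r a) a) \<and> finite t \<and> t \<subseteq> S"
      using lc[of A a] by blast
  next
    fix v t r assume "v = (\<Sum>a\<in>t. pscale (r a) a)" "finite t" "t \<subseteq> S"
    then show "\<exists>a A. v = F.lincomb a A \<and> finite A \<and> A \<subseteq> S \<and> a \<in> A \<rightarrow> carrier ring_of"
      using lc[of t r] by (intro exI[of _ r] exI[of _ t]) simp
  qed
qed

subsection \<open>Quotient modules\<close>

lemma quotient_module_simps [simp]:
  "carrier (quotient_module M N) = a_rcosets\<^bsub>M\<^esub> N" "zero (quotient_module M N) = N"
  "add (quotient_module M N) = set_add M"
  by (simp_all add: quotient_module_def)

lemma carrier_quotient_module: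
  "a_rcosets\<^bsub>M\<^esub> N = (\<lambda>x. N +>\<^bsub>M\<^esub> x) ` carrier M"
  by (auto simp: A_RCOSETS_def' )

text \<open>Scalar multiplication on a quotient is well defined on cosets as soon as it preserves the
  submodule and is additive; no module structure over a commutative ring is required, so that this
  also applies to left modules over the Weyl algebra.\<close>

lemma quotient_smult:
  assumes "abelian_group M" "additive_subgroup N M" "x \<in> carrier M"
    and "\<And>y. y \<in> carrier M \<Longrightarrow> r \<odot>\<^bsub>M\<^esub> y \<in> carrier M"
    and "\<And>n. n \<in> N \<Longrightarrow> r \<odot>\<^bsub>M\<^esub> n \<in> N"
    and "\<And>n. n \<in> N \<Longrightarrow> r \<odot>\<^bsub>M\<^esub> (n \<oplus>\<^bsub>M\<^esub> x) = r \<odot>\<^bsub>M\<^esub> n \<oplus>\<^bsub>M\<^esub> r \<odot>\<^bsub>M\<^esub> x"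
  shows "smult (quotient_module M N) r (N +>\<^bsub>M\<^esub> x) = N +>\<^bsub>M\<^esub> (r \<odot>\<^bsub>M\<^esub> x)"
proof -
  interpret M: abelian_group M by fact
  interpret N: abelian_subgroup N M
    by (rule abelian_subgroupI3) fact+
  have eq: "N +>\<^bsub>M\<^esub> (r \<odot>\<^bsub>M\<^esub> y) = N +>\<^bsub>M\<^esub> (r \<odot>\<^bsub>M\<^esub> x)" if y: "y \<in> N +>\<^bsub>M\<^esub> x" for y
  proof -
    from y obtain n where n: "n \<in> N" "y = n \<oplus>\<^bsub>M\<^esub> x" by (auto simp: a_r_coset_def')
    have "r \<odot>\<^bsub>M\<^esub> y = r \<odot>\<^bsub>M\<^esub> n \<oplus>\<^bsub>M\<^esub> r \<odot>\<^bsub>M\<^esub> x" using n assms by simp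
    then have "r \<odot>\<^bsub>M\<^esub> y \<in> N +>\<^bsub>M\<^esub> (r \<odot>\<^bsub>M\<^esub> x)"
      using assms(5)[OF n(1)] by (auto simp: a_r_coset_def')
    then show ?thesis
      using M.a_repr_independence[of "r \<odot>\<^bsub>M\<^esub> y" N "r \<odot>\<^bsub>M\<^esub> x"] assms N.a_subgroup by auto
  qed
  have "N +>\<^bsub>M\<^esub> x \<noteq> {}" using N.a_rcos_self assms by blast
  moreover have "(\<Union>y\<in>N +>\<^bsub>M\<^esub> x. N +>\<^bsub>M\<^esub> (r \<odot>\<^bsub>M\<^esub> y)) = (\<Union>y\<in>N +>\<^bsub>M\<^esub> x. N +>\<^bsub>M\<^esub> (r \<odot>\<^bsub>M\<^esub> x))"
    using eq by (intro SUP_cong refl)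
  ultimately show ?thesis
    unfolding quotient_module_def by simp
qed

lemma module_quotient_module:
  assumes M: "Module.module R M" and N: "submodule R N M"
  shows "Module.module R (quotient_module M N)"
    and "\<And>r x. r \<in> carrier R \<Longrightarrow> x \<in> carrier M \<Longrightarrow>
      smult (quotient_module M N) r (N +>\<^bsub>M\<^esub> x) = N +>\<^bsub>M\<^esub> (r \<odot>\<^bsub>M\<^esub> x)"
    and "\<And>x y. x \<in> carrier M \<Longrightarrow> y \<in> carrier M \<Longrightarrow>
      set_add M (N +>\<^bsub>M\<^esub> x) (N +>\<^bsub>M\<^esub> y) = N +>\<^bsub>M\<^esub> (x \<oplus>\<^bsub>M\<^esub> y)"
    and "\<And>x. x \<in> carrier M \<Longrightarrow> N +>\<^bsub>M\<^esub> x = N \<longleftrightarrow> x \<in> N"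
proof -
  interpret M: Module.module R M by fact
  interpret N: submodule R N M by fact
  have asub: "additive_subgroup N M"
  proof (rule additive_subgroupI, unfold_locales)
    show "N \<subseteq> carrier (add_monoid M)" using N.subset by simp
    show "inv\<^bsub>add_monoid M\<^esub> x \<in> N" if "x \<in> N" for x
    proof -
      have "x \<in> carrier M" using that N.subset by auto
      then have "(\<ominus>\<^bsub>R\<^esub> \<one>\<^bsub>R\<^esub>) \<odot>\<^bsub>M\<^esub> x = \<ominus>\<^bsub>M\<^esub> x"
        by (simp add: M.smult_minus_1)
      then show ?thesis using N.smult_closed[of "\<ominus>\<^bsub>R\<^esub> \<one>\<^bsub>R\<^esub>" x] that
        by (simp add: a_inv_def)
    qed
  qed auto
  interpret N: abelian_subgroup N M
    by (rule abelian_subgroupI3[OF asub]) (rule M.abelian_group_axioms)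
  have sub: "x \<in> carrier M" if "x \<in> N" for x using N.subset that by auto
  show sm: "smult (quotient_module M N) r (N +>\<^bsub>M\<^esub> x) = N +>\<^bsub>M\<^esub> (r \<odot>\<^bsub>M\<^esub> x)"
    if "r \<in> carrier R" "x \<in> carrier M" for r x
    by (rule quotient_smult[OF M.abelian_group_axioms asub that(2)])
       (use that sub in \<open>auto simp: M.smult_r_distr\<close>)
  show ad: "set_add M (N +>\<^bsub>M\<^esub> x) (N +>\<^bsub>M\<^esub> y) = N +>\<^bsub>M\<^esub> (x \<oplus>\<^bsub>M\<^esub> y)"
    if "x \<in> carrier M" "y \<in> carrier M" for x y
    using that by (rule N.a_rcos_sum)
  show "N +>\<^bsub>M\<^esub> x = N \<longleftrightarrow> x \<in> N" if "x \<in> carrier M" for x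
    using that N.a_rcos_self[of x] M.a_coset_join2[of x N] N.a_subgroup by auto
  have zero: "N = N +>\<^bsub>M\<^esub> \<zero>\<^bsub>M\<^esub>" using N.subset by simp
  have neg: "\<exists>w\<in>(\<lambda>x. N +>\<^bsub>M\<^esub> x) ` carrier M. set_add M v w = N"
    if "v \<in> (\<lambda>x. N +>\<^bsub>M\<^esub> x) ` carrier M" for v
  proof -
    from that obtain x where x: "x \<in> carrier M" "v = N +>\<^bsub>M\<^esub> x" by auto
    show ?thesis
      by (rule bexI[of _ "N +>\<^bsub>M\<^esub> (\<ominus>\<^bsub>M\<^esub> x)"])
         (use x zero in \<open>auto simp: ad M.r_neg\<close>)
  qed
  show "Module.module R (quotient_module M N)"
  proof (rule LinearCombinations.module_criteria)
    show "cring R" by (rule M.R.cring_axioms)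
    show "\<zero>\<^bsub>quotient_module M N\<^esub> \<in> carrier (quotient_module M N)"
      by (subst quotient_module_simps)+ (subst zero, auto simp: carrier_quotient_module)
    show "\<forall>v\<in>carrier (quotient_module M N). \<exists>neg_v\<in>carrier (quotient_module M N).
        v \<oplus>\<^bsub>quotient_module M N\<^esub> neg_v = \<zero>\<^bsub>quotient_module M N\<^esub>"
      using neg by (simp add: carrier_quotient_module)
    show "\<forall>v\<in>carrier (quotient_module M N).
        v \<oplus>\<^bsub>quotient_module M N\<^esub> \<zero>\<^bsub>quotient_module M N\<^esub> = v"
    proof
      fix v assume "v \<in> carrier (quotient_module M N)"
      then obtain x where x: "x \<in> carrier M" "v = N +>\<^bsub>M\<^esub> x" by (auto simp: carrier_quotient_module)
      have "set_add M v N = set_add M v (N +>\<^bsub>M\<^esub> \<zero>\<^bsub>M\<^esub>)" using zero by simp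
      also have "\<dots> = v" using x by (simp add: ad)
      finally show "v \<oplus>\<^bsub>quotient_module M N\<^esub> \<zero>\<^bsub>quotient_module M N\<^esub> = v" by simp
    qed
  next
    show "\<forall>v w. v \<in> carrier (quotient_module M N) \<and> w \<in> carrier (quotient_module M N) \<longrightarrow>
        v \<oplus>\<^bsub>quotient_module M N\<^esub> w \<in> carrier (quotient_module M N)"
      by (auto simp: carrier_quotient_module ad)
    show "\<forall>c v. c \<in> carrier R \<and> v \<in> carrier (quotient_module M N) \<longrightarrow>
        c \<odot>\<^bsub>quotient_module M N\<^esub> v \<in> carrier (quotient_module M N)"
      by (auto simp: carrier_quotient_module sm)
    show "\<forall>v w. v \<in> carrier (quotient_module M N) \<and> w \<in> carrier (quotient_module M N) \<longrightarrow>
        v \<oplus>\<^bsub>quotient_module M N\<^esub> w = w \<oplus>\<^bsub>quotient_module M N\<^esub> v"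
    proof -
      have "set_add M (N +>\<^bsub>M\<^esub> x) (N +>\<^bsub>M\<^esub> y) = set_add M (N +>\<^bsub>M\<^esub> y) (N +>\<^bsub>M\<^esub> x)"
        if "x \<in> carrier M" "y \<in> carrier M" for x y
        using that by (simp only: ad M.a_comm[of x y])
      then show ?thesis by (auto simp only: quotient_module_simps carrier_quotient_module)
    qed
    show "\<forall>v w x. v \<in> carrier (quotient_module M N) \<and> w \<in> carrier (quotient_module M N) \<and>
        x \<in> carrier (quotient_module M N) \<longrightarrow>
        v \<oplus>\<^bsub>quotient_module M N\<^esub> w \<oplus>\<^bsub>quotient_module M N\<^esub> x =
        v \<oplus>\<^bsub>quotient_module M N\<^esub> (w \<oplus>\<^bsub>quotient_module M N\<^esub> x)"
      by (auto simp only: quotient_module_simps carrier_quotient_module ad M.a_assoc M.a_closed)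
    show "\<forall>v\<in>carrier (quotient_module M N). \<one>\<^bsub>R\<^esub> \<odot>\<^bsub>quotient_module M N\<^esub> v = v"
      by (auto simp only: quotient_module_simps carrier_quotient_module sm M.smult_one M.R.one_closed)
    show "\<forall>a b v. a \<in> carrier R \<and> b \<in> carrier R \<and> v \<in> carrier (quotient_module M N) \<longrightarrow>
        (a \<otimes>\<^bsub>R\<^esub> b) \<odot>\<^bsub>quotient_module M N\<^esub> v =
        a \<odot>\<^bsub>quotient_module M N\<^esub> (b \<odot>\<^bsub>quotient_module M N\<^esub> v)"
      by (auto simp only: quotient_module_simps carrier_quotient_module sm M.smult_assoc1
          M.R.m_closed M.smult_closed)
    show "\<forall>a b v. a \<in> carrier R \<and> b \<in> carrier R \<and> v \<in> carrier (quotient_module M N) \<longrightarrow>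
        (a \<oplus>\<^bsub>R\<^esub> b) \<odot>\<^bsub>quotient_module M N\<^esub> v =
        a \<odot>\<^bsub>quotient_module M N\<^esub> v \<oplus>\<^bsub>quotient_module M N\<^esub> b \<odot>\<^bsub>quotient_module M N\<^esub> v"
      by (auto simp only: quotient_module_simps carrier_quotient_module sm ad M.smult_l_distr
          M.R.a_closed M.smult_closed)
    show "\<forall>a v w. a \<in> carrier R \<and> v \<in> carrier (quotient_module M N) \<and>
        w \<in> carrier (quotient_module M N) \<longrightarrow>
        a \<odot>\<^bsub>quotient_module M N\<^esub> (v \<oplus>\<^bsub>quotient_module M N\<^esub> w) =
        a \<odot>\<^bsub>quotient_module M N\<^esub> v \<oplus>\<^bsub>quotient_module M N\<^esub> a \<odot>\<^bsub>quotient_module M N\<^esub> w"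
      by (auto simp only: quotient_module_simps carrier_quotient_module sm ad M.smult_r_distr
          M.a_closed M.smult_closed)
  qed
qed

text \<open>Spanning sets and linearly independent families of a quotient of a free module bound its
  dimension.\<close>

lemma
  fixes N :: "('m \<Rightarrow>\<^sub>0 'k::field) set" and B :: "'m set"
  assumes N: "ps.subspace N" "N \<subseteq> {v. Poly_Mapping.keys v \<subseteq> B}"
  defines "V \<equiv> quotient_module (free_module B) N"
  shows vectorspace_quotient: "vectorspace ring_of V"
    and fin_dim_quotient: "\<And>S. finite S \<Longrightarrow> S \<subseteq> {v. Poly_Mapping.keys v \<subseteq> B} \<Longrightarrow>
      {v. Poly_Mapping.keys v \<subseteq> B} \<subseteq> ps.span (N \<union> S) \<Longrightarrow> vectorspace.fin_dim ring_of V"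
    and dim_quotient_le: "\<And>S. finite S \<Longrightarrow> S \<subseteq> {v. Poly_Mapping.keys v \<subseteq> B} \<Longrightarrow>
      {v. Poly_Mapping.keys v \<subseteq> B} \<subseteq> ps.span (N \<union> S) \<Longrightarrow> vectorspace.dim ring_of V \<le> card S"
    and dim_quotient_ge: "\<And>I (b :: 'i \<Rightarrow> 'm \<Rightarrow>\<^sub>0 'k). finite I \<Longrightarrow> b ` I \<subseteq> {v. Poly_Mapping.keys v \<subseteq> B} \<Longrightarrow>
      vectorspace.fin_dim ring_of V \<Longrightarrow>
      (\<And>c. (\<Sum>i\<in>I. pscale (c i) (b i)) \<in> N \<Longrightarrow> \<forall>i\<in>I. c i = 0) \<Longrightarrow> card I \<le> vectorspace.dim ring_of V"
proof -
  define W where "W = {v :: 'm \<Rightarrow>\<^sub>0 'k. Poly_Mapping.keys v \<subseteq> B}"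
  define q where "q v = N +>\<^bsub>free_module B\<^esub> v" for v
  have W: "ps.subspace W" unfolding W_def by (rule subspace_keys_subset)
  have F: "Module.module ring_of (free_module B :: ('k, 'm \<Rightarrow>\<^sub>0 'k) module)"
    by (rule module_free_module)
  have sub: "submodule ring_of N (free_module B)"
    by (rule submodule.intro[OF F]) (use N in \<open>simp_all add: ps.subspace_def\<close>)
  note Q = module_quotient_module[OF F sub, folded V_def q_def]
  have V: "carrier V = q ` W" "add V = set_add (free_module B)" "zero V = N"
    unfolding V_def W_def q_def by (simp_all add: carrier_quotient_module)
  have q_add: "q v \<oplus>\<^bsub>V\<^esub> q w = q (v + w)" if "v \<in> W" "w \<in> W" for v w
    using Q(3)[of v w] that by (simp add: V W_def)
  have q_smult: "r \<odot>\<^bsub>V\<^esub> q v = q (pscale r v)" if "v \<in> W" for r v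
    using Q(2)[of r v] that by (simp add: W_def)
  have q_zero: "q v = \<zero>\<^bsub>V\<^esub> \<longleftrightarrow> v \<in> N" if "v \<in> W" for v
    using Q(4)[of v] that by (simp add: V W_def)
  show VS: "vectorspace ring_of V"
    using Q(1) field_ring_of by (simp add: vectorspace_def)
  interpret vectorspace "ring_of :: 'k ring" V by (rule VS)
  have gen: "gen_set (q ` S)" if S: "finite S" "S \<subseteq> W" "W \<subseteq> ps.span (N \<union> S)" for S
  proof -
    have SV: "q ` S \<subseteq> carrier V" using S V by auto
    have smod: "submodule ring_of (span (q ` S)) V" by (rule span_is_submodule[OF SV])
    interpret sm: submodule ring_of "span (q ` S)" V by (rule smod)
    have "ps.subspace {v \<in> W. q v \<in> span (q ` S)}"
      unfolding ps.subspace_def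
    proof (intro conjI ballI allI)
      show "0 \<in> {v \<in> W. q v \<in> span (q ` S)}"
        using q_zero[of 0] N(1) W by (auto simp: ps.subspace_def)
    next
      fix v w assume "v \<in> {v \<in> W. q v \<in> span (q ` S)}" "w \<in> {v \<in> W. q v \<in> span (q ` S)}"
      then show "v + w \<in> {v \<in> W. q v \<in> span (q ` S)}"
        using q_add[of v w] sm.m_closed[of "q v" "q w"] ps.subspace_add[OF W] by auto
    next
      fix c v assume "v \<in> {v \<in> W. q v \<in> span (q ` S)}"
      then show "pscale c v \<in> {v \<in> W. q v \<in> span (q ` S)}"
        using q_smult[of v c] sm.smult_closed[of c "q v"] ps.subspace_scale[OF W] by auto
    qed
    moreover have "N \<union> S \<subseteq> {v \<in> W. q v \<in> span (q ` S)}"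
    proof
      fix v assume v: "v \<in> N \<union> S"
      then have "v \<in> W" using N(2) S by (auto simp: W_def)
      moreover have "q v \<in> span (q ` S)"
        using v q_zero[OF \<open>v \<in> W\<close>] sm.zero_closed in_own_span[OF SV] by auto
      ultimately show "v \<in> {v \<in> W. q v \<in> span (q ` S)}" by simp
    qed
    ultimately have "ps.span (N \<union> S) \<subseteq> {v \<in> W. q v \<in> span (q ` S)}"
      by (intro ps.span_minimal)
    then have "carrier V \<subseteq> span (q ` S)" using S V by auto
    then show ?thesis using span_is_subset2[OF SV] by auto
  qed
  show "fin_dim" if "finite S" "S \<subseteq> {v. Poly_Mapping.keys v \<subseteq> B}"
      "{v. Poly_Mapping.keys v \<subseteq> B} \<subseteq> ps.span (N \<union> S)" for S
    using gen[of S] that V unfolding fin_dim_def W_def by (intro exI[of _ "q ` S"]) auto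
  show "dim \<le> card S" if "finite S" "S \<subseteq> {v. Poly_Mapping.keys v \<subseteq> B}"
      "{v. Poly_Mapping.keys v \<subseteq> B} \<subseteq> ps.span (N \<union> S)" for S
  proof -
    have "dim \<le> card (q ` S)"
      using gen[of S] that V by (intro gen_ge_dim) (auto simp: W_def)
    then show ?thesis using card_image_le[OF that(1), of q] by simp
  qed
  show "card I \<le> dim"
    if I: "finite I" "b ` I \<subseteq> {v. Poly_Mapping.keys v \<subseteq> B}" and fd: fin_dim
      and indep: "\<And>c. (\<Sum>i\<in>I. pscale (c i) (b i)) \<in> N \<Longrightarrow> \<forall>i\<in>I. c i = 0"
    for I and b :: "'i \<Rightarrow> 'm \<Rightarrow>\<^sub>0 'k"
  proof -
    have bW: "b i \<in> W" if "i \<in> I" for i using I that by (auto simp: W_def)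
    have sumW: "(\<Sum>i\<in>J. pscale (c i) (b i)) \<in> W" if "J \<subseteq> I" for c J
      using that bW by (intro ps.subspace_sum[OF W] ps.subspace_scale[OF W]) auto
    have fs: "(\<Oplus>\<^bsub>V\<^esub>i\<in>J. c i \<odot>\<^bsub>V\<^esub> q (b i)) = q (\<Sum>i\<in>J. pscale (c i) (b i))" if "J \<subseteq> I" for c J
      using finite_subset[OF that I(1)] that
    proof (induction J rule: finite_induct)
      case empty
      show ?case using q_zero[of 0] N(1) W by (simp add: ps.subspace_def)
    next
      case (insert i J)
      then have "(\<Oplus>\<^bsub>V\<^esub>i\<in>insert i J. c i \<odot>\<^bsub>V\<^esub> q (b i)) =
          q (pscale (c i) (b i)) \<oplus>\<^bsub>V\<^esub> q (\<Sum>i\<in>J. pscale (c i) (b i))"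
        using bW V ps.subspace_scale[OF W]
        by (subst M.finsum_insert) (auto simp: q_smult)
      also have "\<dots> = q (\<Sum>i\<in>insert i J. pscale (c i) (b i))"
        using insert bW by (subst q_add) (auto intro: sumW ps.subspace_scale[OF W])
      finally show ?case .
    qed
    have inj: "inj_on (q \<circ> b) I"
    proof (rule inj_onI, rule ccontr)
      fix i j assume ij: "i \<in> I" "j \<in> I" "(q \<circ> b) i = (q \<circ> b) j" "i \<noteq> j"
      have "b i - b j \<in> N"
      proof -
        have "q (b i - b j) = q (b i) \<oplus>\<^bsub>V\<^esub> q (pscale (-1) (b j))"
          using ij bW by (subst q_add) (auto intro: ps.subspace_scale[OF W] ps.subspace_neg[OF W])
        also have "\<dots> = q (b j) \<oplus>\<^bsub>V\<^esub> q (pscale (-1) (b j))" using ij by simp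
        also have "\<dots> = q 0"
          using ij bW by (subst q_add) (auto intro: ps.subspace_scale[OF W] ps.subspace_neg[OF W])
        finally show ?thesis
          using q_zero[of 0] q_zero[of "b i - b j"] ps.subspace_diff[OF W] ij bW N(1) W
          by (auto simp: ps.subspace_def)
      qed
      moreover have "(\<Sum>k\<in>I. pscale (if k = i then 1 else if k = j then -1 else 0) (b k)) = b i - b j"
      proof -
        have "(\<Sum>k\<in>I. pscale (if k = i then 1 else if k = j then -1 else 0) (b k)) =
            (\<Sum>k\<in>I. (if k = i then b i else 0) + (if k = j then - b j else 0))"
          using ij by (intro sum.cong) auto
        then show ?thesis using ij I by (simp add: sum.distrib)
      qed
      ultimately have "\<forall>k\<in>I. (if k = i then 1 else if k = j then -1 else (0::'k)) = 0"
        by (intro indep) simp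
      then show False using ij by force
    qed
    have "lin_indpt ((q \<circ> b) ` I)"
    proof (rule finite_lin_indpt2)
      show "finite ((q \<circ> b) ` I)" "(q \<circ> b) ` I \<subseteq> carrier V" using I bW V by auto
      fix a assume a: "lincomb a ((q \<circ> b) ` I) = \<zero>\<^bsub>V\<^esub>"
      have "lincomb a ((q \<circ> b) ` I) = (\<Oplus>\<^bsub>V\<^esub>i\<in>I. a (q (b i)) \<odot>\<^bsub>V\<^esub> q (b i))"
        unfolding lincomb_def using bW V inj ps.subspace_scale[OF W]
        by (subst M.finsum_reindex) (auto simp: q_smult)
      also have "\<dots> = q (\<Sum>i\<in>I. pscale (a (q (b i))) (b i))" by (rule fs) simp
      finally have "(\<Sum>i\<in>I. pscale (a (q (b i))) (b i)) \<in> N"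
        using a q_zero[OF sumW] by simp
      from indep[OF this] show "\<forall>v\<in>(q \<circ> b) ` I. a v = \<zero>\<^bsub>ring_of\<^esub>" by simp
    qed
    then have "card ((q \<circ> b) ` I) \<le> dim"
      using bW V by (intro li_le_dim(2)[OF fd]) auto
    then show ?thesis using card_image[OF inj] by simp
  qed
qed

text \<open>The base change is the quotient of the free module on the symbols \<open>1 \<otimes> m\<close> by the span of
  the defining relations.\<close>

lemma base_change_relations_subset:
  fixes M :: "('r, 'm) module"
  assumes "\<And>m m'. m \<in> carrier M \<Longrightarrow> m' \<in> carrier M \<Longrightarrow> m \<oplus>\<^bsub>M\<^esub> m' \<in> carrier M"
    and "\<And>r m. m \<in> carrier M \<Longrightarrow> r \<odot>\<^bsub>M\<^esub> m \<in> carrier M"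
  shows "base_change_relations (\<phi> :: 'r \<Rightarrow> 's::comm_ring_1) M \<subseteq> {v. Poly_Mapping.keys v \<subseteq> carrier M}"
proof -
  have sub: "ps.subspace {v :: 'm \<Rightarrow>\<^sub>0 's. Poly_Mapping.keys v \<subseteq> carrier M}" by (rule subspace_keys_subset)
  have single: "Poly_Mapping.single m c \<in> {v. Poly_Mapping.keys v \<subseteq> carrier M}" if "m \<in> carrier M"
    for m and c :: 's using that by simp
  have "Poly_Mapping.single (m \<oplus>\<^bsub>M\<^esub> m') 1 - Poly_Mapping.single m 1 - Poly_Mapping.single m' 1
      \<in> {v :: 'm \<Rightarrow>\<^sub>0 's. Poly_Mapping.keys v \<subseteq> carrier M}" if "m \<in> carrier M" "m' \<in> carrier M" for m m'
    using that by (intro ps.subspace_diff[OF sub] single assms)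
  moreover have "Poly_Mapping.single (r \<odot>\<^bsub>M\<^esub> m) 1 - Poly_Mapping.single m (\<phi> r)
      \<in> {v :: 'm \<Rightarrow>\<^sub>0 's. Poly_Mapping.keys v \<subseteq> carrier M}" if "m \<in> carrier M" for r m
    using that by (intro ps.subspace_diff[OF sub] single assms)
  ultimately show ?thesis
    unfolding base_change_relations_def by blast
qed

lemma base_change_eq:
  assumes "\<And>m m'. m \<in> carrier M \<Longrightarrow> m' \<in> carrier M \<Longrightarrow> m \<oplus>\<^bsub>M\<^esub> m' \<in> carrier M"
    and "\<And>r m. m \<in> carrier M \<Longrightarrow> r \<odot>\<^bsub>M\<^esub> m \<in> carrier M"
  shows "base_change \<phi> M =
    quotient_module (free_module (carrier M)) (ps.span (base_change_relations \<phi> M))"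
  unfolding base_change_def
  by (subst span_free_module) (use base_change_relations_subset[of M \<phi>] assms in auto)

section \<open>Computing in the Weyl algebra\<close>

subsection \<open>Words\<close>

text \<open>A word in the generators, as an element of the free algebra.\<close>

definition wd :: "'n weyl_gen list \<Rightarrow> ('n, 'k::field) free_alg" where
  "wd gs = Poly_Mapping.single (Word gs) 1"

lemma wd_mult [simp]: "wd u * wd v = (wd (u @ v) :: ('n, 'k::field) free_alg)"
  by (simp add: wd_def Poly_Mapping.mult_single)

lemma wd_Nil: "wd [] = 1"
  by (simp add: wd_def zero_free_monoid_def[symmetric])

lemma free_gen_wd: "free_gen g = wd [g]"
  by (simp add: free_gen_def wd_def)

lemma wd_power: "wd [g] ^ k = wd (replicate k g)"
  by (induction k) (simp_all add: wd_Nil)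

lemma prod_list_wd: "prod_list (map (\<lambda>j. wd (f j)) js) = wd (concat (map f js))"
  by (induction js) (simp_all add: wd_Nil)

text \<open>The word that lists every index \<open>j\<close> as often as it occurs in the exponent vector \<open>u\<close>,
  in increasing order.\<close>

definition letters :: "('n::{finite,linorder} \<Rightarrow>\<^sub>0 nat) \<Rightarrow> 'n list" where
  "letters u = concat (map (\<lambda>j. replicate (Poly_Mapping.lookup u j) j) (sorted_list_of_set UNIV))"

lemma monomial_in_wd: "monomial_in g u = wd (map g (letters u))"
proof -
  have "monomial_in g u = prod_list (map (\<lambda>j. wd (replicate (Poly_Mapping.lookup u j) (g j)))
      (sorted_list_of_set UNIV))"
    by (simp add: monomial_in_def free_gen_wd wd_power)
  also have "\<dots> = wd (map g (letters u))"
    by (simp add: prod_list_wd letters_def map_concat comp_def)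
  finally show ?thesis .
qed

lemma count_letters: "count (mset (letters u)) j = Poly_Mapping.lookup u j"
proof -
  have "count (mset (concat (map (\<lambda>j. replicate (f j) j) js))) j = (if j \<in> set js then f j else 0)"
    if "distinct js" for js :: "'a list" and f
    using that by (induction js) auto
  then show ?thesis by (simp add: letters_def)
qed

lemma mset_letters_plus: "mset (letters (u + v)) = mset (letters u @ letters v)"
  by (rule multiset_eqI) (simp add: count_letters lookup_add)

lemma free_const_mult_left: "free_const c * p = Poly_Mapping.map ((*) c) p"
proof (induction p rule: poly_mapping_induct)
  case (single k v)
  then show ?case
    by (simp add: free_const_def Poly_Mapping.mult_single pscale_single[unfolded pscale_def])
next
  case (sum f g)
  then show ?case
    by (simp add: distrib_left ps.scale_right_distrib[unfolded pscale_def])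
qed

lemma free_const_0 [simp]: "free_const 0 = 0"
  by (simp add: free_const_def)

lemma free_const_1 [simp]: "free_const 1 = 1"
  by (simp add: free_const_def)

lemma free_const_add: "free_const (a + b) = free_const a + free_const b"
  by (simp add: free_const_def single_add)

lemma free_const_mult: "free_const (a * b) = free_const a * free_const b"
  by (simp add: free_const_def Poly_Mapping.mult_single)

lemma free_const_commute: "free_const c * p = p * free_const c"
proof (induction p rule: poly_mapping_induct)
  case (single k v)
  then show ?case by (simp add: free_const_def Poly_Mapping.mult_single mult.commute)
qed (simp add: distrib_left distrib_right)

lemma free_alg_eq_sum: "(P :: ('n, 'k::field) free_alg) =
    (\<Sum>w\<in>Poly_Mapping.keys P. free_const (Poly_Mapping.lookup P w) * Poly_Mapping.single w 1)"
proof -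
  have "P = (\<Sum>w\<in>Poly_Mapping.keys P. Poly_Mapping.single w (Poly_Mapping.lookup P w))"
    by (simp add: poly_mapping_sum_monomials)
  then show ?thesis by (simp add: free_const_def Poly_Mapping.mult_single)
qed

text \<open>A property of the free algebra that is stable under sums and scalar multiples follows from
  its validity for words.\<close>

lemma free_alg_induct [case_names zero add const word]:
  assumes "Q 0" "\<And>P P'. Q P \<Longrightarrow> Q P' \<Longrightarrow> Q (P + P')" "\<And>c P. Q P \<Longrightarrow> Q (free_const c * P)" "\<And>gs. Q (wd gs)"
  shows "Q (P :: ('n, 'k::field) free_alg)"
proof -
  have termQ: "Q (free_const (Poly_Mapping.lookup P w) * Poly_Mapping.single w 1)" for w
    using assms(3)[OF assms(4)] by (cases w) (simp add: wd_def)
  have "Q (\<Sum>w\<in>S. free_const (Poly_Mapping.lookup P w) * Poly_Mapping.single w 1)"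
    if "finite S" for S
    using that by (induction S rule: finite_induct) (auto intro: assms(1,2) termQ)
  from this[of "Poly_Mapping.keys P"] show ?thesis
    by (simp flip: free_alg_eq_sum)
qed

lemma poly_in_superset:
  assumes "finite S" "Poly_Mapping.keys p \<subseteq> S"
  shows "poly_in g p = (\<Sum>u\<in>S. free_const (Poly_Mapping.lookup p u) * monomial_in g u)"
  unfolding poly_in_def
  by (rule sum.mono_neutral_left) (use assms in \<open>auto simp: in_keys_iff\<close>)

lemma poly_in_0 [simp]: "poly_in g 0 = 0"
  by (simp add: poly_in_def)

lemma poly_in_add: "poly_in g (p + q) = poly_in g p + poly_in g q"
proof -
  let ?S = "Poly_Mapping.keys p \<union> Poly_Mapping.keys q"
  show ?thesis
    by (subst (1 2 3) poly_in_superset[of ?S])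
       (use Poly_Mapping.keys_add[of p q] in
        \<open>auto simp: lookup_add free_const_add distrib_right sum.distrib\<close>)
qed

lemma poly_in_single [simp]: "poly_in g (Poly_Mapping.single u c) = free_const c * monomial_in g u"
  by (subst poly_in_superset[of "{u}"]) auto

lemma poly_in_minus: "poly_in g (- p) = - poly_in g p"
  using poly_in_add[of g p "- p"] by (simp add: eq_neg_iff_add_eq_0 add.commute)

lemma poly_in_diff: "poly_in g (p - q) = poly_in g p - poly_in g q"
  using poly_in_add[of g p "- q"] by (simp add: poly_in_minus)

subsection \<open>The ideal of relations\<close>

text \<open>Equality of two representatives in the Weyl algebra.\<close>

definition weq :: "('n, 'k::field) free_alg \<Rightarrow> ('n, 'k) free_alg \<Rightarrow> bool" (infix "=\<^sub>W" 50) where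
  "P =\<^sub>W Q \<longleftrightarrow> P - Q \<in> weyl_ideal"

lemma ideal_weyl_ideal: "ideal (weyl_ideal :: ('n, 'k::field) free_alg set) ring_of"
  unfolding weyl_ideal_def
  by (rule ring.genideal_ideal[OF ring_ring_of]) simp

lemma uminus_ring_of [simp]: "\<ominus>\<^bsub>ring_of\<^esub> (x :: 'a::ring_1) = - x"
proof -
  interpret R: Ring.ring "ring_of :: 'a ring" by (rule ring_ring_of)
  show ?thesis by (rule R.minus_equality) simp_all
qed

lemma weyl_ideal_0: "(0 :: ('n, 'k::field) free_alg) \<in> weyl_ideal"
  using additive_subgroup.zero_closed[OF ideal.axioms(1)[OF ideal_weyl_ideal]] by simp

lemma weyl_ideal_add:
  "P \<in> weyl_ideal \<Longrightarrow> Q \<in> weyl_ideal \<Longrightarrow> (P + Q :: ('n, 'k::field) free_alg) \<in> weyl_ideal"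
  using additive_subgroup.a_closed[OF ideal.axioms(1)[OF ideal_weyl_ideal]] by simp

lemma weyl_ideal_minus: "P \<in> weyl_ideal \<Longrightarrow> (- P :: ('n, 'k::field) free_alg) \<in> weyl_ideal"
  using additive_subgroup.a_inv_closed[OF ideal.axioms(1)[OF ideal_weyl_ideal]]
    ring.is_abelian_group[OF ring_ring_of] by simp

lemma weyl_ideal_mult_left: "P \<in> weyl_ideal \<Longrightarrow> (Q * P :: ('n, 'k::field) free_alg) \<in> weyl_ideal"
  using ideal.I_l_closed[OF ideal_weyl_ideal, of P Q] by simp

lemma weyl_ideal_mult_right: "P \<in> weyl_ideal \<Longrightarrow> (P * Q :: ('n, 'k::field) free_alg) \<in> weyl_ideal"
  using ideal.I_r_closed[OF ideal_weyl_ideal, of P Q] by simp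

lemma weyl_relations_subset: "(weyl_relations :: ('n, 'k::field) free_alg set) \<subseteq> weyl_ideal"
  unfolding weyl_ideal_def by (rule ring.genideal_self[OF ring_ring_of]) simp

text \<open>Induction over a generated two-sided ideal.  The closure under negation is not assumed: it is
  multiplication by -1.\<close>

lemma genideal_subset:
  fixes S J :: "'a::ring_1 set"
  assumes "S \<subseteq> J" "0 \<in> J" "\<And>P Q. P \<in> J \<Longrightarrow> Q \<in> J \<Longrightarrow> P + Q \<in> J"
    "\<And>P Q. P \<in> J \<Longrightarrow> Q * P \<in> J" "\<And>P Q. P \<in> J \<Longrightarrow> P * Q \<in> J"
  shows "Idl\<^bsub>ring_of\<^esub> S \<subseteq> J"
proof -
  have "ideal J ring_of"
  proof (rule idealI[OF ring_ring_of])
    show "subgroup J (add_monoid ring_of)"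
    proof (rule group.subgroupI)
      show "group (add_monoid (ring_of :: 'a ring))"
        using ring_ring_of[where ?'a = 'a]
        by (simp add: Ring.ring_def abelian_group_def abelian_group_axioms_def comm_group_def)
      show "inv\<^bsub>add_monoid ring_of\<^esub> a \<in> J" if "a \<in> J" for a
        using assms(4)[OF that, of "- 1"] uminus_ring_of[of a] by (simp add: a_inv_def)
    qed (use assms in auto)
  qed (use assms in auto)
  then show ?thesis
    using assms(1) by (intro ring.genideal_minimal[OF ring_ring_of])
qed

lemma weq_refl [simp]: "P =\<^sub>W P"
  by (simp add: weq_def weyl_ideal_0)

lemma weq_sym: "P =\<^sub>W Q \<Longrightarrow> Q =\<^sub>W P"
  unfolding weq_def using weyl_ideal_minus by force

lemma weq_trans [trans]: "P =\<^sub>W Q \<Longrightarrow> Q =\<^sub>W S \<Longrightarrow> P =\<^sub>W S"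
  unfolding weq_def using weyl_ideal_add by force

lemma weq_add: "P =\<^sub>W Q \<Longrightarrow> P' =\<^sub>W Q' \<Longrightarrow> P + P' =\<^sub>W Q + Q'"
  unfolding weq_def using weyl_ideal_add by (force simp: algebra_simps)

lemma weq_mult_left: "P =\<^sub>W Q \<Longrightarrow> S * P =\<^sub>W S * Q"
  unfolding weq_def using weyl_ideal_mult_left by (force simp: algebra_simps)

lemma weq_mult_right: "P =\<^sub>W Q \<Longrightarrow> P * S =\<^sub>W Q * S"
  unfolding weq_def using weyl_ideal_mult_right by (force simp: algebra_simps)

lemma wd_swap:
  assumes "g = GenX \<or> g = GenD"
  shows "(wd [g i, g j] :: ('n, 'k::field) free_alg) =\<^sub>W wd [g j, g i]"
proof -
  have "free_gen (g i) * free_gen (g j) - free_gen (g j) * free_gen (g i) \<in>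
      (weyl_relations :: ('n, 'k) free_alg set)"
    using assms unfolding weyl_relations_def by blast
  then show ?thesis using weyl_relations_subset by (auto simp: weq_def free_gen_wd)
qed

lemma wd_DX:
  "(wd [GenD i, GenX j] :: ('n, 'k::field) free_alg) =\<^sub>W wd [GenX j, GenD i] + (if i = j then 1 else 0)"
proof -
  have "free_gen (GenD i) * free_gen (GenX j) - free_gen (GenX j) * free_gen (GenD i)
        - (if i = j then 1 else 0) \<in> (weyl_relations :: ('n, 'k) free_alg set)"
    unfolding weyl_relations_def by blast
  then show ?thesis using weyl_relations_subset by (force simp: weq_def free_gen_wd algebra_simps)
qed

text \<open>Words in the \<open>x\<^sub>j\<close> only, or in the \<open>\<partial>\<^sub>j\<close> only, may be reordered.\<close>

lemma wd_perm:
  assumes "g = GenX \<or> g = GenD" "mset js = mset js'"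
  shows "(wd (map g js) :: ('n, 'k::field) free_alg) =\<^sub>W wd (map g js')"
  using assms(2)
proof (induction js arbitrary: js')
  case (Cons j js)
  have move: "(wd (map g (us @ [j])) :: ('n, 'k) free_alg) =\<^sub>W wd (map g (j # us))" for us
  proof (induction us)
    case (Cons i us)
    have "(wd (map g ((i # us) @ [j])) :: ('n, 'k) free_alg) = wd [g i] * wd (map g (us @ [j]))" by simp
    also have "\<dots> =\<^sub>W wd [g i] * wd (map g (j # us))" by (rule weq_mult_left[OF Cons])
    also have "\<dots> = wd [g i, g j] * wd (map g us)" by simp
    also have "\<dots> =\<^sub>W wd [g j, g i] * wd (map g us)" by (rule weq_mult_right[OF wd_swap[OF assms(1)]])
    finally show ?case by simp
  qed simp
  have "j \<in> set js'" using Cons.prems by (metis list.set_intros(1) set_mset_mset)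
  then obtain us vs where js': "js' = us @ j # vs" by (meson split_list)
  have "mset js = mset (us @ vs)" using Cons.prems js' by simp
  from weq_mult_left[OF Cons.IH[OF this], of "wd [g j]"]
  have "(wd (map g (j # js)) :: ('n, 'k) free_alg) =\<^sub>W wd (map g (j # us)) * wd (map g vs)" by simp
  also have "\<dots> =\<^sub>W wd (map g (us @ [j])) * wd (map g vs)" by (rule weq_mult_right[OF weq_sym[OF move]])
  also have "\<dots> = wd (map g js')" by (simp add: js')
  finally show ?case .
qed simp

lemma poly_in_mult:
  assumes g: "g = GenX \<or> g = GenD"
  shows "(poly_in g (p * q) :: ('n::{finite,linorder}, 'k::field) free_alg) =\<^sub>W poly_in g p * poly_in g q"
proof (induction p rule: poly_mapping_induct)
  case (single u a)
  show ?case
  proof (induction q rule: poly_mapping_induct)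
    case (single v b)
    have "(monomial_in g (u + v) :: ('n, 'k) free_alg) =\<^sub>W monomial_in g u * monomial_in g v"
      unfolding monomial_in_wd wd_mult map_append[symmetric]
      by (rule wd_perm[OF g mset_letters_plus])
    from weq_mult_left[OF this, of "free_const (a * b)"] show ?case
      by (simp add: Poly_Mapping.mult_single free_const_mult mult.assoc)
         (metis (no_types, lifting) free_const_commute mult.assoc)
  next
    case (sum q q')
    then show ?case by (simp add: distrib_left poly_in_add weq_add)
  qed
next
  case (sum p p')
  then show ?case by (simp add: distrib_right poly_in_add weq_add)
qed

subsection \<open>The classes of operators in the hypergeometric module\<close>

lemma weyl_class_add: "weyl_class (P + Q) = weyl_class P \<oplus>\<^bsub>weyl_algebra\<^esub> weyl_class Q"
  using ring_hom_add[OF ideal.rcos_ring_hom[OF ideal_weyl_ideal], of P Q]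
  by (simp add: weyl_class_def weyl_algebra_def)

lemma weyl_class_mult: "weyl_class (P * Q) = weyl_class P \<otimes>\<^bsub>weyl_algebra\<^esub> weyl_class Q"
  using ring_hom_mult[OF ideal.rcos_ring_hom[OF ideal_weyl_ideal], of P Q]
  by (simp add: weyl_class_def weyl_algebra_def)

lemma ring_weyl_algebra: "Ring.ring (weyl_algebra :: ('n, 'k::field) free_alg set ring)"
  unfolding weyl_algebra_def by (rule ideal.quotient_is_ring[OF ideal_weyl_ideal])

lemma carrier_weyl_algebra: "carrier weyl_algebra = range weyl_class"
  by (auto simp: weyl_algebra_def FactRing_def A_RCOSETS_def' weyl_class_def)

lemma weyl_class_eq_iff: "weyl_class P = weyl_class Q \<longleftrightarrow> P =\<^sub>W Q"
proof -
  interpret W: ideal "weyl_ideal :: ('a, 'b) free_alg set" ring_of by (rule ideal_weyl_ideal)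
  show ?thesis
    using W.quotient_eq_iff_same_a_r_cos[OF ideal_weyl_ideal, of P Q]
    by (simp add: weyl_class_def weq_def a_minus_def)
qed

lemma weyl_class_0: "weyl_class 0 = \<zero>\<^bsub>weyl_algebra\<^esub>"
proof -
  interpret R: Ring.ring "weyl_algebra :: ('a, 'b) free_alg set ring" by (rule ring_weyl_algebra)
  have "weyl_class (0 :: ('a, 'b) free_alg) \<in> carrier weyl_algebra" by (simp add: carrier_weyl_algebra)
  moreover have "weyl_class (0 :: ('a, 'b) free_alg) \<oplus>\<^bsub>weyl_algebra\<^esub> weyl_class 0 = weyl_class 0"
    by (simp flip: weyl_class_add)
  ultimately show ?thesis by (simp add: R.add.l_cancel_one')
qed

lemma weyl_class_minus: "weyl_class (- P) = \<ominus>\<^bsub>weyl_algebra\<^esub> weyl_class P"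
proof -
  interpret R: Ring.ring "weyl_algebra :: ('a, 'b) free_alg set ring" by (rule ring_weyl_algebra)
  show ?thesis
    by (rule R.minus_equality[symmetric])
       (auto simp flip: weyl_class_add simp: weyl_class_0 carrier_weyl_algebra)
qed

lemma left_ideal_generated:
  assumes R: "Ring.ring R" and S: "S \<subseteq> carrier R"
  shows "additive_subgroup (left_ideal_generated R S) R"
    and "\<And>r a. r \<in> carrier R \<Longrightarrow> a \<in> left_ideal_generated R S \<Longrightarrow> r \<otimes>\<^bsub>R\<^esub> a \<in> left_ideal_generated R S"
    and "S \<subseteq> left_ideal_generated R S"
proof -
  interpret R: Ring.ring R by (rule R)
  let ?F = "{J. additive_subgroup J R \<and> (\<forall>r\<in>carrier R. \<forall>a\<in>J. r \<otimes>\<^bsub>R\<^esub> a \<in> J) \<and> S \<subseteq> J}"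
  have "additive_subgroup (carrier R) R"
    by (rule additive_subgroupI) (use R.add.subgroup_self in simp)
  then have ne: "carrier R \<in> ?F" using S by auto
  have "subgroup (\<Inter>?F) (add_monoid R)"
    by (rule R.add.subgroups_Inter) (use ne in \<open>auto dest: additive_subgroup.a_subgroup\<close>)
  then show "additive_subgroup (left_ideal_generated R S) R"
    unfolding left_ideal_generated_def by (rule additive_subgroupI)
qed (unfold left_ideal_generated_def, blast+)

context
  fixes A :: "int ^ 'n::{finite,linorder} ^ 'd::finite" and \<beta> :: "'k::field ^ 'd"
begin

text \<open>The left ideal of the free algebra that maps onto the hypergeometric ideal.\<close>

definition hfree :: "('n, 'k) free_alg set" where
  "hfree = {P. weyl_class P \<in> hypergeometric_ideal A \<beta>}"

text \<open>The class of an operator in the hypergeometric module.\<close>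

definition hclass :: "('n, 'k) free_alg \<Rightarrow> ('n, 'k) free_alg set set" where
  "hclass P = hypergeometric_ideal A \<beta> +>\<^bsub>regular_module weyl_algebra\<^esub> weyl_class P"

text \<open>The hypergeometric module as a module over the polynomials in \<open>x\<close>.\<close>

definition xmodule :: "(('n, 'k) mpoly, ('n, 'k) free_alg set set) module" where
  "xmodule = restrict_scalars (\<lambda>p. weyl_class (poly_in GenX p)) (hypergeometric_module A \<beta>)"

lemma
  shows hyp_subgroup: "additive_subgroup (hypergeometric_ideal A \<beta>) weyl_algebra"
    and hyp_left: "\<And>r a. r \<in> carrier weyl_algebra \<Longrightarrow> a \<in> hypergeometric_ideal A \<beta> \<Longrightarrow>
        r \<otimes>\<^bsub>weyl_algebra\<^esub> a \<in> hypergeometric_ideal A \<beta>"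
    and hyp_gens: "weyl_class ` (poly_in GenD ` toric_ideal A \<union> range (euler_op A \<beta>))
        \<subseteq> hypergeometric_ideal A \<beta>"
proof -
  have "weyl_class ` (poly_in GenD ` toric_ideal A \<union> range (euler_op A \<beta>)) \<subseteq> carrier weyl_algebra"
    by (auto simp: carrier_weyl_algebra)
  note * = left_ideal_generated[OF ring_weyl_algebra this, folded hypergeometric_ideal_def]
  from * show "additive_subgroup (hypergeometric_ideal A \<beta>) weyl_algebra"
    and "\<And>r a. r \<in> carrier weyl_algebra \<Longrightarrow> a \<in> hypergeometric_ideal A \<beta> \<Longrightarrow>
        r \<otimes>\<^bsub>weyl_algebra\<^esub> a \<in> hypergeometric_ideal A \<beta>"
    and "weyl_class ` (poly_in GenD ` toric_ideal A \<union> range (euler_op A \<beta>))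
        \<subseteq> hypergeometric_ideal A \<beta>" by blast+
qed

lemma hfree_add: "P \<in> hfree \<Longrightarrow> Q \<in> hfree \<Longrightarrow> P + Q \<in> hfree"
  using additive_subgroup.a_closed[OF hyp_subgroup] by (simp add: hfree_def weyl_class_add)

lemma hfree_minus: "P \<in> hfree \<Longrightarrow> - P \<in> hfree"
  using additive_subgroup.a_inv_closed[OF hyp_subgroup]
  by (simp add: hfree_def weyl_class_minus)

lemma hfree_mult_left: "P \<in> hfree \<Longrightarrow> Q * P \<in> hfree"
  using hyp_left by (simp add: hfree_def weyl_class_mult carrier_weyl_algebra)

lemma hfree_weyl: "P \<in> weyl_ideal \<Longrightarrow> P \<in> hfree"
proof -
  assume "P \<in> weyl_ideal"
  then have "weyl_class P = weyl_class 0" by (simp add: weyl_class_eq_iff weq_def)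
  then show "P \<in> hfree"
    using additive_subgroup.zero_closed[OF hyp_subgroup] by (simp add: hfree_def weyl_class_0)
qed

lemma hfree_toric: "p \<in> toric_ideal A \<Longrightarrow> poly_in GenD p \<in> hfree"
  using hyp_gens by (auto simp: hfree_def)

lemma hfree_euler: "euler_op A \<beta> i \<in> hfree"
  using hyp_gens by (auto simp: hfree_def)

text \<open>Induction over the left ideal: it is the smallest left ideal of the free algebra that contains
  the relations of the Weyl algebra and the generators of the hypergeometric system.\<close>

lemma hfree_minimal:
  assumes weyl: "weyl_ideal \<subseteq> J" and toric: "\<And>p. p \<in> toric_ideal A \<Longrightarrow> poly_in GenD p \<in> J"
    and euler: "\<And>i. euler_op A \<beta> i \<in> J"
    and add: "\<And>P Q. P \<in> J \<Longrightarrow> Q \<in> J \<Longrightarrow> P + Q \<in> J" and mult: "\<And>P Q. P \<in> J \<Longrightarrow> Q * P \<in> J"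
  shows "hfree \<subseteq> J"
proof
  fix P assume P: "P \<in> hfree"
  have minus: "- P \<in> J" if "P \<in> J" for P using mult[OF that, of "- 1"] by simp
  have "additive_subgroup (weyl_class ` J) weyl_algebra"
  proof (rule additive_subgroupI)
    interpret R: Ring.ring "weyl_algebra :: ('n, 'k) free_alg set ring" by (rule ring_weyl_algebra)
    show "subgroup (weyl_class ` J) (add_monoid weyl_algebra)"
    proof (rule group.subgroupI[OF R.add.is_group])
      show "weyl_class ` J \<noteq> {}" using euler by blast
      show "inv\<^bsub>add_monoid weyl_algebra\<^esub> a \<in> weyl_class ` J" if a: "a \<in> weyl_class ` J" for a
      proof -
        from a obtain Q where "Q \<in> J" "a = weyl_class Q" by blast
        then show ?thesis
          using minus weyl_class_minus[of Q] by (auto simp: a_inv_def intro!: image_eqI[of _ _ "- Q"])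
      qed
      show "a \<otimes>\<^bsub>add_monoid weyl_algebra\<^esub> b \<in> weyl_class ` J"
        if "a \<in> weyl_class ` J" "b \<in> weyl_class ` J" for a b
        using that add by (auto simp flip: weyl_class_add)
    qed (auto simp: carrier_weyl_algebra)
  qed
  moreover have "\<forall>r\<in>carrier weyl_algebra. \<forall>a\<in>weyl_class ` J. r \<otimes>\<^bsub>weyl_algebra\<^esub> a \<in> weyl_class ` J"
    using mult by (auto simp: carrier_weyl_algebra simp flip: weyl_class_mult)
  moreover have "weyl_class ` (poly_in GenD ` toric_ideal A \<union> range (euler_op A \<beta>)) \<subseteq> weyl_class ` J"
    using toric euler by auto
  ultimately have "hypergeometric_ideal A \<beta> \<subseteq> weyl_class ` J"
    unfolding hypergeometric_ideal_def left_ideal_generated_def by blast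
  then obtain Q where "Q \<in> J" "weyl_class P = weyl_class Q" using P by (auto simp: hfree_def)
  then have "P - Q \<in> J" using weyl by (auto simp: weyl_class_eq_iff weq_def)
  from add[OF this \<open>Q \<in> J\<close>] show "P \<in> J" by simp
qed

lemma regular_module_simps [simp]:
  "carrier (regular_module R) = carrier R" "add (regular_module R) = add R"
  "zero (regular_module R) = zero R" "smult (regular_module R) = monoid.mult R"
  by (simp_all add: regular_module_def)

lemma xmodule_simps:
  "carrier xmodule = a_rcosets\<^bsub>regular_module weyl_algebra\<^esub> (hypergeometric_ideal A \<beta>)"
  "add xmodule = set_add (regular_module weyl_algebra)"
  "smult xmodule p X = smult (quotient_module (regular_module weyl_algebra)
      (hypergeometric_ideal A \<beta>)) (weyl_class (poly_in GenX p)) X"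
  by (simp_all add: xmodule_def restrict_scalars_def hypergeometric_module_def)

lemma reg_minus: "\<ominus>\<^bsub>regular_module R\<^esub> x = \<ominus>\<^bsub>R\<^esub> x"
  by (simp add: a_inv_def m_inv_def)

lemma
  shows reg_group: "abelian_group (regular_module weyl_algebra :: (('n,'k) free_alg set, _) module)"
    and reg_subgroup: "additive_subgroup (hypergeometric_ideal A \<beta>) (regular_module weyl_algebra)"
proof -
  interpret R: Ring.ring "weyl_algebra :: ('n, 'k) free_alg set ring" by (rule ring_weyl_algebra)
  show "abelian_group (regular_module weyl_algebra :: (('n,'k) free_alg set, _) module)"
  proof (rule abelian_groupI)
    fix x :: "('n, 'k) free_alg set" assume "x \<in> carrier (regular_module weyl_algebra)"
    then show "\<exists>y\<in>carrier (regular_module weyl_algebra).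
        y \<oplus>\<^bsub>regular_module weyl_algebra\<^esub> x = \<zero>\<^bsub>regular_module weyl_algebra\<^esub>"
      by (intro bexI[of _ "\<ominus>\<^bsub>weyl_algebra\<^esub> x"]) (simp_all add: R.l_neg)
  qed (simp_all add: R.a_ac)
  interpret H: additive_subgroup "hypergeometric_ideal A \<beta>" weyl_algebra by (rule hyp_subgroup)
  have "inv\<^bsub>add_monoid (regular_module weyl_algebra)\<^esub> x \<in> hypergeometric_ideal A \<beta>"
    if "x \<in> hypergeometric_ideal A \<beta>" for x
    using H.a_inv_closed[OF that] reg_minus[of weyl_algebra x]
    by (simp add: a_inv_def)
  then show "additive_subgroup (hypergeometric_ideal A \<beta>) (regular_module weyl_algebra)"
    by (intro additive_subgroupI subgroup.intro) (use H.a_subset in auto)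
qed

lemma reg_abelian_subgroup: "abelian_subgroup (hypergeometric_ideal A \<beta>) (regular_module weyl_algebra)"
  by (rule abelian_subgroupI3[OF reg_subgroup reg_group])

lemma carrier_xmodule: "carrier xmodule = range hclass"
  by (auto simp: xmodule_simps carrier_quotient_module carrier_weyl_algebra hclass_def)

lemma add_xmodule: "hclass P \<oplus>\<^bsub>xmodule\<^esub> hclass Q = hclass (P + Q)"
  using abelian_subgroup.a_rcos_sum[OF reg_abelian_subgroup, of "weyl_class P" "weyl_class Q"]
  by (simp add: xmodule_simps hclass_def weyl_class_add carrier_weyl_algebra)

lemma hclass_eq_iff: "hclass P = hclass Q \<longleftrightarrow> P - Q \<in> hfree"
proof -
  interpret H: abelian_subgroup "hypergeometric_ideal A \<beta>" "regular_module weyl_algebra"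
    by (rule reg_abelian_subgroup)
  have "hclass P = hclass Q \<longleftrightarrow> weyl_class P \<in> hclass Q"
    using H.a_rcos_self[of "weyl_class P"] H.a_repr_independence[of "weyl_class P" _ "weyl_class Q"]
      H.a_subgroup
    by (auto simp: hclass_def carrier_weyl_algebra)
  also have "\<dots> \<longleftrightarrow> weyl_class P \<ominus>\<^bsub>regular_module weyl_algebra\<^esub> weyl_class Q \<in> hypergeometric_ideal A \<beta>"
    using H.a_rcos_module[of "weyl_class Q" "weyl_class P"]
    by (simp add: hclass_def carrier_weyl_algebra a_minus_def)
  also have "\<dots> \<longleftrightarrow> P - Q \<in> hfree"
    by (simp add: hfree_def a_minus_def reg_minus weyl_class_add[of P "- Q", simplified] weyl_class_minus)
  finally show ?thesis .
qed

lemma smult_xmodule: "p \<odot>\<^bsub>xmodule\<^esub> hclass P = hclass (poly_in GenX p * P)"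
proof -
  interpret R: Ring.ring "weyl_algebra :: ('n, 'k) free_alg set ring" by (rule ring_weyl_algebra)
  have sub: "hypergeometric_ideal A \<beta> \<subseteq> carrier weyl_algebra"
    using additive_subgroup.a_subset[OF hyp_subgroup] .
  have "smult (quotient_module (regular_module weyl_algebra) (hypergeometric_ideal A \<beta>))
      (weyl_class (poly_in GenX p)) (hypergeometric_ideal A \<beta> +>\<^bsub>regular_module weyl_algebra\<^esub> weyl_class P) =
    hypergeometric_ideal A \<beta> +>\<^bsub>regular_module weyl_algebra\<^esub>
      (weyl_class (poly_in GenX p) \<odot>\<^bsub>regular_module weyl_algebra\<^esub> weyl_class P)"
  proof (rule quotient_smult[OF reg_group reg_subgroup])
    have c: "weyl_class Q \<in> carrier weyl_algebra" for Q :: "('n, 'k) free_alg"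
      by (simp add: carrier_weyl_algebra)
    then show "weyl_class P \<in> carrier (regular_module weyl_algebra)" by simp
    show "weyl_class (poly_in GenX p) \<odot>\<^bsub>regular_module weyl_algebra\<^esub> y \<in> carrier (regular_module weyl_algebra)"
      if "y \<in> carrier (regular_module weyl_algebra)" for y using that c by simp
    show "weyl_class (poly_in GenX p) \<odot>\<^bsub>regular_module weyl_algebra\<^esub> n \<in> hypergeometric_ideal A \<beta>"
      if "n \<in> hypergeometric_ideal A \<beta>" for n using that c hyp_left by simp
    show "weyl_class (poly_in GenX p) \<odot>\<^bsub>regular_module weyl_algebra\<^esub> (n \<oplus>\<^bsub>regular_module weyl_algebra\<^esub> weyl_class P) =
        weyl_class (poly_in GenX p) \<odot>\<^bsub>regular_module weyl_algebra\<^esub> n \<oplus>\<^bsub>regular_module weyl_algebra\<^esub>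
        weyl_class (poly_in GenX p) \<odot>\<^bsub>regular_module weyl_algebra\<^esub> weyl_class P"
      if "n \<in> hypergeometric_ideal A \<beta>" for n
      using that c sub R.r_distr[of n "weyl_class P" "weyl_class (poly_in GenX p)"] by (simp add: subset_iff)
  qed
  then show ?thesis
    by (simp add: xmodule_simps hclass_def weyl_class_mult)
qed

end

section \<open>Simplicial configurations\<close>

lemma matrix_vector_mult_axis: "M *v axis k 1 = (\<chi> i. M $ i $ k)" for M :: "'a::comm_ring_1 ^ 'n::finite ^ 'm"
  by (simp add: matrix_vector_mult_def axis_def vec_eq_iff if_distrib[of "\<lambda>x. _ * x"] cong: if_cong)

text \<open>A configuration \<open>A\<close> together with the indices \<open>vtx v\<close> of the vertices of a simplex that
  contains all its columns; \<open>\<kappa> j\<close> are the barycentric coordinates of the column \<open>j\<close>.\<close>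

locale simplicial =
  fixes A :: "int ^ 'n::{finite,linorder} ^ 'd::finite" and vtx :: "'d \<Rightarrow> 'n" and \<kappa> :: "'n \<Rightarrow> 'd \<Rightarrow> rat"
  assumes coords: "\<And>i j. rat_of_int (A $ i $ j) = (\<Sum>v\<in>UNIV. \<kappa> j v * rat_of_int (A $ i $ vtx v))"
    and nonneg: "\<And>j v. \<kappa> j v \<ge> 0"
    and sum1: "\<And>j. (\<Sum>v\<in>UNIV. \<kappa> j v) = 1"
    and det_vtx: "det (\<chi> i v. A $ i $ vtx v) \<noteq> (0 :: int)"
begin

text \<open>The matrix whose columns are the vertices.\<close>

definition Bmat :: "'a::field_char_0 ^ 'd ^ 'd" where
  "Bmat = (\<chi> i v. of_int (A $ i $ vtx v))"

text \<open>Coordinates with respect to the vertices.\<close>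

definition vc :: "'a::field_char_0 ^ 'd \<Rightarrow> 'a ^ 'd" where
  "vc x = matrix_inv Bmat *v x"

lemma det_of_int_matrix: "det (\<chi> i v. of_int (M $ i $ v) :: 'a::field_char_0 ^ 'm::finite ^ 'm) = of_int (det M)"
  by (simp add: det_def)

lemma invertible_Bmat: "invertible (Bmat :: 'a::field_char_0 ^ 'd ^ 'd)"
proof -
  have "det (Bmat :: 'a ^ 'd ^ 'd) = of_int (det (\<chi> i v. A $ i $ vtx v))"
    using det_of_int_matrix[of "\<chi> i v. A $ i $ vtx v"] by (simp add: Bmat_def)
  then show ?thesis using det_vtx by (simp add: invertible_det_nz)
qed

lemma
  shows Bmat_vc: "Bmat *v vc x = (x :: 'a::field_char_0 ^ 'd)"
    and vc_Bmat: "vc (Bmat *v y) = (y :: 'a::field_char_0 ^ 'd)"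
proof -
  have "(Bmat :: 'a ^ 'd ^ 'd) ** matrix_inv Bmat = mat 1 \<and> matrix_inv Bmat ** (Bmat :: 'a ^ 'd ^ 'd) = mat 1"
    unfolding matrix_inv_def using invertible_Bmat unfolding invertible_def by (rule someI_ex)
  then show "Bmat *v vc x = x" "vc (Bmat *v y) = y"
    by (simp_all add: vc_def matrix_vector_mul_assoc)
qed

lemma vc_add: "vc (x + y) = vc x + vc y"
  by (simp add: vc_def matrix_vector_right_distrib)

lemma vc_diff: "vc (x - y) = vc x - vc y"
  by (simp add: vc_def matrix_vector_mult_diff_distrib)

lemma vc_inj: "vc x = vc y \<longleftrightarrow> x = y"
  by (metis Bmat_vc)

lemma coords_field: "(of_int (A $ i $ j) :: 'a::field_char_0) =
    (\<Sum>v\<in>UNIV. of_int (A $ i $ vtx v) * of_rat (\<kappa> j v))"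
proof -
  have "(of_int (A $ i $ j) :: 'a) = of_rat (rat_of_int (A $ i $ j))" by simp
  also have "\<dots> = (\<Sum>v\<in>UNIV. of_int (A $ i $ vtx v) * of_rat (\<kappa> j v))"
    by (subst coords) (simp add: of_rat_sum of_rat_mult mult.commute)
  finally show ?thesis .
qed

lemma vc_acol: "vc (acol A j :: 'a::field_char_0 ^ 'd) $ v = of_rat (\<kappa> j v)"
proof -
  have "acol A j = Bmat *v (\<chi> v. of_rat (\<kappa> j v) :: 'a ^ 'd)"
    by (auto simp: acol_def Bmat_def matrix_vector_mult_def vec_eq_iff intro: coords_field)
  then show ?thesis by (simp add: vc_Bmat)
qed

lemma kappa_vtx: "\<kappa> (vtx w) v = (if v = w then 1 else 0)"
proof -
  have "Bmat *v (axis w 1 :: rat ^ 'd) = acol A (vtx w)"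
    by (simp add: acol_def Bmat_def matrix_vector_mult_axis)
  then have "vc (acol A (vtx w)) = (axis w 1 :: rat ^ 'd)" by (metis vc_Bmat)
  then show ?thesis using vc_acol[of "vtx w" v, where ?'a = rat] by (simp add: axis_def)
qed

lemma inj_vtx: "inj vtx"
  by (rule injI) (metis kappa_vtx one_neq_zero)

text \<open>Multisets of columns stand for elements of the monoid \<open>\<nat>A\<close>.\<close>

definition asum :: "'n multiset \<Rightarrow> 'a::ring_1 ^ 'd" where
  "asum \<alpha> = (\<Sum>j\<in>#\<alpha>. acol A j)"

text \<open>The coordinates of \<open>asum \<alpha>\<close> with respect to the vertices; they are rational.\<close>

definition kc :: "'n multiset \<Rightarrow> 'd \<Rightarrow> rat" where
  "kc \<alpha> v = (\<Sum>j\<in>#\<alpha>. \<kappa> j v)"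

lemma asum_simps [simp]: "asum {#} = 0" "asum (add_mset j \<alpha>) = acol A j + asum \<alpha>" "asum (\<alpha> + \<alpha>') = asum \<alpha> + asum \<alpha>'"
  by (simp_all add: asum_def)

lemma kc_simps [simp]: "kc {#} v = 0" "kc (add_mset j \<alpha>) v = \<kappa> j v + kc \<alpha> v"
    "kc (\<alpha> + \<alpha>') v = kc \<alpha> v + kc \<alpha>' v"
  by (simp_all add: kc_def)

lemma kc_nonneg: "kc \<alpha> v \<ge> 0"
  by (induction \<alpha>) (simp_all add: nonneg)

lemma kc_vtx: "kc (image_mset vtx m) v = of_nat (count m v)"
  by (induction m) (auto simp: kappa_vtx)

lemma vc_asum: "vc (asum \<alpha>) $ v = of_rat (kc \<alpha> v)"
proof (induction \<alpha>)
  case empty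
  show ?case by (simp add: vc_def)
next
  case (add j \<alpha>)
  then show ?case by (simp add: vc_add vc_acol of_rat_add)
qed

lemma of_int_asum: "(\<chi> i. of_int (asum \<alpha> $ i)) = asum \<alpha>"
  by (induction \<alpha>) (simp_all add: vec_eq_iff acol_def)

lemma asum_eq_iff:
  "(asum \<alpha> :: 'a::field_char_0 ^ 'd) = asum \<alpha>' \<longleftrightarrow> (\<forall>v. kc \<alpha> v = kc \<alpha>' v)"
proof -
  have "(asum \<alpha> :: 'a ^ 'd) = asum \<alpha>' \<longleftrightarrow> vc (asum \<alpha> :: 'a ^ 'd) = vc (asum \<alpha>')"
    by (rule vc_inj[symmetric])
  then show ?thesis by (simp add: vec_eq_iff vc_asum)
qed

lemma asum_int_eq_iff: "(asum \<alpha> :: int ^ 'd) = asum \<alpha>' \<longleftrightarrow> (\<forall>v. kc \<alpha> v = kc \<alpha>' v)"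
proof -
  have "(asum \<alpha> :: int ^ 'd) = asum \<alpha>' \<longleftrightarrow> (asum \<alpha> :: rat ^ 'd) = asum \<alpha>'"
    unfolding of_int_asum[symmetric, where ?'a = rat] by (simp add: vec_eq_iff)
  then show ?thesis by (simp add: asum_eq_iff)
qed

end

subsection \<open>Relations between classes of operators\<close>

text \<open>The operator \<open>\<Sum> a\<^sub>j x\<^sub>j \<partial>\<^sub>j\<close>.\<close>

definition theta :: "('n::finite \<Rightarrow> 'k) \<Rightarrow> ('n, 'k::field) free_alg" where
  "theta a = (\<Sum>j\<in>UNIV. free_const (a j) * wd [GenX j, GenD j])"

lemma weq_sum: "(\<And>i. i \<in> S \<Longrightarrow> f i =\<^sub>W g i) \<Longrightarrow> sum f S =\<^sub>W sum g S"
  by (induction S rule: infinite_finite_induct) (auto intro: weq_add)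

lemma mult_free_const: "P * (free_const c * Q) = free_const c * (P * Q)"
  by (metis free_const_commute mult.assoc)

text \<open>The commutation rule \<open>\<partial>\<^sup>\<alpha> \<theta> = (\<theta> + \<Sum>\<^sub>j \<alpha>\<^sub>j a\<^sub>j) \<partial>\<^sup>\<alpha>\<close> for \<open>\<theta> = \<Sum> a\<^sub>j x\<^sub>j \<partial>\<^sub>j\<close>.\<close>

lemma wd_theta:
  "wd (map GenD js) * theta a =\<^sub>W theta a * wd (map GenD js) + free_const (\<Sum>j\<leftarrow>js. a j) * wd (map GenD js)"
proof (induction js)
  case Nil
  show ?case by (simp add: wd_Nil)
next
  case (Cons k js)
  have one: "wd [GenD k] * theta a =\<^sub>W theta a * wd [GenD k] + free_const (a k) * wd [GenD k]"
  proof -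
    have step: "wd [GenD k, GenX j, GenD j] =\<^sub>W wd [GenX j, GenD j, GenD k] + (if k = j then wd [GenD k] else 0)"
      for j
    proof -
      have "wd [GenD k, GenX j, GenD j] = wd [GenD k, GenX j] * wd [GenD j]" by simp
      also have "\<dots> =\<^sub>W (wd [GenX j, GenD k] + (if k = j then 1 else 0)) * wd [GenD j]"
        by (rule weq_mult_right[OF wd_DX])
      also have "\<dots> = wd [GenX j] * wd [GenD k, GenD j] + (if k = j then wd [GenD k] else 0)"
        by (simp add: distrib_right)
      also have "\<dots> =\<^sub>W wd [GenX j] * wd [GenD j, GenD k] + (if k = j then wd [GenD k] else 0)"
        by (intro weq_add weq_mult_left wd_swap weq_refl) simp
      finally show ?thesis by simp
    qed
    have "wd [GenD k] * theta a = (\<Sum>j\<in>UNIV. free_const (a j) * wd [GenD k, GenX j, GenD j])"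
      by (simp add: theta_def sum_distrib_left mult_free_const)
    also have "\<dots> =\<^sub>W (\<Sum>j\<in>UNIV. free_const (a j) * (wd [GenX j, GenD j, GenD k] + (if k = j then wd [GenD k] else 0)))"
      by (intro weq_sum weq_mult_left step)
    also have "\<dots> = (\<Sum>j\<in>UNIV. free_const (a j) * wd [GenX j, GenD j, GenD k]) + free_const (a k) * wd [GenD k]"
      by (simp add: distrib_left sum.distrib if_distrib[of "\<lambda>x. _ * x"] cong: if_cong)
    also have "\<dots> = theta a * wd [GenD k] + free_const (a k) * wd [GenD k]"
      by (simp add: theta_def sum_distrib_right mult.assoc)
    finally show ?thesis .
  qed
  have "wd (map GenD (k # js)) * theta a = wd [GenD k] * (wd (map GenD js) * theta a)"
    by (simp flip: mult.assoc)
  also have "\<dots> =\<^sub>W wd [GenD k] * (theta a * wd (map GenD js) + free_const (\<Sum>j\<leftarrow>js. a j) * wd (map GenD js))"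
    by (rule weq_mult_left[OF Cons])
  also have "\<dots> = (wd [GenD k] * theta a) * wd (map GenD js) + free_const (\<Sum>j\<leftarrow>js. a j) * wd (map GenD (k # js))"
    by (simp add: distrib_left mult.assoc mult_free_const)
  also have "\<dots> =\<^sub>W (theta a * wd [GenD k] + free_const (a k) * wd [GenD k]) * wd (map GenD js)
      + free_const (\<Sum>j\<leftarrow>js. a j) * wd (map GenD (k # js))"
    by (intro weq_add weq_mult_right one weq_refl)
  also have "\<dots> = theta a * wd (map GenD (k # js)) + free_const (\<Sum>j\<leftarrow>k # js. a j) * wd (map GenD (k # js))"
    by (simp add: distrib_right mult.assoc free_const_add)
  finally show ?case .
qed

lemma euler_op_theta: "euler_op A \<beta> i = theta (\<lambda>j. of_int (A $ i $ j)) - free_const (\<beta> $ i)"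
  by (simp add: euler_op_def theta_def free_gen_wd mult.assoc)

text \<open>Modulo the hypergeometric ideal, the Euler vector fields act on \<open>\<partial>\<^sup>\<alpha>\<close> as scalars, namely the
  entries of \<open>\<beta> - A \<alpha>\<close>.\<close>

lemma hfree_theta:
  "theta (\<lambda>j. of_int (A $ i $ j)) * wd (map GenD js)
     - free_const (\<beta> $ i - (\<Sum>j\<leftarrow>js. of_int (A $ i $ j))) * wd (map GenD js) \<in> hfree A \<beta>"
proof -
  let ?t = "theta (\<lambda>j. of_int (A $ i $ j))" and ?w = "wd (map GenD js)"
    and ?s = "free_const (\<Sum>j\<leftarrow>js. of_int (A $ i $ j))"
  have "?w * ?t - (?t * ?w + ?s * ?w) \<in> hfree A \<beta>"
    using wd_theta[of js] by (intro hfree_weyl) (simp add: weq_def)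
  from hfree_minus[OF this] hfree_mult_left[OF hfree_euler, of ?w A \<beta> i]
  have "- (?w * ?t - (?t * ?w + ?s * ?w)) + ?w * (?t - free_const (\<beta> $ i)) \<in> hfree A \<beta>"
    unfolding euler_op_theta by (rule hfree_add)
  also have "- (?w * ?t - (?t * ?w + ?s * ?w)) + ?w * (?t - free_const (\<beta> $ i)) =
      ?t * ?w - free_const (\<beta> $ i - (\<Sum>j\<leftarrow>js. of_int (A $ i $ j))) * ?w"
  proof -
    have "?w * free_const (\<beta> $ i) = free_const ((\<beta> $ i - (\<Sum>j\<leftarrow>js. of_int (A $ i $ j))) + (\<Sum>j\<leftarrow>js. of_int (A $ i $ j))) * ?w"
      by (simp add: free_const_commute)
    also have "\<dots> = free_const (\<beta> $ i - (\<Sum>j\<leftarrow>js. of_int (A $ i $ j))) * ?w + ?s * ?w"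
      by (simp only: free_const_add distrib_right)
    finally show ?thesis by (simp add: right_diff_distrib)
  qed
  finally show ?thesis .
qed

text \<open>Modulo the hypergeometric ideal, a monomial in the derivations depends only on the sum of the
  corresponding columns.\<close>

lemma hfree_swap_sum:
  fixes A :: "int ^ 'b::{finite,linorder} ^ 'd::finite"
  assumes "(\<Sum>j\<leftarrow>js. acol A j :: int ^ 'd) = (\<Sum>j\<leftarrow>js'. acol A j)"
  shows "wd (map GenD js) - wd (map GenD js') \<in> hfree A (\<beta> :: 'k::field ^ 'd)"
proof -
  define u where "u js = (Abs_poly_mapping (count_list js) :: 'b \<Rightarrow>\<^sub>0 nat)" for js :: "'b list"
  have u: "Poly_Mapping.lookup (u js) = count_list js" for js :: "'b list"
    unfolding u_def by (rule Abs_poly_mapping_inverse) simp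
  have col: "A *v (\<chi> j. int (Poly_Mapping.lookup (u js) j)) = (\<Sum>j\<leftarrow>js. acol A j)" for js
  proof (induction js)
    case Nil
    show ?case by (simp add: vec_eq_iff matrix_vector_mult_def u)
  next
    case (Cons k js)
    have "A *v (\<chi> j. int (Poly_Mapping.lookup (u (k # js)) j)) =
        A *v (axis k 1) + A *v (\<chi> j. int (Poly_Mapping.lookup (u js) j))"
      unfolding matrix_vector_right_distrib[symmetric]
      by (rule arg_cong[of _ _ "\<lambda>x. A *v x"]) (auto simp: vec_eq_iff axis_def u)
    also have "A *v (axis k 1) = acol A k"
      by (simp add: matrix_vector_mult_axis acol_def)
    finally show ?case using Cons by simp
  qed
  have perm: "wd (map GenD (letters (u js))) =\<^sub>W (wd (map GenD js) :: ('b, 'k) free_alg)" for js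
  proof (rule wd_perm)
    show "mset (letters (u js)) = mset js"
      by (rule multiset_eqI) (metis count_letters u count_mset)
  qed simp
  have "Poly_Mapping.single (u js) 1 - Poly_Mapping.single (u js') 1 \<in> (toric_ideal A :: ('b, 'k) mpoly set)"
  proof -
    have "{Poly_Mapping.single u 1 - Poly_Mapping.single v 1 | u v.
        A *v (\<chi> j. int (Poly_Mapping.lookup u j)) = A *v (\<chi> j. int (Poly_Mapping.lookup v j))}
        \<subseteq> (toric_ideal A :: ('b, 'k) mpoly set)"
      unfolding toric_ideal_def by (rule ring.genideal_self[OF ring_ring_of]) simp
    moreover have "A *v (\<chi> j. int (Poly_Mapping.lookup (u js) j)) = A *v (\<chi> j. int (Poly_Mapping.lookup (u js') j))"
      using assms by (simp add: col)
    ultimately show ?thesis by blast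
  qed
  from hfree_toric[OF this, of \<beta>]
  have *: "wd (map GenD (letters (u js))) - wd (map GenD (letters (u js'))) \<in> hfree A \<beta>"
    by (simp add: poly_in_diff monomial_in_wd)
  have h: "wd (map GenD (letters (u js))) - wd (map GenD js) \<in> hfree A \<beta>" for js
    using perm[of js] by (intro hfree_weyl) (simp add: weq_def)
  from hfree_add[OF hfree_add[OF * h[of js']] hfree_minus[OF h[of js]]] show ?thesis by simp
qed

section \<open>Evaluation of polynomials and the local ring of a point\<close>

context
  fixes x0 :: "'n::{finite,linorder} \<Rightarrow> 'k::field"
begin

text \<open>The value of a polynomial at the point \<open>x0\<close>.\<close>

definition ev :: "('n, 'k) mpoly \<Rightarrow> 'k" where
  "ev p = (\<Sum>u\<in>Poly_Mapping.keys p. Poly_Mapping.lookup p u * (\<Prod>j\<in>UNIV. x0 j ^ Poly_Mapping.lookup u j))"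

lemma ev_superset:
  assumes "finite S" "Poly_Mapping.keys p \<subseteq> S"
  shows "ev p = (\<Sum>u\<in>S. Poly_Mapping.lookup p u * (\<Prod>j\<in>UNIV. x0 j ^ Poly_Mapping.lookup u j))"
  unfolding ev_def by (rule sum.mono_neutral_left) (use assms in \<open>auto simp: in_keys_iff\<close>)

lemma ev_add: "ev (p + q) = ev p + ev q"
proof -
  let ?S = "Poly_Mapping.keys p \<union> Poly_Mapping.keys q"
  show ?thesis
    by (subst (1 2 3) ev_superset[of ?S])
       (use Poly_Mapping.keys_add[of p q] in \<open>auto simp: lookup_add distrib_right sum.distrib\<close>)
qed

lemma ev_single: "ev (Poly_Mapping.single u c) = c * (\<Prod>j\<in>UNIV. x0 j ^ Poly_Mapping.lookup u j)"
  by (subst ev_superset[of "{u}"]) auto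

lemma ev_0 [simp]: "ev 0 = 0"
  by (simp add: ev_def)

lemma ev_const [simp]: "ev (Poly_Mapping.single 0 c) = c"
  by (simp add: ev_single)

lemma ev_1 [simp]: "ev 1 = 1"
  using ev_const[of 1] by simp

lemma ev_var: "ev (Poly_Mapping.single (Poly_Mapping.single j 1) 1) = x0 j"
proof -
  have "(\<Prod>i\<in>UNIV. x0 i ^ Poly_Mapping.lookup (Poly_Mapping.single j 1) i) = (\<Prod>i\<in>UNIV. if i = j then x0 j else 1)"
    by (rule prod.cong) (auto simp: lookup_single when_def)
  then show ?thesis by (simp add: ev_single)
qed

lemma ev_mult: "ev (p * q) = ev p * ev q"
proof (induction p rule: poly_mapping_induct)
  case (single u a)
  show ?case
    by (induction q rule: poly_mapping_induct)
       (simp_all add: Poly_Mapping.mult_single ev_single lookup_add power_add prod.distrib distrib_left ev_add)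
qed (simp add: distrib_right ev_add)

lemma ev_minus: "ev (- p) = - ev p"
  using ev_add[of p "- p"] by (simp add: eq_neg_iff_add_eq_0 add.commute)

lemma ev_diff: "ev (p - q) = ev p - ev q"
  using ev_add[of p "- q"] by (simp add: ev_minus)

text \<open>The rational functions that are regular at the point \<open>x0\<close>, and those that vanish there.\<close>

definition locring :: "('n, 'k) mpoly fract set" where
  "locring = {Fract p q | p q. ev q \<noteq> 0}"

definition maxid :: "('n, 'k) mpoly fract set" where
  "maxid = {Fract p q | p q. ev p = 0 \<and> ev q \<noteq> 0}"

lemma ev_nz: "ev q \<noteq> 0 \<Longrightarrow> q \<noteq> 0"
  by auto

lemma maxidI: "ev p = 0 \<Longrightarrow> ev q \<noteq> 0 \<Longrightarrow> Fract p q \<in> maxid"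
  unfolding maxid_def by blast

lemma maxid_0: "0 \<in> maxid"
  unfolding Zero_fract_def by (rule maxidI) simp_all

lemma maxid_add: "a \<in> maxid \<Longrightarrow> b \<in> maxid \<Longrightarrow> a + b \<in> maxid"
proof -
  assume "a \<in> maxid" "b \<in> maxid"
  then obtain p q p' q' where "a = Fract p q" "b = Fract p' q'" "ev p = 0" "ev q \<noteq> 0" "ev p' = 0" "ev q' \<noteq> 0"
    by (auto simp: maxid_def)
  then show ?thesis
    using maxidI[of "p * q' + p' * q" "q * q'"] by (simp add: add_fract ev_nz ev_add ev_mult)
qed

lemma locring_mult_maxid: "a \<in> locring \<Longrightarrow> b \<in> maxid \<Longrightarrow> a * b \<in> maxid"
proof -
  assume "a \<in> locring" "b \<in> maxid"
  then obtain p q p' q' where "a = Fract p q" "b = Fract p' q'" "ev q \<noteq> 0" "ev p' = 0" "ev q' \<noteq> 0"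
    by (auto simp: maxid_def locring_def)
  then show ?thesis
    using maxidI[of "p * p'" "q * q'"] by (simp add: ev_nz ev_mult)
qed

lemma maxid_locring: "a \<in> maxid \<Longrightarrow> a \<in> locring"
  by (auto simp: maxid_def locring_def)

lemma maxid_inverse: "a \<in> maxid \<Longrightarrow> \<exists>w\<in>locring. w * (1 - a) = 1"
proof -
  assume "a \<in> maxid"
  then obtain p q where a: "a = Fract p q" "ev p = 0" "ev q \<noteq> 0" by (auto simp: maxid_def)
  then have "ev (q - p) \<noteq> 0" by (simp add: ev_diff)
  note nz = ev_nz[OF this] ev_nz[OF a(3)]
  have "1 - a = Fract (q - p) q" using nz a by (simp add: One_fract_def diff_fract)
  then have "Fract q (q - p) * (1 - a) = 1"
    using nz by (simp add: One_fract_def eq_fract mult.commute)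
  then show ?thesis using \<open>ev (q - p) \<noteq> 0\<close> by (auto simp: locring_def)
qed

text \<open>Constants and variables as rational functions.\<close>

definition cK :: "'k \<Rightarrow> ('n, 'k) mpoly fract" where
  "cK c = Fract (Poly_Mapping.single 0 c) 1"

definition xK :: "'n \<Rightarrow> ('n, 'k) mpoly fract" where
  "xK j = Fract (Poly_Mapping.single (Poly_Mapping.single j 1) 1) 1"

lemma cK_locring: "cK c \<in> locring"
  unfolding cK_def locring_def by (rule CollectI, intro exI conjI, rule refl) simp

lemma cK_add: "cK (a + b) = cK a + cK b"
  by (simp add: cK_def single_add)

lemma cK_mult: "cK (a * b) = cK a * cK b"
  by (simp add: cK_def Poly_Mapping.mult_single)

lemma cK_0 [simp]: "cK 0 = 0"
  by (simp add: cK_def Zero_fract_def)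

lemma cK_1 [simp]: "cK 1 = 1"
  by (simp add: cK_def fract_collapse)

lemma xK_diff_maxid: "xK j - cK (x0 j) \<in> maxid"
proof -
  have "xK j - cK (x0 j) = Fract (Poly_Mapping.single (Poly_Mapping.single j 1) 1 - Poly_Mapping.single 0 (x0 j)) 1"
    by (simp add: xK_def cK_def)
  then show ?thesis
    using maxidI[of "Poly_Mapping.single (Poly_Mapping.single j 1) 1 - Poly_Mapping.single 0 (x0 j)" 1]
      ev_var[of j] by (simp add: ev_diff)
qed

text \<open>Nakayama's lemma: vectors that reproduce themselves, up to a subspace, by a matrix with
  entries in the maximal ideal, belong to the subspace.\<close>

lemma nakayama:
  fixes e :: "'i \<Rightarrow> 'm \<Rightarrow>\<^sub>0 ('n, 'k) mpoly fract"
  assumes "finite X" "ps.subspace U"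
    and "\<And>s. s \<in> X \<Longrightarrow> \<exists>u\<in>U. \<exists>\<mu>. (\<forall>t\<in>X. \<mu> t \<in> maxid) \<and> e s = u + (\<Sum>t\<in>X. pscale (\<mu> t) (e t))"
  shows "\<forall>s\<in>X. e s \<in> U"
  using assms(1,3)
proof (induction X rule: finite_induct)
  case (insert r X)
  from insert.prems[of r] obtain u \<mu> where u: "u \<in> U" and \<mu>: "\<forall>t\<in>insert r X. \<mu> t \<in> maxid"
    and er: "e r = u + (\<Sum>t\<in>insert r X. pscale (\<mu> t) (e t))" by auto
  from maxid_inverse[of "\<mu> r"] \<mu> obtain w where w: "w \<in> locring" "w * (1 - \<mu> r) = 1" by auto
  define u' where "u' = pscale w u"
  define \<mu>' where "\<mu>' t = w * \<mu> t" for t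
  have u': "u' \<in> U" unfolding u'_def using u ps.subspace_scale[OF assms(2)] by blast
  have \<mu>': "\<mu>' t \<in> maxid" if "t \<in> X" for t
    unfolding \<mu>'_def using \<mu> w that by (auto intro: locring_mult_maxid)
  have "pscale (1 - \<mu> r) (e r) = u + (\<Sum>t\<in>X. pscale (\<mu> t) (e t))"
    using er insert.hyps by (simp add: ps.scale_left_diff_distrib algebra_simps)
  then have "pscale w (pscale (1 - \<mu> r) (e r)) = pscale w (u + (\<Sum>t\<in>X. pscale (\<mu> t) (e t)))" by simp
  then have er': "e r = u' + (\<Sum>t\<in>X. pscale (\<mu>' t) (e t))"
    using w by (simp add: u'_def \<mu>'_def ps.scale_right_distrib ps.scale_sum_right)
  have "\<forall>s\<in>X. e s \<in> U"
  proof (rule insert.IH)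
    fix s assume s: "s \<in> X"
    from insert.prems[of s] s obtain v \<nu> where v: "v \<in> U" and \<nu>: "\<forall>t\<in>insert r X. \<nu> t \<in> maxid"
      and es: "e s = v + (\<Sum>t\<in>insert r X. pscale (\<nu> t) (e t))" by auto
    have "e s = (v + pscale (\<nu> r) u') + (\<Sum>t\<in>X. pscale (\<nu> t + \<nu> r * \<mu>' t) (e t))"
    proof -
      have "e s = v + pscale (\<nu> r) (e r) + (\<Sum>t\<in>X. pscale (\<nu> t) (e t))"
        using es insert.hyps by (simp add: add.assoc)
      also have "pscale (\<nu> r) (e r) = pscale (\<nu> r) u' + (\<Sum>t\<in>X. pscale (\<nu> r * \<mu>' t) (e t))"
        by (subst er') (simp add: ps.scale_right_distrib ps.scale_sum_right)
      finally show ?thesis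
        by (simp add: ps.scale_left_distrib sum.distrib algebra_simps)
    qed
    moreover have "v + pscale (\<nu> r) u' \<in> U"
      using v u' by (intro ps.subspace_add[OF assms(2)] ps.subspace_scale[OF assms(2)])
    moreover have "\<forall>t\<in>X. \<nu> t + \<nu> r * \<mu>' t \<in> maxid"
      using \<nu> \<mu>' by (auto intro!: maxid_add locring_mult_maxid maxid_locring)
    ultimately show "\<exists>u\<in>U. \<exists>\<mu>. (\<forall>t\<in>X. \<mu> t \<in> maxid) \<and> e s = u + (\<Sum>t\<in>X. pscale (\<mu> t) (e t))"
      by (intro bexI[of _ "v + pscale (\<nu> r) u'"] exI[of _ "\<lambda>t. \<nu> t + \<nu> r * \<mu>' t"]) auto
  qed
  moreover from this have "e r \<in> U"
    by (subst er') (intro ps.subspace_add[OF assms(2)] u' ps.subspace_sum[OF assms(2)] ps.subspace_scale[OF assms(2)], auto)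
  ultimately show ?case by simp
qed simp

end

section \<open>The generic fibre of the hypergeometric module\<close>

context
  fixes A :: "int ^ 'n::{finite,linorder} ^ 'd::finite" and \<beta> :: "'k::field_char_0 ^ 'd"
begin

text \<open>The symbol \<open>1 \<otimes> P\<close>.\<close>

definition tv :: "('n, 'k) free_alg \<Rightarrow> (('n, 'k) free_alg set set \<Rightarrow>\<^sub>0 ('n, 'k) mpoly fract)" where
  "tv P = Poly_Mapping.single (hclass A \<beta> P) 1"

text \<open>The relations of the base change: the generic fibre \<open>k(x) \<otimes> M\<^sub>A(\<beta>)\<close> is the quotient of the free
  vector space on the symbols \<open>1 \<otimes> m\<close> by this subspace.\<close>

definition relspace :: "(('n, 'k) free_alg set set \<Rightarrow>\<^sub>0 ('n, 'k) mpoly fract) set" where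
  "relspace = ps.span (base_change_relations (\<lambda>p. Fract p 1) (xmodule A \<beta>))"

lemma xmodule_closed:
  "m \<in> carrier (xmodule A \<beta>) \<Longrightarrow> m' \<in> carrier (xmodule A \<beta>) \<Longrightarrow> m \<oplus>\<^bsub>xmodule A \<beta>\<^esub> m' \<in> carrier (xmodule A \<beta>)"
  "m \<in> carrier (xmodule A \<beta>) \<Longrightarrow> r \<odot>\<^bsub>xmodule A \<beta>\<^esub> m \<in> carrier (xmodule A \<beta>)"
  by (auto simp: carrier_xmodule add_xmodule smult_xmodule)

lemma holonomic_rank_eq:
  "holonomic_rank (hypergeometric_module A \<beta>) =
     vectorspace.dim ring_of (quotient_module (free_module (carrier (xmodule A \<beta>))) relspace)"
  unfolding holonomic_rank_def xmodule_def[symmetric] relspace_def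
  by (subst base_change_eq) (use xmodule_closed in auto)

lemma subspace_relspace: "ps.subspace relspace"
  by (simp add: relspace_def ps.subspace_span)

lemma relspace_subset: "relspace \<subseteq> {v. Poly_Mapping.keys v \<subseteq> carrier (xmodule A \<beta>)}"
  unfolding relspace_def
  by (intro ps.span_minimal base_change_relations_subset subspace_keys_subset) (use xmodule_closed in auto)

lemma keys_tv: "Poly_Mapping.keys (tv P) \<subseteq> carrier (xmodule A \<beta>)"
  by (simp add: tv_def carrier_xmodule)

text \<open>Equality of two representatives in the generic fibre.\<close>

definition req :: "(('n, 'k) free_alg set set \<Rightarrow>\<^sub>0 ('n, 'k) mpoly fract) \<Rightarrow> _ \<Rightarrow> bool" (infix "=\<^sub>R" 50) where
  "v =\<^sub>R w \<longleftrightarrow> v - w \<in> relspace"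

lemma req_refl [simp]: "v =\<^sub>R v"
  using ps.subspace_0[OF subspace_relspace] by (simp add: req_def)

lemma req_sym: "v =\<^sub>R w \<Longrightarrow> w =\<^sub>R v"
  unfolding req_def using ps.subspace_neg[OF subspace_relspace] by fastforce

lemma req_trans [trans]: "u =\<^sub>R v \<Longrightarrow> v =\<^sub>R w \<Longrightarrow> u =\<^sub>R w"
  unfolding req_def using ps.subspace_add[OF subspace_relspace] by fastforce

lemma req_add: "u =\<^sub>R v \<Longrightarrow> u' =\<^sub>R v' \<Longrightarrow> u + u' =\<^sub>R v + v'"
  unfolding req_def using ps.subspace_add[OF subspace_relspace, of "u - v" "u' - v'"] by (simp add: algebra_simps)

lemma req_scale: "u =\<^sub>R v \<Longrightarrow> pscale c u =\<^sub>R pscale c v"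
  unfolding req_def using ps.subspace_scale[OF subspace_relspace, of "u - v" c] by (simp add: ps.scale_right_diff_distrib)

lemma req_sum: "(\<And>i. i \<in> S \<Longrightarrow> f i =\<^sub>R g i) \<Longrightarrow> sum f S =\<^sub>R sum g S"
  by (induction S rule: infinite_finite_induct) (auto intro: req_add)

lemma tv_add: "tv (P + Q) =\<^sub>R tv P + tv Q"
proof -
  have "tv (P + Q) - tv P - tv Q \<in> base_change_relations (\<lambda>p. Fract p 1) (xmodule A \<beta>)"
    unfolding base_change_relations_def tv_def add_xmodule[symmetric] carrier_xmodule by blast
  from ps.span_base[OF this] show ?thesis by (simp add: req_def relspace_def algebra_simps)
qed

lemma tv_poly: "tv (poly_in GenX p * P) =\<^sub>R pscale (Fract p 1) (tv P)"
proof -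
  have "tv (poly_in GenX p * P) - Poly_Mapping.single (hclass A \<beta> P) (Fract p 1)
      \<in> base_change_relations (\<lambda>p. Fract p 1) (xmodule A \<beta>)"
    unfolding base_change_relations_def tv_def smult_xmodule[symmetric] carrier_xmodule by blast
  from ps.span_base[OF this] show ?thesis by (simp add: req_def relspace_def tv_def)
qed

lemma tv_hfree: "P - Q \<in> hfree A \<beta> \<Longrightarrow> tv P = tv Q"
  using hclass_eq_iff[of A \<beta> P Q] by (simp add: tv_def)

lemma tv_weq: "P =\<^sub>W Q \<Longrightarrow> tv P = tv Q"
  by (rule tv_hfree) (simp add: weq_def hfree_weyl)

lemma letters_0: "letters 0 = []"
proof -
  have "mset (letters 0) = {#}" by (rule multiset_eqI) (metis count_letters lookup_zero count_empty)
  then show ?thesis by simp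
qed

lemma tv_const: "tv (free_const c * P) =\<^sub>R pscale (cK c) (tv P)"
  using tv_poly[of "Poly_Mapping.single 0 c" P]
  by (simp add: cK_def monomial_in_wd letters_0 wd_Nil)

lemma letters_single: "letters (Poly_Mapping.single j 1) = [j]"
proof -
  have "mset (letters (Poly_Mapping.single j 1)) = {#j#}"
    by (rule multiset_eqI) (simp only: count_letters, simp add: lookup_single when_def)
  then show ?thesis by simp
qed

lemma tv_var: "tv (wd (GenX j # gs)) =\<^sub>R pscale (xK j) (tv (wd gs))"
  using tv_poly[of "Poly_Mapping.single (Poly_Mapping.single j 1) 1" "wd gs"]
  by (simp add: xK_def monomial_in_wd letters_single[simplified])

lemma tv_0: "tv 0 =\<^sub>R 0"
  using tv_const[of 0 0] by simp

lemma tv_sum: "finite S \<Longrightarrow> tv (sum f S) =\<^sub>R (\<Sum>i\<in>S. tv (f i))"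
  by (induction S rule: finite_induct) (auto intro: tv_0 req_trans[OF tv_add req_add[OF req_refl]])

lemma req_mem:
  assumes "ps.subspace U" "relspace \<subseteq> U" "v =\<^sub>R w" "w \<in> U"
  shows "v \<in> U"
  using ps.subspace_add[OF assms(1), of "v - w" w] assms(2-) by (auto simp: req_def)

text \<open>Moving a derivation to the right end of a word produces only shorter words as correction
  terms.\<close>

lemma commutator_word:
  "\<exists>Ws. (\<forall>w\<in>set Ws. length w < length gs) \<and>
     (wd (GenD j # gs) :: ('n, 'k) free_alg) =\<^sub>W wd (gs @ [GenD j]) + (\<Sum>w\<leftarrow>Ws. wd w)"
proof (induction gs)
  case (Cons g gs)
  then obtain Ws where Ws: "\<forall>w\<in>set Ws. length w < length gs"
    "(wd (GenD j # gs) :: ('n, 'k) free_alg) =\<^sub>W wd (gs @ [GenD j]) + (\<Sum>w\<leftarrow>Ws. wd w)" by auto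
  have shift: "wd [g] * (\<Sum>w\<leftarrow>Ws. wd w) = ((\<Sum>w\<leftarrow>map ((#) g) Ws. wd w) :: ('n, 'k) free_alg)"
    by (induction Ws) (simp_all add: distrib_left)
  have "(wd [GenD j, g] :: ('n, 'k) free_alg) =\<^sub>W wd [g, GenD j] + (if g = GenX j then 1 else 0)"
  proof (cases g)
    case (GenX i)
    then show ?thesis using wd_DX[of j i, where ?'k = 'k] by auto
  next
    case (GenD i)
    then show ?thesis using wd_swap[of GenD j i, where ?'k = 'k] by auto
  qed
  from weq_mult_right[OF this, of "wd gs"]
  have "(wd (GenD j # g # gs) :: ('n, 'k) free_alg) =\<^sub>W wd [g] * wd (GenD j # gs) + (if g = GenX j then wd gs else 0)"
    by (simp add: distrib_right split: if_splits)
  also have "\<dots> =\<^sub>W wd [g] * (wd (gs @ [GenD j]) + (\<Sum>w\<leftarrow>Ws. wd w)) + (if g = GenX j then wd gs else 0)"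
    by (intro weq_add weq_mult_left Ws(2) weq_refl)
  also have "\<dots> = wd ((g # gs) @ [GenD j]) + (\<Sum>w\<leftarrow>map ((#) g) Ws @ (if g = GenX j then [gs] else []). wd w)"
    by (simp add: distrib_left shift add.assoc)
  finally show ?case
    using Ws(1) by (intro exI[of _ "map ((#) g) Ws @ (if g = GenX j then [gs] else [])"]) auto
qed (auto intro: exI[of _ "[]"])

text \<open>The generic fibre is spanned by the monomials in the derivations: a letter \<open>x\<^sub>j\<close> at the front of a
  word acts as a scalar, and a letter \<open>\<partial>\<^sub>j\<close> at the front can be moved to the derivations at the end,
  by induction on the length of the rest of the word.\<close>

lemma tv_in_subspace:
  assumes U: "ps.subspace U" "relspace \<subseteq> U" and gen: "\<And>js. tv (wd (map GenD js)) \<in> U"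
  shows "tv P \<in> U"
proof -
  note mem = req_mem[OF U]
  have words: "tv (wd (gs @ map GenD js)) \<in> U" for gs js
  proof (induction gs arbitrary: js rule: length_induct)
    case (1 gs)
    show ?case
    proof (cases gs)
      case Nil
      then show ?thesis using gen[of js] by simp
    next
      case (Cons g gs')
      show ?thesis
      proof (cases g)
        case (GenX j)
        then show ?thesis
          using 1 Cons by (auto intro!: mem[OF tv_var] ps.subspace_scale[OF U(1)])
      next
        case (GenD j)
        obtain Ws where Ws: "\<forall>w\<in>set Ws. length w < length gs'"
          "(wd (GenD j # gs') :: ('n, 'k) free_alg) =\<^sub>W wd (gs' @ [GenD j]) + (\<Sum>w\<leftarrow>Ws. wd w)"
          using commutator_word by blast
        have sumU: "tv ((\<Sum>w\<leftarrow>Ws'. wd w) * wd (map GenD js)) \<in> U" if "set Ws' \<subseteq> set Ws" for Ws'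
          using that
        proof (induction Ws')
          case Nil
          then show ?case using mem[OF tv_0 ps.subspace_0[OF U(1)]] by simp
        next
          case (Cons w Ws')
          then have "tv (wd (w @ map GenD js)) \<in> U"
            using 1 Ws(1) \<open>gs = g # gs'\<close> by auto
          then have "tv (wd w * wd (map GenD js)) + tv ((\<Sum>w\<leftarrow>Ws'. wd w) * wd (map GenD js)) \<in> U"
            using Cons by (intro ps.subspace_add[OF U(1)]) auto
          from mem[OF tv_add this] show ?case by (simp add: distrib_right)
        qed
        have "tv (wd (gs @ map GenD js)) = tv (wd (GenD j # gs') * wd (map GenD js))"
          using Cons GenD by simp
        also have "\<dots> = tv ((wd (gs' @ [GenD j]) + (\<Sum>w\<leftarrow>Ws. wd w)) * wd (map GenD js))"
          by (rule tv_weq[OF weq_mult_right[OF Ws(2)]])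
        also have "\<dots> = tv (wd (gs' @ map GenD (j # js)) + (\<Sum>w\<leftarrow>Ws. wd w) * wd (map GenD js))"
          by (simp add: distrib_right)
        also have "\<dots> \<in> U"
        proof (rule mem[OF tv_add ps.subspace_add[OF U(1)]])
          show "tv (wd (gs' @ map GenD (j # js))) \<in> U"
            using 1 Cons by (metis length_Cons lessI)
          show "tv ((\<Sum>w\<leftarrow>Ws. wd w) * wd (map GenD js)) \<in> U" by (rule sumU) simp
        qed
        finally show ?thesis .
      qed
    qed
  qed
  show ?thesis
  proof (induction P rule: free_alg_induct)
    case zero
    then show ?case using mem[OF tv_0 ps.subspace_0[OF U(1)]] .
  next
    case (add P P')
    then show ?case by (intro mem[OF tv_add] ps.subspace_add[OF U(1)])
  next
    case (const c P)
    then show ?case by (intro mem[OF tv_const] ps.subspace_scale[OF U(1)])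
  next
    case (word gs)
    then show ?case using words[of gs "[]"] by simp
  qed
qed

lemma generic_fibre_subset:
  assumes U: "ps.subspace U" "relspace \<subseteq> U" and gen: "\<And>js. tv (wd (map GenD js)) \<in> U"
  shows "{v. Poly_Mapping.keys v \<subseteq> carrier (xmodule A \<beta>)} \<subseteq> U"
proof
  fix v :: "('n, 'k) free_alg set set \<Rightarrow>\<^sub>0 ('n, 'k) mpoly fract"
  assume v: "v \<in> {v. Poly_Mapping.keys v \<subseteq> carrier (xmodule A \<beta>)}"
  have "(\<Sum>m\<in>Poly_Mapping.keys v. Poly_Mapping.single m (Poly_Mapping.lookup v m)) \<in> U"
  proof (rule ps.subspace_sum[OF U(1)])
    fix m assume "m \<in> Poly_Mapping.keys v"
    then obtain P where "m = hclass A \<beta> P" using v by (auto simp: carrier_xmodule)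
    then have "Poly_Mapping.single m (Poly_Mapping.lookup v m) = pscale (Poly_Mapping.lookup v m) (tv P)"
      by (simp add: tv_def)
    then show "Poly_Mapping.single m (Poly_Mapping.lookup v m) \<in> U"
      using ps.subspace_scale[OF U(1) tv_in_subspace[OF U gen]] by simp
  qed
  then show "v \<in> U" by (simp add: poly_mapping_sum_monomials)
qed

end

section \<open>Spanning sets of the generic fibre\<close>

context simplicial
begin

lemma common_denominator:
  obtains m f where "m > 0" "\<And>j v. of_nat m * \<kappa> j v = of_nat (f j v)"
proof -
  define den where "den j v = nat (snd (quotient_of (\<kappa> j v)))" for j v
  define m where "m = (\<Prod>p\<in>UNIV. den (fst p) (snd p))"
  have den: "den j v > 0" for j v
    using quotient_of_denom_pos'[of "\<kappa> j v"] by (simp add: den_def)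
  then have "m > 0" by (simp add: m_def prod_pos)
  have "\<exists>f. of_nat m * \<kappa> j v = of_nat f" for j v
  proof -
    obtain a b where ab: "quotient_of (\<kappa> j v) = (a, b)" by (cases "quotient_of (\<kappa> j v)")
    then have k: "\<kappa> j v = of_int a / of_int b" "b > 0"
      using quotient_of_div quotient_of_denom_pos by blast+
    have "a \<ge> 0" using nonneg[of j v] k by (simp add: zero_le_divide_iff)
    have "den j v dvd m" unfolding m_def
      using dvd_prodI[of UNIV "(j, v)" "\<lambda>p. den (fst p) (snd p)"] by simp
    then obtain c where "m = den j v * c" by blast
    then have m: "(of_nat m :: rat) = of_int b * of_nat c" using k(2) by (simp add: den_def ab)
    have "of_nat m * \<kappa> j v = of_nat (c * nat a)"
      unfolding m k(1) using k(2) \<open>a \<ge> 0\<close> by simp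
    then show ?thesis by blast
  qed
  then have "\<forall>j v. \<exists>f. of_nat m * \<kappa> j v = of_nat f" by blast
  then obtain f where "\<And>j v. of_nat m * \<kappa> j v = of_nat (f j v)" by metis
  then show ?thesis using that \<open>m > 0\<close> by blast
qed

lemma kc_replicate: "kc (replicate_mset m j) v = of_nat m * \<kappa> j v"
  by (induction m) (simp_all add: algebra_simps)

lemma kc_sum: "kc (\<Sum>w\<in>S. f w) v = (\<Sum>w\<in>S. kc (f w) v)"
  by (induction S rule: infinite_finite_induct) simp_all

text \<open>Modulo the toric ideal, a monomial in the derivations of large degree equals a monomial of the
  same degree in which a vertex occurs: some column occurs at least \<open>m\<close> times in it, where \<open>m\<close> is a
  common denominator of the barycentric coordinates, and \<open>m\<close> times a column is a sum of \<open>m\<close> vertices.\<close>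

lemma exists_vertex:
  obtains D0 where "\<And>js. length js > D0 \<Longrightarrow>
    \<exists>v js'. length js = Suc (length js') \<and> (\<forall>w. kc (mset js) w = kc (mset (vtx v # js')) w)"
proof -
  obtain m f where m: "m > 0" and f: "\<And>j v. of_nat m * \<kappa> j v = of_nat (f j v)"
    by (rule common_denominator) blast
  have "\<exists>v js'. length js = Suc (length js') \<and> (\<forall>w. kc (mset js) w = kc (mset (vtx v # js')) w)"
    if len: "length js > CARD('n) * m" for js
  proof -
    have "\<exists>j. count (mset js) j \<ge> m"
    proof (rule ccontr)
      assume "\<not> ?thesis"
      then have *: "count (mset js) j \<le> m" for j by (meson nle_le)
      have "length js = size (mset js)" by simp
      also have "\<dots> = (\<Sum>j\<in>set_mset (mset js). count (mset js) j)" by (rule size_multiset_overloaded_eq)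
      also have "\<dots> \<le> (\<Sum>j\<in>set_mset (mset js). m)" by (rule sum_mono) (rule *)
      also have "\<dots> \<le> (\<Sum>j\<in>(UNIV :: 'n set). m)" by (rule sum_mono2) simp_all
      finally show False using len by simp
    qed
    then obtain j where j: "count (mset js) j \<ge> m" by blast
    define rest where "rest = mset js - replicate_mset m j"
    have js: "mset js = replicate_mset m j + rest"
      unfolding rest_def using j by (simp add: count_le_replicate_mset_subset_eq)
    define vs where "vs = (\<Sum>v\<in>UNIV. replicate_mset (f j v) (vtx v))"
    have kvs: "kc vs w = kc (replicate_mset m j) w" for w
      by (simp add: vs_def kc_sum kc_replicate kappa_vtx f if_distrib[of "\<lambda>x. _ * x"] cong: if_cong)
    have size_sum: "size (\<Sum>v\<in>S. replicate_mset (f j v) (vtx v)) = (\<Sum>v\<in>S. f j v)" for S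
      by (induction S rule: infinite_finite_induct) simp_all
    have "(of_nat (\<Sum>v\<in>UNIV. f j v) :: rat) = of_nat m"
      using f sum1[of j] by (simp flip: f sum_distrib_left)
    then have "size vs = m" unfolding vs_def size_sum by linarith
    then have "vs \<noteq> {#}" using m by auto
    then obtain i where i: "i \<in># vs" by (meson multiset_nonemptyE)
    then obtain v where v: "i = vtx v"
      by (auto simp: vs_def set_mset_sum split: if_splits)
    obtain js' where js': "mset js' = (vs - {#i#}) + rest" by (metis ex_mset)
    have add: "mset (vtx v # js') = vs + rest" using i v by (simp add: js')
    have "length js = size (mset js)" by simp
    also have "\<dots> = size (vs + rest)" using \<open>size vs = m\<close> by (simp add: js)
    also have "\<dots> = Suc (length js')" by (metis add length_Cons size_mset)
    finally have "length js = Suc (length js')" .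
    moreover have "kc (mset js) w = kc (mset (vtx v # js')) w" for w
      unfolding add js by (simp add: kvs)
    ultimately show ?thesis by blast
  qed
  then show ?thesis using that by blast
qed

context
  fixes \<beta> :: "'k::field_char_0 ^ 'd"
begin

text \<open>The point with coordinate 1 at the vertices and 0 elsewhere.\<close>

definition x0 :: "'n \<Rightarrow> 'k" where
  "x0 j = (if j \<in> range vtx then 1 else 0)"

text \<open>The coordinates of \<open>\<beta>\<close> with respect to the vertices.\<close>

definition bc :: "'d \<Rightarrow> 'k" where
  "bc v = vc \<beta> $ v"

text \<open>The element of the generic fibre given by a monomial in the derivations.\<close>

definition em :: "'n list \<Rightarrow> (('n, 'k) free_alg set set \<Rightarrow>\<^sub>0 ('n, 'k) mpoly fract)" where
  "em js = tv A \<beta> (wd (map GenD js))"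

abbreviation req' (infix "\<sim>" 50) where "v \<sim> w \<equiv> req A \<beta> v w"

lemma asum_mset: "asum (mset js) = (\<Sum>j\<leftarrow>js. acol A j)"
  by (induction js) simp_all

lemma em_cong: "(\<And>v. kc (mset js) v = kc (mset js') v) \<Longrightarrow> em js = em js'"
  unfolding em_def
  by (intro tv_hfree hfree_swap_sum) (simp add: asum_mset[symmetric] asum_int_eq_iff)

lemma euler_relation_row:
  "(\<Sum>j\<in>UNIV. pscale (cK (of_int (A $ i $ j)) * xK j) (em (j # js)))
     \<sim> pscale (cK (\<beta> $ i - (\<Sum>j\<leftarrow>js. of_int (A $ i $ j)))) (em js)"
proof -
  let ?w = "wd (map GenD js) :: ('n, 'k) free_alg"
  let ?c = "\<beta> $ i - (\<Sum>j\<leftarrow>js. of_int (A $ i $ j))"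
  have "tv A \<beta> (free_const (of_int (A $ i $ j)) * wd (GenX j # GenD j # map GenD js))
      \<sim> pscale (cK (of_int (A $ i $ j)) * xK j) (em (j # js))" for j
    using req_trans[OF tv_const req_scale[OF tv_var]] by (simp add: em_def)
  then have "(\<Sum>j\<in>UNIV. tv A \<beta> (free_const (of_int (A $ i $ j)) * wd (GenX j # GenD j # map GenD js)))
      \<sim> (\<Sum>j\<in>UNIV. pscale (cK (of_int (A $ i $ j)) * xK j) (em (j # js)))"
    by (intro req_sum)
  from req_trans[OF tv_sum this]
  have "tv A \<beta> (theta (\<lambda>j. of_int (A $ i $ j)) * ?w)
      \<sim> (\<Sum>j\<in>UNIV. pscale (cK (of_int (A $ i $ j)) * xK j) (em (j # js)))"
    by (simp add: theta_def sum_distrib_right mult.assoc)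
  then have "(\<Sum>j\<in>UNIV. pscale (cK (of_int (A $ i $ j)) * xK j) (em (j # js)))
      \<sim> tv A \<beta> (theta (\<lambda>j. of_int (A $ i $ j)) * ?w)"
    by (rule req_sym)
  also have "tv A \<beta> (theta (\<lambda>j. of_int (A $ i $ j)) * ?w) = tv A \<beta> (free_const ?c * ?w)"
    by (rule tv_hfree[OF hfree_theta])
  also have "tv A \<beta> (free_const ?c * ?w) \<sim> pscale (cK ?c) (em js)"
    unfolding em_def by (rule tv_const)
  finally show ?thesis .
qed

lemma cK_sum: "cK (sum f S) = (\<Sum>i\<in>S. cK (f i))"
  by (induction S rule: infinite_finite_induct) (simp_all add: cK_add)

text \<open>The Euler relations in the coordinates with respect to the vertices; this is the linear
  combination of the original ones by a row of the inverse of the matrix of the vertices.\<close>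

lemma euler_relation:
  "(\<Sum>j\<in>UNIV. pscale (cK (of_rat (\<kappa> j v)) * xK j) (em (j # js)))
     \<sim> pscale (cK (bc v - of_rat (kc (mset js) v))) (em js)"
proof -
  define B where "B i = (matrix_inv (Bmat :: 'k ^ 'd ^ 'd)) $ v $ i" for i
  have vcB: "vc x $ v = (\<Sum>i\<in>UNIV. B i * x $ i)" for x :: "'k ^ 'd"
    by (simp add: vc_def B_def matrix_vector_mult_def)
  have "(\<Sum>i\<in>UNIV. pscale (cK (B i)) (\<Sum>j\<in>UNIV. pscale (cK (of_int (A $ i $ j)) * xK j) (em (j # js))))
      = (\<Sum>j\<in>UNIV. pscale (cK (of_rat (\<kappa> j v)) * xK j) (em (j # js)))"
  proof -
    have "of_rat (\<kappa> j v) = (\<Sum>i\<in>UNIV. B i * of_int (A $ i $ j))" for j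
      using vc_acol[of j v, where ?'a = 'k] vcB[of "acol A j"] by (simp add: acol_def)
    then show ?thesis
      unfolding ps.scale_sum_right
      by (subst sum.swap) (simp add: cK_sum cK_mult ps.scale_sum_left sum_distrib_right mult.assoc)
  qed
  moreover have "(\<Sum>i\<in>UNIV. pscale (cK (B i)) (pscale (cK (\<beta> $ i - (\<Sum>j\<leftarrow>js. of_int (A $ i $ j)))) (em js)))
      = pscale (cK (bc v - of_rat (kc (mset js) v))) (em js)"
  proof -
    have "(asum (mset js) :: 'k ^ 'd) $ i = (\<Sum>j\<leftarrow>js. of_int (A $ i $ j))" for i
      by (induction js) (simp_all add: acol_def)
    then have "bc v - of_rat (kc (mset js) v) = (\<Sum>i\<in>UNIV. B i * (\<beta> $ i - (\<Sum>j\<leftarrow>js. of_int (A $ i $ j))))"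
      using vcB[of "\<beta> - asum (mset js)"] by (simp add: bc_def vc_diff vc_asum)
    then show ?thesis by (simp add: cK_sum cK_mult ps.scale_sum_left)
  qed
  moreover have "(\<Sum>i\<in>UNIV. pscale (cK (B i)) (\<Sum>j\<in>UNIV. pscale (cK (of_int (A $ i $ j)) * xK j) (em (j # js))))
      \<sim> (\<Sum>i\<in>UNIV. pscale (cK (B i)) (pscale (cK (\<beta> $ i - (\<Sum>j\<leftarrow>js. of_int (A $ i $ j)))) (em js)))"
    by (intro req_sum req_scale euler_relation_row)
  ultimately show ?thesis by simp
qed

text \<open>The vectors that are congruent to an element of \<open>U\<close> modulo combinations of monomials of
  degree at most \<open>D\<close> whose coefficients vanish at the point \<open>x0\<close>.\<close>

definition near :: "(('n, 'k) free_alg set set \<Rightarrow>\<^sub>0 ('n, 'k) mpoly fract) set \<Rightarrow> nat \<Rightarrow> _ set" where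
  "near U D = {u + (\<Sum>ks\<in>{ks. length ks \<le> D}. pscale (\<mu> ks) (em ks)) | u \<mu>. u \<in> U \<and> (\<forall>ks. \<mu> ks \<in> maxid x0)}"

lemma finite_lists_le [simp]: "finite {ks :: 'n list. length ks \<le> D}"
  using finite_lists_length_le[of "UNIV :: 'n set" D] by simp

context
  fixes U
  assumes U: "ps.subspace U" "relspace A \<beta> \<subseteq> U"
begin

lemma near_base: "u \<in> U \<Longrightarrow> u \<in> near U D"
  unfolding near_def by (auto intro!: exI[of _ u] exI[of _ "\<lambda>_. 0"] maxid_0)

lemma near_add: "a \<in> near U D \<Longrightarrow> b \<in> near U D \<Longrightarrow> a + b \<in> near U D"
proof -
  assume "a \<in> near U D" "b \<in> near U D"
  then obtain u \<mu> u' \<mu>' where "u \<in> U" "u' \<in> U" "\<forall>ks. \<mu> ks \<in> maxid x0" "\<forall>ks. \<mu>' ks \<in> maxid x0"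
    "a = u + (\<Sum>ks\<in>{ks. length ks \<le> D}. pscale (\<mu> ks) (em ks))"
    "b = u' + (\<Sum>ks\<in>{ks. length ks \<le> D}. pscale (\<mu>' ks) (em ks))"
    unfolding near_def by blast
  then show ?thesis
    unfolding near_def
    by (intro CollectI exI[of _ "u + u'"] exI[of _ "\<lambda>ks. \<mu> ks + \<mu>' ks"])
       (auto intro: ps.subspace_add[OF U(1)] maxid_add simp: ps.scale_left_distrib sum.distrib)
qed

lemma near_scale: "a \<in> near U D \<Longrightarrow> c \<in> locring x0 \<Longrightarrow> pscale c a \<in> near U D"
proof -
  assume a: "a \<in> near U D" and c: "c \<in> locring x0"
  then obtain u \<mu> where "u \<in> U" "\<forall>ks. \<mu> ks \<in> maxid x0"
    "a = u + (\<Sum>ks\<in>{ks. length ks \<le> D}. pscale (\<mu> ks) (em ks))"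
    unfolding near_def by blast
  then show ?thesis
    unfolding near_def using c
    by (intro CollectI exI[of _ "pscale c u"] exI[of _ "\<lambda>ks. c * \<mu> ks"])
       (auto intro: ps.subspace_scale[OF U(1)] locring_mult_maxid simp: ps.scale_right_distrib ps.scale_sum_right)
qed

lemma near_diff: "a \<in> near U D \<Longrightarrow> b \<in> near U D \<Longrightarrow> a - b \<in> near U D"
proof -
  assume a: "a \<in> near U D" and b: "b \<in> near U D"
  have "cK (- 1) + 1 = (0 :: ('n, 'k) mpoly fract)"
    using cK_add[of "- 1 :: 'k" 1] by simp
  then have "cK (- 1) = (- 1 :: ('n, 'k) mpoly fract)" by (simp add: eq_neg_iff_add_eq_0)
  then have "- b \<in> near U D" using near_scale[OF b cK_locring, of "- 1"] by simp
  from near_add[OF a this] show ?thesis by simp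
qed

lemma near_sum: "(\<And>i. i \<in> S \<Longrightarrow> f i \<in> near U D) \<Longrightarrow> sum f S \<in> near U D"
  by (induction S rule: infinite_finite_induct) (auto intro: near_add near_base ps.subspace_0[OF U(1)])

lemma near_em: "length ks \<le> D \<Longrightarrow> \<mu> \<in> maxid x0 \<Longrightarrow> pscale \<mu> (em ks) \<in> near U D"
  unfolding near_def
  by (intro CollectI exI[of _ 0] exI[of _ "\<lambda>ls. if ls = ks then \<mu> else 0"])
     (auto simp: maxid_0 ps.subspace_0[OF U(1)] if_distrib[of "\<lambda>c. pscale c _"] cong: if_cong)

lemma near_mono: "a \<in> near U D \<Longrightarrow> D \<le> D' \<Longrightarrow> a \<in> near U D'"
proof -
  assume a: "a \<in> near U D" and D: "D \<le> D'"
  then obtain u \<mu> where u: "u \<in> U" "\<forall>ks. \<mu> ks \<in> maxid x0"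
    "a = u + (\<Sum>ks\<in>{ks. length ks \<le> D}. pscale (\<mu> ks) (em ks))"
    unfolding near_def by blast
  show ?thesis unfolding u(3)
    using u D by (intro near_add near_sum near_em near_base) auto
qed

text \<open>Multiplication by a vertex acts, up to terms that vanish at \<open>x0\<close>, as a scalar.\<close>

lemma near_vertex:
  assumes "length js < D"
  shows "em (vtx v # js) - pscale (cK (bc v - of_rat (kc (mset js) v))) (em js) \<in> near U D"
proof -
  let ?S = "\<Sum>j\<in>UNIV. pscale (cK (of_rat (\<kappa> j v)) * xK j) (em (j # js))"
  have "em (vtx v # js) = (\<Sum>j\<in>UNIV. pscale (cK (of_rat (\<kappa> j v)) * cK (x0 j)) (em (j # js)))"
  proof -
    have "cK (of_rat (\<kappa> j v)) * cK (x0 j) = (if j = vtx v then 1 else 0 :: ('n, 'k) mpoly fract)" for j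
      using inj_vtx by (auto simp: x0_def kappa_vtx simp flip: cK_mult dest: injD)
    then have "(\<Sum>j\<in>UNIV. pscale (cK (of_rat (\<kappa> j v)) * cK (x0 j)) (em (j # js))) =
        (\<Sum>j\<in>UNIV. if j = vtx v then em (j # js) else 0)"
      by (intro sum.cong) simp_all
    then show ?thesis by simp
  qed
  also have "\<dots> = ?S - (\<Sum>j\<in>UNIV. pscale (cK (of_rat (\<kappa> j v)) * (xK j - cK (x0 j))) (em (j # js)))"
    by (simp add: sum_subtractf[symmetric] ps.scale_left_diff_distrib right_diff_distrib)
  finally have "em (vtx v # js) - pscale (cK (bc v - of_rat (kc (mset js) v))) (em js) =
      (?S - pscale (cK (bc v - of_rat (kc (mset js) v))) (em js))
      - (\<Sum>j\<in>UNIV. pscale (cK (of_rat (\<kappa> j v)) * (xK j - cK (x0 j))) (em (j # js)))"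
    by simp
  also have "\<dots> \<in> near U D"
  proof (rule near_diff)
    show "?S - pscale (cK (bc v - of_rat (kc (mset js) v))) (em js) \<in> near U D"
      using euler_relation[of v js] U(2) by (intro near_base) (auto simp: req_def)
    show "(\<Sum>j\<in>UNIV. pscale (cK (of_rat (\<kappa> j v)) * (xK j - cK (x0 j))) (em (j # js))) \<in> near U D"
      using assms by (intro near_sum near_em locring_mult_maxid cK_locring xK_diff_maxid) auto
  qed
  finally show ?thesis .
qed

text \<open>The product of the factors that appear when the vertices in the list are added to the
  monomial one after the other, starting from the end of the list.\<close>

fun path_coeff :: "'n list \<Rightarrow> 'd list \<Rightarrow> 'k" where
  "path_coeff js [] = 1"
| "path_coeff js (v # n) = (bc v - of_rat (kc (mset js) v) - of_nat (count (mset n) v)) * path_coeff js n"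

lemma path_coeff_nonzero:
  assumes "\<And>v m. m < count (mset n) v \<Longrightarrow> bc v \<noteq> of_rat (kc (mset js) v) + of_nat m"
  shows "path_coeff js n \<noteq> 0"
  using assms
proof (induction n)
  case (Cons v n)
  have "path_coeff js n \<noteq> 0"
    by (rule Cons.IH) (use Cons.prems in \<open>auto split: if_splits\<close>)
  moreover have "bc v \<noteq> of_rat (kc (mset js) v) + of_nat (count (mset n) v)"
    by (rule Cons.prems) simp
  ultimately show ?case by (simp add: diff_diff_eq)
qed simp

lemma near_path:
  assumes "length js + length n \<le> D"
  shows "em (map vtx n @ js) - pscale (cK (path_coeff js n)) (em js) \<in> near U D"
  using assms
proof (induction n)
  case Nil
  show ?case using near_base[OF ps.subspace_0[OF U(1)]] by simp
next
  case (Cons v n)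
  let ?c = "bc v - of_rat (kc (mset js) v) - of_nat (count (mset n) v)"
  have k: "kc (mset (map vtx n @ js)) v = of_nat (count (mset n) v) + kc (mset js) v"
    using kc_vtx[of "mset n" v] by simp
  have "em (vtx v # map vtx n @ js) - pscale (cK ?c) (em (map vtx n @ js)) \<in> near U D"
    using near_vertex[of "map vtx n @ js" D v] Cons.prems unfolding k
    by (simp add: of_rat_add algebra_simps)
  moreover have "pscale (cK ?c) (em (map vtx n @ js) - pscale (cK (path_coeff js n)) (em js)) \<in> near U D"
    using Cons by (intro near_scale cK_locring) auto
  ultimately have "(em (vtx v # map vtx n @ js) - pscale (cK ?c) (em (map vtx n @ js))) +
      pscale (cK ?c) (em (map vtx n @ js) - pscale (cK (path_coeff js n)) (em js)) \<in> near U D"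
    by (rule near_add)
  then show ?case by (simp add: ps.scale_right_diff_distrib cK_mult)
qed

text \<open>By Nakayama's lemma it suffices to know modulo the maximal ideal of \<open>x0\<close> that the monomials of low
  degree lie in \<open>U\<close>: a monomial of higher degree contains a vertex, which is replaced by a scalar
  modulo the maximal ideal.\<close>

lemma all_in_subspace:
  assumes vertex: "\<And>js. length js > D0 \<Longrightarrow>
      \<exists>v js'. length js = Suc (length js') \<and> (\<forall>w. kc (mset js) w = kc (mset (vtx v # js')) w)"
    and near: "\<And>js. length js \<le> D0 \<Longrightarrow> \<exists>D. em js \<in> near U D"
  shows "em js \<in> U"
proof -
  from near obtain dg where dg: "\<And>js. length js \<le> D0 \<Longrightarrow> em js \<in> near U (dg js)" by metis
  \<comment> \<open>A degree that suffices for all monomials of degree at most \<open>D0\<close>, and for \<open>js\<close>.\<close>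
  define D where "D = length js + (\<Sum>ks\<in>{ks. length ks \<le> D0}. dg ks)"
  have "em ks \<in> near U D" if "length ks \<le> D" for ks
    using that
  proof (induction "length ks" arbitrary: ks rule: less_induct)
    case less
    show ?case
    proof (cases "length ks \<le> D0")
      case True
      then have "dg ks \<le> D" unfolding D_def by (intro trans_le_add2 member_le_sum) auto
      then show ?thesis using near_mono[OF dg[OF True]] by simp
    next
      case False
      then obtain v ks' where ks': "length ks = Suc (length ks')"
          "\<forall>w. kc (mset ks) w = kc (mset (vtx v # ks')) w" using vertex[of ks] by auto
      have "em ks = em (vtx v # ks')" using ks' by (intro em_cong) auto
      also have "\<dots> = (em (vtx v # ks') - pscale (cK (bc v - of_rat (kc (mset ks') v))) (em ks'))
          + pscale (cK (bc v - of_rat (kc (mset ks') v))) (em ks')" by simp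
      also have "\<dots> \<in> near U D"
        using less ks' by (intro near_add near_vertex near_scale cK_locring) auto
      finally show ?thesis .
    qed
  qed
  then have "\<forall>s\<in>{ks. length ks \<le> D}. em s \<in> U"
    by (intro nakayama[where ?x0.0 = x0]) (auto simp: near_def U(1), blast)
  then show ?thesis by (simp add: D_def)
qed

end

text \<open>The monomials of bounded degree span the generic fibre.\<close>

lemma generic_fibre_fin_dim:
  "\<exists>R. finite R \<and> {v. Poly_Mapping.keys v \<subseteq> carrier (xmodule A \<beta>)} \<subseteq> ps.span (relspace A \<beta> \<union> em ` R)"
proof -
  obtain D0 where D0: "\<And>js. length js > D0 \<Longrightarrow>
      \<exists>v js'. length js = Suc (length js') \<and> (\<forall>w. kc (mset js) w = kc (mset (vtx v # js')) w)"
    by (rule exists_vertex) blast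
  let ?U = "ps.span (relspace A \<beta> \<union> em ` {js. length js \<le> D0})"
  have U: "ps.subspace ?U" "relspace A \<beta> \<subseteq> ?U" by (auto intro: ps.span_base)
  have "em js \<in> ?U" for js
    by (rule all_in_subspace[OF U D0]) (auto intro!: near_base[OF U] ps.span_base)
  then have "{v. Poly_Mapping.keys v \<subseteq> carrier (xmodule A \<beta>)} \<subseteq> ?U"
    by (intro generic_fibre_subset[OF U]) (simp add: em_def)
  then show ?thesis by (intro exI[of _ "{js. length js \<le> D0}"]) simp
qed

text \<open>A set of monomials such that every monomial can be connected to one of them by
  multiplication with vertices along invertible steps spans the generic fibre.\<close>

lemma generic_fibre_spanned:
  assumes conn: "\<And>js. \<exists>r\<in>R. \<exists>n n'. (\<forall>v. kc (mset (map vtx n @ js)) v = kc (mset (map vtx n' @ r)) v) \<and>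
      (\<forall>v m. m < count (mset n) v \<longrightarrow> bc v \<noteq> of_rat (kc (mset js) v) + of_nat m)"
  shows "{v. Poly_Mapping.keys v \<subseteq> carrier (xmodule A \<beta>)} \<subseteq> ps.span (relspace A \<beta> \<union> em ` R)"
proof -
  obtain D0 where D0: "\<And>js. length js > D0 \<Longrightarrow>
      \<exists>v js'. length js = Suc (length js') \<and> (\<forall>w. kc (mset js) w = kc (mset (vtx v # js')) w)"
    by (rule exists_vertex) blast
  let ?U = "ps.span (relspace A \<beta> \<union> em ` R)"
  have U: "ps.subspace ?U" "relspace A \<beta> \<subseteq> ?U" by (auto intro: ps.span_base)
  have near: "\<exists>D. em js \<in> near ?U D" for js
  proof -
    obtain r n n' where r: "r \<in> R" and eq: "\<forall>v. kc (mset (map vtx n @ js)) v = kc (mset (map vtx n' @ r)) v"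
      and nz: "\<forall>v m. m < count (mset n) v \<longrightarrow> bc v \<noteq> of_rat (kc (mset js) v) + of_nat m"
      using conn by metis
    define D where "D = length js + length n + length r + length n'"
    let ?c = "path_coeff js n" and ?c' = "path_coeff r n'"
    have "em r \<in> near ?U D" using r by (intro near_base[OF U] ps.span_base) auto
    from near_add[OF U near_path[OF U, of r n' D] near_scale[OF U this cK_locring[of ?c']]]
    have "em (map vtx n' @ r) \<in> near ?U D" by (simp add: D_def)
    also have "em (map vtx n' @ r) = em (map vtx n @ js)" using eq by (intro em_cong) auto
    finally have "em (map vtx n @ js) - (em (map vtx n @ js) - pscale (cK ?c) (em js)) \<in> near ?U D"
      by (intro near_diff[OF U] near_path[OF U]) (simp_all add: D_def)
    from near_scale[OF U this cK_locring[of "inverse ?c"]]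
    have "pscale (cK (inverse ?c * ?c)) (em js) \<in> near ?U D" by (simp add: cK_mult)
    moreover have "inverse ?c * ?c = 1" using path_coeff_nonzero[OF U, of n js] nz by simp
    ultimately show ?thesis by (intro exI[of _ D]) simp
  qed
  have "em js \<in> ?U" for js
    by (rule all_in_subspace[OF U D0 near])
  then show ?thesis
    by (intro generic_fibre_subset[OF U]) (simp add: em_def)
qed

end

end

section \<open>Formal solutions and linear independence\<close>

subsection \<open>Partial derivatives of polynomials\<close>

text \<open>The partial derivative of a polynomial with respect to \<open>x\<^sub>j\<close>.\<close>

definition dpoly :: "'n \<Rightarrow> ('n, 'k::field) mpoly \<Rightarrow> ('n, 'k) mpoly" where
  "dpoly j p = Abs_poly_mapping (\<lambda>u. of_nat (Poly_Mapping.lookup u j + 1) * Poly_Mapping.lookup p (u + Poly_Mapping.single j 1))"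

lemma lookup_dpoly:
  "Poly_Mapping.lookup (dpoly j p) u = of_nat (Poly_Mapping.lookup u j + 1) * Poly_Mapping.lookup p (u + Poly_Mapping.single j 1)"
proof -
  have "{u. of_nat (Poly_Mapping.lookup u j + 1) * Poly_Mapping.lookup p (u + Poly_Mapping.single j 1) \<noteq> 0}
      \<subseteq> (\<lambda>u. u - Poly_Mapping.single j 1) ` Poly_Mapping.keys p"
    by (auto simp: in_keys_iff intro!: image_eqI[of _ _ "_ + Poly_Mapping.single j 1"])
  then have "finite {u. of_nat (Poly_Mapping.lookup u j + 1) * Poly_Mapping.lookup p (u + Poly_Mapping.single j 1) \<noteq> 0}"
    by (rule finite_subset) simp
  then show ?thesis by (simp add: dpoly_def)
qed

lemma dpoly_add: "dpoly j (p + q) = dpoly j p + dpoly j q"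
  by (rule poly_mapping_eqI) (simp add: lookup_dpoly lookup_add distrib_left)

lemma dpoly_single: "dpoly j (Poly_Mapping.single u c) =
    Poly_Mapping.single (u - Poly_Mapping.single j 1) (of_nat (Poly_Mapping.lookup u j) * c)"
proof (rule poly_mapping_eqI)
  fix w
  have "u = w + Poly_Mapping.single j 1 \<longleftrightarrow> Poly_Mapping.lookup u j > 0 \<and> u - Poly_Mapping.single j 1 = w"
  proof
    assume r: "Poly_Mapping.lookup u j > 0 \<and> u - Poly_Mapping.single j 1 = w"
    have "Poly_Mapping.lookup u i = Poly_Mapping.lookup (w + Poly_Mapping.single j 1) i" for i
      using r by (auto simp: lookup_add lookup_minus lookup_single when_def)
    then show "u = w + Poly_Mapping.single j 1" by (rule poly_mapping_eqI)
  qed (auto simp: lookup_add)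
  note iff = this
  show "Poly_Mapping.lookup (dpoly j (Poly_Mapping.single u c)) w = Poly_Mapping.lookup
      (Poly_Mapping.single (u - Poly_Mapping.single j 1) (of_nat (Poly_Mapping.lookup u j) * c)) w"
  proof (cases "u = w + Poly_Mapping.single j 1")
    case True
    then show ?thesis by (simp add: lookup_dpoly lookup_add)
  next
    case False
    then have "Poly_Mapping.lookup (Poly_Mapping.single u c) (w + Poly_Mapping.single j 1) = 0"
      by (simp add: lookup_single when_def)
    moreover have "Poly_Mapping.lookup u j = 0 \<or> u - Poly_Mapping.single j 1 \<noteq> w"
      using iff False by auto
    ultimately show ?thesis unfolding lookup_dpoly by (auto simp: lookup_single when_def)
  qed
qed

lemma wd_D_monomial:
  "(wd (GenD j # map GenX js) :: ('n, 'k::field) free_alg) =\<^sub>W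
     free_const (of_nat (count_list js j)) * wd (map GenX (remove1 j js)) + wd (map GenX js @ [GenD j])"
proof (induction js)
  case (Cons i js)
  let ?r = "free_const (of_nat (count_list js j)) * wd (map GenX (remove1 j js)) :: ('n, 'k) free_alg"
  have "(wd (GenD j # map GenX (i # js)) :: ('n, 'k) free_alg) = wd [GenD j, GenX i] * wd (map GenX js)" by simp
  also have "\<dots> =\<^sub>W (wd [GenX i, GenD j] + (if j = i then 1 else 0)) * wd (map GenX js)"
    by (rule weq_mult_right[OF wd_DX])
  also have "\<dots> = wd [GenX i] * wd (GenD j # map GenX js) + (if j = i then wd (map GenX js) else 0)"
    by (simp add: distrib_right)
  also have "\<dots> =\<^sub>W wd [GenX i] * (?r + wd (map GenX js @ [GenD j])) + (if j = i then wd (map GenX js) else 0)"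
    by (intro weq_add weq_mult_left Cons weq_refl)
  also have "\<dots> = free_const (of_nat (count_list js j)) * wd (map GenX (i # remove1 j js))
      + (if j = i then wd (map GenX js) else 0) + wd (map GenX (i # js) @ [GenD j])"
    by (simp add: distrib_left mult_free_const)
  also have "\<dots> =\<^sub>W free_const (of_nat (count_list (i # js) j)) * wd (map GenX (remove1 j (i # js)))
      + wd (map GenX (i # js) @ [GenD j])"
  proof (rule weq_add[OF _ weq_refl])
    show "free_const (of_nat (count_list js j)) * wd (map GenX (i # remove1 j js))
        + (if j = i then wd (map GenX js) else 0) =\<^sub>W
        (free_const (of_nat (count_list (i # js) j)) * wd (map GenX (remove1 j (i # js))) :: ('n, 'k) free_alg)"
    proof (cases "j = i")
      case False
      then show ?thesis by simp
    next
      case True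
      have "free_const (of_nat (count_list js j)) * wd (map GenX (j # remove1 j js)) =\<^sub>W
          (free_const (of_nat (count_list js j)) * wd (map GenX js) :: ('n, 'k) free_alg)"
      proof (cases "j \<in> set js")
        case True
        then show ?thesis by (intro weq_mult_left wd_perm) simp_all
      next
        case False
        then have "count_list js j = 0" by simp
        then show ?thesis by (simp only: of_nat_0 free_const_0 mult_zero_left weq_refl)
      qed
      from weq_add[OF this weq_refl[of "wd (map GenX js)"]] show ?thesis
        using True by (simp add: free_const_add distrib_right add.commute)
    qed
  qed
  finally show ?case .
qed simp

lemma monomial_remove:
  assumes "Poly_Mapping.lookup u j > 0"
  shows "mset (remove1 j (letters u)) = mset (letters (u - Poly_Mapping.single j 1))"
  by (rule multiset_eqI) (simp add: count_letters[unfolded count_mset] lookup_minus lookup_single when_def count_letters)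

lemma D_poly:
  "(wd [GenD j] * poly_in GenX p :: ('n::{finite,linorder}, 'k::field) free_alg) =\<^sub>W
     poly_in GenX (dpoly j p) + poly_in GenX p * wd [GenD j]"
proof (induction p rule: poly_mapping_induct)
  case (single u c)
  have "(wd (GenD j # map GenX (letters u)) :: ('n, 'k) free_alg) =\<^sub>W
      free_const (of_nat (Poly_Mapping.lookup u j)) * wd (map GenX (letters (u - Poly_Mapping.single j 1)))
      + wd (map GenX (letters u) @ [GenD j])"
  proof -
    have c: "count_list (letters u) j = Poly_Mapping.lookup u j" by (metis count_letters count_mset)
    have "(free_const (of_nat (Poly_Mapping.lookup u j)) * wd (map GenX (remove1 j (letters u))) :: ('n, 'k) free_alg) =\<^sub>W
      free_const (of_nat (Poly_Mapping.lookup u j)) * wd (map GenX (letters (u - Poly_Mapping.single j 1)))"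
    proof (cases "Poly_Mapping.lookup u j = 0")
      case False
      then show ?thesis by (intro weq_mult_left wd_perm monomial_remove) simp_all
    qed simp
    from weq_trans[OF wd_D_monomial weq_add[OF this[folded c] weq_refl]] show ?thesis by (simp only: c)
  qed
  from weq_mult_left[OF this, of "free_const c"]
  have "free_const c * wd (GenD j # map GenX (letters u)) =\<^sub>W
      free_const (c * of_nat (Poly_Mapping.lookup u j)) * (wd (map GenX (letters (u - Poly_Mapping.single j 1))) :: ('n, 'k) free_alg)
      + free_const c * wd (map GenX (letters u) @ [GenD j])"
    by (simp only: free_const_mult mult.assoc distrib_left)
  then show ?case
    by (simp add: dpoly_single monomial_in_wd mult_free_const mult.assoc mult.commute[of c])
next
  case (sum p q)
  from weq_add[OF sum] show ?case
    by (simp add: distrib_left distrib_right poly_in_add dpoly_add add_ac)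
qed

text \<open>In characteristic zero, a polynomial all of whose derivatives vanish at a point is zero.\<close>

lemma poly_eq_0_if_derivatives_vanish:
  fixes p :: "('n::{finite,linorder}, 'k::field_char_0) mpoly"
  assumes "\<And>js. ev x0 (foldr dpoly js p) = 0"
  shows "p = 0"
proof -
  have "p = 0"
    if "\<forall>u\<in>Poly_Mapping.keys p. (\<Sum>j\<in>UNIV. Poly_Mapping.lookup u j) < N"
      "\<And>js. ev x0 (foldr dpoly js p) = 0" for N and p :: "('n, 'k) mpoly"
    using that
  proof (induction N arbitrary: p)
    case 0
    then show ?case by (metis Poly_Mapping.keys_eq_empty all_not_in_conv not_less_zero)
  next
    case (Suc N)
    have "dpoly j p = 0" for j
    proof (rule Suc.IH)
      show "\<forall>u\<in>Poly_Mapping.keys (dpoly j p). (\<Sum>j\<in>UNIV. Poly_Mapping.lookup u j) < N"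
      proof
        fix u assume "u \<in> Poly_Mapping.keys (dpoly j p)"
        then have "u + Poly_Mapping.single j 1 \<in> Poly_Mapping.keys p"
          by (auto simp: in_keys_iff lookup_dpoly)
        then have "(\<Sum>i\<in>UNIV. Poly_Mapping.lookup (u + Poly_Mapping.single j 1) i) < Suc N"
          using Suc.prems by blast
        also have "(\<Sum>i\<in>UNIV. Poly_Mapping.lookup (u + Poly_Mapping.single j 1) i) = (\<Sum>i\<in>UNIV. Poly_Mapping.lookup u i) + 1"
          by (simp add: lookup_add sum.distrib lookup_single when_def)
        finally show "(\<Sum>j\<in>UNIV. Poly_Mapping.lookup u j) < N" by simp
      qed
      show "ev x0 (foldr dpoly js (dpoly j p)) = 0" for js
        using Suc.prems(2)[of "js @ [j]"] by simp
    qed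
    then have d: "Poly_Mapping.lookup (dpoly j p) u = 0" for j u by simp
    have "Poly_Mapping.lookup p u = 0" if "u \<noteq> 0" for u
    proof -
      from that obtain j where j: "Poly_Mapping.lookup u j \<noteq> 0"
        by (metis lookup_zero poly_mapping_eqI)
      have "u = (u - Poly_Mapping.single j 1) + Poly_Mapping.single j 1"
        using j by (intro poly_mapping_eqI) (auto simp: lookup_add lookup_minus lookup_single when_def)
      then show ?thesis using d[of j "u - Poly_Mapping.single j 1"]
        by (simp add: lookup_dpoly del: of_nat_add of_nat_Suc)
    qed
    then have "p = Poly_Mapping.single 0 (Poly_Mapping.lookup p 0)"
      by (intro poly_mapping_eqI) (auto simp: lookup_single when_def)
    moreover have "ev x0 p = 0" using Suc.prems(2)[of "[]"] by simp
    ultimately show ?case by (metis ev_const single_zero)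
  qed
  moreover have "\<forall>u\<in>Poly_Mapping.keys p. (\<Sum>j\<in>UNIV. Poly_Mapping.lookup u j)
      < Suc (\<Sum>u\<in>Poly_Mapping.keys p. \<Sum>j\<in>UNIV. Poly_Mapping.lookup u j)"
  proof
    fix u assume "u \<in> Poly_Mapping.keys p"
    from member_le_sum[OF this, of "\<lambda>u. \<Sum>j\<in>UNIV. Poly_Mapping.lookup u j"]
    show "(\<Sum>j\<in>UNIV. Poly_Mapping.lookup u j) < Suc (\<Sum>u\<in>Poly_Mapping.keys p. \<Sum>j\<in>UNIV. Poly_Mapping.lookup u j)"
      by simp
  qed
  ultimately show ?thesis using assms by blast
qed

subsection \<open>Operators acting on power series\<close>

text \<open>A function \<open>f\<close> on multisets stands for the formal power series
  \<open>\<Sum> f(\<alpha>) (x - x0)\<^sup>\<alpha> / \<alpha>!\<close>, so that \<open>f(\<alpha>)\<close> is the value of \<open>\<partial>\<^sup>\<alpha> f\<close> at \<open>x0\<close>.\<close>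

context
  fixes x0 :: "'n::{finite,linorder} \<Rightarrow> 'k::field"
begin

text \<open>In terms of these values, \<open>x\<^sub>j = x0\<^sub>j + (x\<^sub>j - x0\<^sub>j)\<close> acts by Leibniz' rule, and \<open>\<partial>\<^sub>j\<close> by a shift.\<close>

fun gen_act :: "'n weyl_gen \<Rightarrow> ('n multiset \<Rightarrow> 'k) \<Rightarrow> 'n multiset \<Rightarrow> 'k" where
  "gen_act (GenX j) f \<alpha> = x0 j * f \<alpha> + of_nat (count \<alpha> j) * f (\<alpha> - {#j#})"
| "gen_act (GenD j) f \<alpha> = f (add_mset j \<alpha>)"

text \<open>The action of an operator, given by an element of the free algebra, on a power series.\<close>

definition act :: "('n, 'k) free_alg \<Rightarrow> ('n multiset \<Rightarrow> 'k) \<Rightarrow> 'n multiset \<Rightarrow> 'k" where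
  "act P f \<alpha> = (\<Sum>w\<in>Poly_Mapping.keys P. Poly_Mapping.lookup P w * (case w of Word gs \<Rightarrow> foldr gen_act gs f \<alpha>))"

lemma act_superset:
  assumes "finite S" "Poly_Mapping.keys P \<subseteq> S"
  shows "act P f \<alpha> = (\<Sum>w\<in>S. Poly_Mapping.lookup P w * (case w of Word gs \<Rightarrow> foldr gen_act gs f \<alpha>))"
  unfolding act_def by (rule sum.mono_neutral_left) (use assms in \<open>auto simp: in_keys_iff\<close>)

lemma act_0 [simp]: "act 0 f \<alpha> = 0"
  by (simp add: act_def)

lemma act_add: "act (P + Q) f \<alpha> = act P f \<alpha> + act Q f \<alpha>"
proof -
  let ?S = "Poly_Mapping.keys P \<union> Poly_Mapping.keys Q"
  show ?thesis
    by (subst (1 2 3) act_superset[of ?S])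
       (use Poly_Mapping.keys_add[of P Q] in \<open>auto simp: lookup_add distrib_right sum.distrib\<close>)
qed

lemma act_wd [simp]: "act (wd gs) f = foldr gen_act gs f"
  by (rule ext) (subst act_superset[of "{Word gs}"], auto simp: wd_def)

lemma act_const: "act (free_const c * P) f \<alpha> = c * act P f \<alpha>"
proof -
  have "act (free_const c * P) f \<alpha> = (\<Sum>w\<in>Poly_Mapping.keys P. Poly_Mapping.lookup (free_const c * P) w *
      (case w of Word gs \<Rightarrow> foldr gen_act gs f \<alpha>))"
    by (rule act_superset)
       (auto simp: free_const_mult_left in_keys_iff lookup_pscale[unfolded pscale_def])
  also have "\<dots> = c * act P f \<alpha>"
    by (simp add: act_def sum_distrib_left free_const_mult_left lookup_pscale[unfolded pscale_def] mult.assoc)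
  finally show ?thesis .
qed

lemma act_minus: "act (- P) f \<alpha> = - act P f \<alpha>"
  using act_add[of P "- P" f \<alpha>] by (simp add: eq_neg_iff_add_eq_0 add.commute)

lemma act_diff: "act (P - Q) f \<alpha> = act P f \<alpha> - act Q f \<alpha>"
  using act_add[of P "- Q" f \<alpha>] by (simp add: act_minus)

lemma act_sum: "act (sum P S) f \<alpha> = (\<Sum>i\<in>S. act (P i) f \<alpha>)"
  by (induction S rule: infinite_finite_induct) (simp_all add: act_add)

lemma gen_act_linear: "gen_act g (\<lambda>\<alpha>. c * f \<alpha> + f' \<alpha>) = (\<lambda>\<alpha>. c * gen_act g f \<alpha> + gen_act g f' \<alpha>)"
  by (rule ext) (cases g; simp add: algebra_simps)

lemma act_linear: "act P (\<lambda>\<alpha>. c * f \<alpha> + f' \<alpha>) = (\<lambda>\<alpha>. c * act P f \<alpha> + act P f' \<alpha>)"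
proof (rule ext, induction P rule: free_alg_induct)
  case (word gs)
  have "foldr gen_act gs (\<lambda>\<alpha>. c * f \<alpha> + f' \<alpha>) = (\<lambda>\<alpha>. c * foldr gen_act gs f \<alpha> + foldr gen_act gs f' \<alpha>)"
    by (induction gs) (simp_all add: gen_act_linear)
  then show ?case by simp
qed (simp_all add: act_add act_const algebra_simps)

lemma act_plus: "act P (\<lambda>\<alpha>. f \<alpha> + f' \<alpha>) \<alpha> = act P f \<alpha> + act P f' \<alpha>"
  using act_linear[of P 1 f f'] by (simp add: fun_eq_iff)

lemma act_zero: "act P (\<lambda>_. 0) \<alpha> = 0"
  using act_plus[of P "\<lambda>_. 0" "\<lambda>_. 0" \<alpha>] by (metis add_0_right add_left_imp_eq)

lemma act_scale: "act P (\<lambda>\<alpha>. c * f \<alpha>) \<alpha> = c * act P f \<alpha>"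
  using act_linear[of P c f "\<lambda>_. 0"] act_zero[of P] by (simp add: fun_eq_iff)

lemma act_sum_right: "act P (\<lambda>\<alpha>. \<Sum>i\<in>S. f i \<alpha>) \<alpha> = (\<Sum>i\<in>S. act P (f i) \<alpha>)"
  by (induction S rule: infinite_finite_induct) (simp_all add: act_zero act_plus)

lemma act_mult: "act (P * Q) f = act P (act Q f)"
proof (rule ext, induction P rule: free_alg_induct)
  case (word gs)
  show ?case
  proof (induction Q rule: free_alg_induct)
    case zero
    show ?case using act_zero[of "wd gs"] by (simp add: act_0[abs_def])
  next
    case (add Q Q')
    then show ?case using act_plus[of "wd gs" "act Q f" "act Q' f"]
      by (simp add: distrib_left act_add[abs_def])
  next
    case (const c Q)
    then show ?case using act_scale[of "wd gs" c "act Q f"]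
      by (simp add: mult_free_const act_const[abs_def])
  qed simp
qed (simp_all add: distrib_right act_add act_const mult.assoc)

lemma act_weyl_ideal: "P \<in> weyl_ideal \<Longrightarrow> act P f \<alpha> = 0"
proof -
  have X: "gen_act (GenX i) (gen_act (GenX j) f) \<alpha> = gen_act (GenX j) (gen_act (GenX i) f) \<alpha>" for i j f \<alpha>
  proof (cases "i = j")
    case False
    then have "\<alpha> - {#i#} - {#j#} = \<alpha> - {#j#} - {#i#}" by (metis diff_right_commute)
    then show ?thesis using False by (simp add: algebra_simps)
  qed simp
  have D: "gen_act (GenD i) (gen_act (GenD j) f) \<alpha> = gen_act (GenD j) (gen_act (GenD i) f) \<alpha>" for i j f \<alpha>
    by (simp add: add_mset_commute)
  have DX: "gen_act (GenD i) (gen_act (GenX j) f) \<alpha> =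
      gen_act (GenX j) (gen_act (GenD i) f) \<alpha> + (if i = j then f \<alpha> else 0)" for i j f \<alpha>
  proof (cases "count \<alpha> j = 0")
    case True
    then show ?thesis by (auto simp: algebra_simps)
  next
    case False
    then have "j \<in># \<alpha>" by (simp add: count_eq_zero_iff)
    show ?thesis
    proof (cases "i = j")
      case True
      then show ?thesis using \<open>j \<in># \<alpha>\<close> by (simp add: distrib_right)
    next
      case False
      then show ?thesis by simp
    qed
  qed
  have "weyl_ideal \<subseteq> {P. \<forall>f \<alpha>. act P f \<alpha> = 0}"
    unfolding weyl_ideal_def
  proof (rule genideal_subset)
    have 1: "act 1 f = f" for f using act_wd[of "[]" f] by (simp add: wd_Nil)
    show "weyl_relations \<subseteq> {P. \<forall>f \<alpha>. act P f \<alpha> = 0}"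
      unfolding weyl_relations_def free_gen_wd
      by (auto simp: act_diff X D DX 1 simp del: gen_act.simps)
    show "P * Q \<in> {P. \<forall>f \<alpha>. act P f \<alpha> = 0}" if "P \<in> {P. \<forall>f \<alpha>. act P f \<alpha> = 0}" for P Q
      using that by (simp add: act_mult)
    show "Q * P \<in> {P. \<forall>f \<alpha>. act P f \<alpha> = 0}" if "P \<in> {P. \<forall>f \<alpha>. act P f \<alpha> = 0}" for P Q
    proof -
      have "act P f = (\<lambda>_. 0)" for f using that by (simp add: fun_eq_iff)
      then show ?thesis by (simp add: act_mult act_zero)
    qed
  qed (simp_all add: act_add)
  then show "P \<in> weyl_ideal \<Longrightarrow> act P f \<alpha> = 0" by blast
qed

lemma act_weq: "P =\<^sub>W Q \<Longrightarrow> act P f = act Q f"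
  using act_weyl_ideal[of "P - Q" f] by (auto simp: weq_def act_diff fun_eq_iff)

lemma act_poly_mult: "act (poly_in GenX (p * q)) f = act (poly_in GenX p) (act (poly_in GenX q) f)"
  using act_weq[OF poly_in_mult[of GenX p q]] by (simp add: act_mult)

lemma act_poly_origin: "act (poly_in GenX p) f {#} = ev x0 p * f {#}"
proof (induction p rule: poly_mapping_induct)
  case (single u c)
  have "foldr gen_act (map GenX js) f {#} = (\<Prod>j\<leftarrow>js. x0 j) * f {#}" for js
    by (induction js) simp_all
  moreover have "(\<Prod>j\<leftarrow>letters u. x0 j) = (\<Prod>j\<in>UNIV. x0 j ^ Poly_Mapping.lookup u j)"
  proof -
    have "(\<Prod>j\<leftarrow>letters u. x0 j) = (\<Prod>j\<in>#mset (letters u). x0 j)" by (simp flip: prod_mset_prod_list)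
    also have "\<dots> = (\<Prod>j\<in>set (letters u). x0 j ^ count (mset (letters u)) j)"
      by (simp add: image_prod_mset_multiplicity)
    also have "\<dots> = (\<Prod>j\<in>UNIV. x0 j ^ count (mset (letters u)) j)"
      by (rule prod.mono_neutral_left) (auto simp del: count_mset_0_iff simp flip: count_mset_0_iff)
    finally show ?thesis by (simp only: count_letters)
  qed
  ultimately show ?case by (simp add: monomial_in_wd act_const ev_single)
qed (simp add: poly_in_add act_add ev_add distrib_right)

text \<open>The first derivative of a polynomial that does not vanish at \<open>x0\<close> determines the
  corresponding derivative of its product with a series.\<close>

lemma act_poly_derivative:
  assumes "\<And>is. length is < length js \<Longrightarrow> ev x0 (foldr dpoly is p) = 0"
  shows "foldr gen_act (map GenD js) (act (poly_in GenX p) f) {#} = ev x0 (foldr dpoly js p) * f {#}"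
  using assms
proof (induction js arbitrary: p f rule: rev_induct)
  case Nil
  then show ?case by (simp add: act_poly_origin)
next
  case (snoc j js)
  have "gen_act (GenD j) (act (poly_in GenX p) f) =
      (\<lambda>\<alpha>. act (poly_in GenX (dpoly j p)) f \<alpha> + act (poly_in GenX p) (gen_act (GenD j) f) \<alpha>)"
    using act_weq[OF D_poly[of j p], of f] by (simp add: act_mult act_add[abs_def])
  then have "foldr gen_act (map GenD (js @ [j])) (act (poly_in GenX p) f) {#} =
      foldr gen_act (map GenD js) (act (poly_in GenX (dpoly j p)) f) {#}
      + foldr gen_act (map GenD js) (act (poly_in GenX p) (gen_act (GenD j) f)) {#}"
    using act_plus[of "wd (map GenD js)"] by simp
  also have "foldr gen_act (map GenD js) (act (poly_in GenX (dpoly j p)) f) {#}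
      = ev x0 (foldr dpoly js (dpoly j p)) * f {#}"
    using snoc.prems[of "_ @ [j]"] by (intro snoc.IH) simp
  also have "foldr gen_act (map GenD js) (act (poly_in GenX p) (gen_act (GenD j) f)) {#} = 0"
    using snoc.prems by (subst snoc.IH) simp_all
  finally show ?case by simp
qed

end

text \<open>Series \<open>f k i\<close> that are units or vanish at \<open>x0\<close> according to \<open>i = k\<close> or not admit no polynomial
  relations \<open>\<Sum>\<^sub>i p\<^sub>i f\<^sub>k\<^sub>i = 0\<close> for all \<open>k\<close>: by induction on the order, all derivatives of the \<open>p\<^sub>i\<close>
  vanish at \<open>x0\<close>.\<close>

lemma act_independent:
  fixes x0 :: "'n::{finite,linorder} \<Rightarrow> 'k::field_char_0" and p :: "'i \<Rightarrow> ('n, 'k) mpoly"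
  assumes "finite I"
    and diag: "\<And>i k. i \<in> I \<Longrightarrow> k \<in> I \<Longrightarrow> f k i {#} \<noteq> 0 \<longleftrightarrow> i = k"
    and zero: "\<And>k \<alpha>. k \<in> I \<Longrightarrow> (\<Sum>i\<in>I. act x0 (poly_in GenX (p i)) (f k i) \<alpha>) = 0"
    and "i \<in> I"
  shows "p i = 0"
proof -
  have "\<forall>i\<in>I. ev x0 (foldr dpoly js (p i)) = 0" for js
  proof (induction js rule: length_induct)
    case (1 js)
    show ?case
    proof
      fix k assume k: "k \<in> I"
      let ?D = "foldr (gen_act x0) (map GenD js)"
      have "0 = ?D (\<lambda>\<alpha>. \<Sum>i\<in>I. act x0 (poly_in GenX (p i)) (f k i) \<alpha>) {#}"
        using zero[OF k] act_zero[of x0 "wd (map GenD js)"] by simp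
      also have "\<dots> = (\<Sum>i\<in>I. ?D (act x0 (poly_in GenX (p i)) (f k i)) {#})"
        using act_sum_right[of x0 "wd (map GenD js)"] by simp
      also have "\<dots> = (\<Sum>i\<in>I. ev x0 (foldr dpoly js (p i)) * f k i {#})"
        using 1 act_poly_derivative[of js x0 "p _"] by (intro sum.cong refl) auto
      also have "\<dots> = (\<Sum>i\<in>I. if i = k then ev x0 (foldr dpoly js (p k)) * f k k {#} else 0)"
        using diag k by (intro sum.cong) auto
      finally show "ev x0 (foldr dpoly js (p k)) = 0"
        using diag[OF k k] k assms(1) by simp
    qed
  qed
  then show ?thesis using assms(4) by (intro poly_eq_0_if_derivatives_vanish[of x0]) auto
qed

subsection \<open>Solutions at the base point\<close>

context simplicial
begin

lemma asum_count: "(asum \<alpha> :: int ^ 'd) = A *v (\<chi> j. int (count \<alpha> j))"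
proof (induction \<alpha>)
  case empty
  show ?case by (simp add: vec_eq_iff matrix_vector_mult_def)
next
  case (add k \<alpha>)
  have "(\<chi> j. int (count (add_mset k \<alpha>) j)) = axis k 1 + (\<chi> j. int (count \<alpha> j))"
    by (auto simp: vec_eq_iff axis_def)
  then show ?case
    using add by (simp add: matrix_vector_right_distrib matrix_vector_mult_axis acol_def)
qed

context
  fixes \<beta> :: "'k::field_char_0 ^ 'd"
begin

text \<open>The formal power series solutions at \<open>x0\<close>: the value of the derivative \<open>\<partial>\<^sup>\<alpha>\<close> at \<open>x0\<close> depends only on
  the sum of the columns in \<open>\<alpha>\<close>, and satisfies the recursion along the vertices.\<close>

definition solution :: "('n multiset \<Rightarrow> 'k) \<Rightarrow> bool" where
  "solution \<Phi> \<longleftrightarrow> (\<forall>\<alpha> \<alpha>'. (\<forall>v. kc \<alpha> v = kc \<alpha>' v) \<longrightarrow> \<Phi> \<alpha> = \<Phi> \<alpha>') \<and>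
     (\<forall>\<alpha> v. \<Phi> (add_mset (vtx v) \<alpha>) = (bc \<beta> v - of_rat (kc \<alpha> v)) * \<Phi> \<alpha>)"

lemma act_monomial_D: "act x0 (monomial_in GenD u) \<Phi> \<alpha> = \<Phi> (\<alpha> + mset (letters u))"
proof -
  have "foldr (gen_act x0) (map GenD js) \<Phi> \<alpha> = \<Phi> (\<alpha> + mset js)" for js
    by (induction js arbitrary: \<alpha>) simp_all
  then show ?thesis by (simp add: monomial_in_wd)
qed

lemma solution_toric:
  assumes \<Phi>: "solution \<Phi>" and p: "p \<in> toric_ideal A"
  shows "act x0 (poly_in GenD p) \<Phi> \<alpha> = 0"
proof -
  have mult: "act x0 (poly_in GenD (p * q)) \<Phi> = act x0 (poly_in GenD p) (act x0 (poly_in GenD q) \<Phi>)"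
    for p q :: "('n, 'k) mpoly"
    using act_weq[OF poly_in_mult[of GenD p q]] by (simp add: act_mult)
  have "toric_ideal A \<subseteq> {p :: ('n, 'k) mpoly. \<forall>\<alpha>. act x0 (poly_in GenD p) \<Phi> \<alpha> = 0}"
    unfolding toric_ideal_def
  proof (rule genideal_subset)
    show "{Poly_Mapping.single u 1 - Poly_Mapping.single v 1 |u v.
        A *v (\<chi> j. int (Poly_Mapping.lookup u j)) = A *v (\<chi> j. int (Poly_Mapping.lookup v j))}
      \<subseteq> {p :: ('n, 'k) mpoly. \<forall>\<alpha>. act x0 (poly_in GenD p) \<Phi> \<alpha> = 0}"
    proof clarify
      fix u v :: "'n \<Rightarrow>\<^sub>0 nat" and \<alpha>
      assume "A *v (\<chi> j. int (Poly_Mapping.lookup u j)) = A *v (\<chi> j. int (Poly_Mapping.lookup v j))"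
      then have "(asum (mset (letters u)) :: int ^ 'd) = asum (mset (letters v))"
        unfolding asum_count count_letters .
      then have "\<forall>w. kc (\<alpha> + mset (letters u)) w = kc (\<alpha> + mset (letters v)) w"
        by (simp add: asum_int_eq_iff)
      then have "\<Phi> (\<alpha> + mset (letters u)) = \<Phi> (\<alpha> + mset (letters v))"
        using \<Phi> unfolding solution_def by blast
      then show "act x0 (poly_in GenD (Poly_Mapping.single u 1 - Poly_Mapping.single v 1)) \<Phi> \<alpha> = 0"
        by (simp add: poly_in_diff act_diff act_monomial_D)
    qed
    show "q * p \<in> {p :: ('n, 'k) mpoly. \<forall>\<alpha>. act x0 (poly_in GenD p) \<Phi> \<alpha> = 0}"
      if "p \<in> {p. \<forall>\<alpha>. act x0 (poly_in GenD p) \<Phi> \<alpha> = 0}" for p q :: "('n, 'k) mpoly"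
    proof -
      have "act x0 (poly_in GenD p) \<Phi> = (\<lambda>_. 0)" using that by (simp add: fun_eq_iff)
      then show ?thesis by (simp add: mult act_zero)
    qed
    then show "p * q \<in> {p :: ('n, 'k) mpoly. \<forall>\<alpha>. act x0 (poly_in GenD p) \<Phi> \<alpha> = 0}"
      if "p \<in> {p. \<forall>\<alpha>. act x0 (poly_in GenD p) \<Phi> \<alpha> = 0}" for p q :: "('n, 'k) mpoly"
      using that by (simp only: mult.commute[of p q])
  qed (simp_all add: poly_in_add act_add)
  then show ?thesis using p by blast
qed

lemma solution_euler:
  assumes \<Phi>: "solution \<Phi>"
  shows "act x0 (euler_op A \<beta> i) \<Phi> \<alpha> = 0"
proof -
  have one: "act x0 1 f = f" for f :: "'n multiset \<Rightarrow> 'k"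
    using act_wd[of x0 "[]" f] by (simp add: wd_Nil)
  have const: "act x0 (free_const c) f \<alpha> = c * f \<alpha>" for c and f :: "'n multiset \<Rightarrow> 'k"
    using act_const[of x0 c 1 f \<alpha>] by (simp add: one)
  have summand: "act x0 (free_const (of_int (A $ i $ j)) * wd [GenX j, GenD j]) \<Phi> \<alpha> =
      of_int (A $ i $ j) * x0 j * \<Phi> (add_mset j \<alpha>) + of_int (A $ i $ j) * of_nat (count \<alpha> j) * \<Phi> \<alpha>" for j
  proof (cases "j \<in># \<alpha>")
    case True
    then show ?thesis by (simp add: act_const algebra_simps)
  next
    case False
    then have "count \<alpha> j = 0" by (simp add: count_eq_zero_iff)
    then show ?thesis by (simp add: act_const algebra_simps)
  qed
  have "(\<Sum>j\<in>UNIV. of_int (A $ i $ j) * x0 j * \<Phi> (add_mset j \<alpha>)) =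
      (\<Sum>j\<in>range vtx. of_int (A $ i $ j) * x0 j * \<Phi> (add_mset j \<alpha>))"
    by (rule sum.mono_neutral_right) (auto simp: x0_def)
  also have "\<dots> = (\<Sum>v\<in>UNIV. of_int (A $ i $ vtx v) * \<Phi> (add_mset (vtx v) \<alpha>))"
    by (simp add: sum.reindex[OF inj_vtx] x0_def)
  also have "\<dots> = (\<Sum>v\<in>UNIV. of_int (A $ i $ vtx v) * (bc \<beta> v - of_rat (kc \<alpha> v))) * \<Phi> \<alpha>"
    using \<Phi> by (simp add: solution_def sum_distrib_right mult.assoc)
  also have "(\<Sum>v\<in>UNIV. of_int (A $ i $ vtx v) * (bc \<beta> v - of_rat (kc \<alpha> v))) = \<beta> $ i - (asum \<alpha> :: 'k ^ 'd) $ i"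
  proof -
    have "(\<Sum>v\<in>UNIV. of_int (A $ i $ vtx v) * (bc \<beta> v - of_rat (kc \<alpha> v))) =
        (Bmat *v (vc \<beta> - vc (asum \<alpha>))) $ i"
      by (simp add: Bmat_def matrix_vector_mult_def bc_def vc_asum)
    then show ?thesis by (simp add: vc_diff[symmetric] Bmat_vc)
  qed
  also have "(asum \<alpha> :: 'k ^ 'd) $ i = (\<Sum>j\<in>UNIV. of_int (A $ i $ j) * of_nat (count \<alpha> j))"
  proof -
    have "(asum \<alpha> :: 'k ^ 'd) $ i = of_int ((asum \<alpha> :: int ^ 'd) $ i)"
      using of_int_asum[of \<alpha>, where ?'a = 'k] by (metis vec_lambda_beta)
    then show ?thesis by (simp add: asum_count matrix_vector_mult_def)
  qed
  finally show ?thesis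
    unfolding euler_op_theta theta_def
    by (simp add: act_diff act_sum summand const sum.distrib left_diff_distrib sum_distrib_right
        del: act_wd)
qed

lemma solution_hfree:
  assumes \<Phi>: "solution \<Phi>" and P: "P \<in> hfree A \<beta>"
  shows "act x0 P \<Phi> \<alpha> = 0"
proof -
  have "hfree A \<beta> \<subseteq> {P. \<forall>\<alpha>. act x0 P \<Phi> \<alpha> = 0}"
  proof (rule hfree_minimal)
    show "Q * P \<in> {P. \<forall>\<alpha>. act x0 P \<Phi> \<alpha> = 0}" if "P \<in> {P. \<forall>\<alpha>. act x0 P \<Phi> \<alpha> = 0}" for P Q
    proof -
      have "act x0 P \<Phi> = (\<lambda>_. 0)" using that by (simp add: fun_eq_iff)
      then show ?thesis by (simp add: act_mult act_zero)
    qed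
  qed (use \<Phi> in \<open>auto simp: act_weyl_ideal solution_toric solution_euler act_add\<close>)
  then show ?thesis using P by blast
qed

subsection \<open>Bounds for the rank\<close>

text \<open>The power series obtained by applying an operator to a solution, as a function of the class of
  the operator; it does not depend on the representative.\<close>

definition val :: "('n multiset \<Rightarrow> 'k) \<Rightarrow> ('n, 'k) free_alg set set \<Rightarrow> 'n multiset \<Rightarrow> 'k" where
  "val \<Phi> m = act x0 (SOME P. hclass A \<beta> P = m) \<Phi>"

lemma val_hclass: "solution \<Phi> \<Longrightarrow> val \<Phi> (hclass A \<beta> P) = act x0 P \<Phi>"
proof -
  assume \<Phi>: "solution \<Phi>"
  have "hclass A \<beta> (SOME Q. hclass A \<beta> Q = hclass A \<beta> P) = hclass A \<beta> P"
    by (rule someI[of "\<lambda>Q. hclass A \<beta> Q = hclass A \<beta> P" P]) simp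
  then have "(SOME Q. hclass A \<beta> Q = hclass A \<beta> P) - P \<in> hfree A \<beta>"
    by (simp add: hclass_eq_iff)
  from solution_hfree[OF \<Phi> this] show ?thesis
    by (simp add: val_def act_diff fun_eq_iff)
qed

text \<open>The value of \<open>\<Sum> p\<^sub>m m\<close> on a solution, for polynomials \<open>p\<^sub>m\<close>.\<close>

definition lval :: "('n multiset \<Rightarrow> 'k) \<Rightarrow> (('n, 'k) free_alg set set \<Rightarrow>\<^sub>0 ('n, 'k) mpoly) \<Rightarrow> 'n multiset \<Rightarrow> 'k" where
  "lval \<Phi> w \<alpha> = (\<Sum>m\<in>Poly_Mapping.keys w. act x0 (poly_in GenX (Poly_Mapping.lookup w m)) (val \<Phi> m) \<alpha>)"

lemma lval_superset:
  assumes "finite S" "Poly_Mapping.keys w \<subseteq> S"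
  shows "lval \<Phi> w \<alpha> = (\<Sum>m\<in>S. act x0 (poly_in GenX (Poly_Mapping.lookup w m)) (val \<Phi> m) \<alpha>)"
  unfolding lval_def by (rule sum.mono_neutral_left) (use assms in \<open>auto simp: in_keys_iff\<close>)

lemma lval_add: "lval \<Phi> (w + w') \<alpha> = lval \<Phi> w \<alpha> + lval \<Phi> w' \<alpha>"
proof -
  let ?S = "Poly_Mapping.keys w \<union> Poly_Mapping.keys w'"
  show ?thesis
    by (subst (1 2 3) lval_superset[of ?S])
       (use Poly_Mapping.keys_add[of w w'] in \<open>auto simp: lookup_add poly_in_add act_add sum.distrib\<close>)
qed

lemma lval_single: "lval \<Phi> (Poly_Mapping.single m p) \<alpha> = act x0 (poly_in GenX p) (val \<Phi> m) \<alpha>"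
  by (subst lval_superset[of "{m}"]) auto

lemma lval_0: "lval \<Phi> 0 \<alpha> = 0"
  by (simp add: lval_def)

lemma lval_diff: "lval \<Phi> (w - w') \<alpha> = lval \<Phi> w \<alpha> - lval \<Phi> w' \<alpha>"
  using lval_add[of \<Phi> "w - w'" w' \<alpha>] by simp

lemma lval_scale: "lval \<Phi> (pscale a w) \<alpha> = act x0 (poly_in GenX a) (lval \<Phi> w) \<alpha>"
proof -
  have "lval \<Phi> (pscale a w) \<alpha> = (\<Sum>m\<in>Poly_Mapping.keys w. act x0 (poly_in GenX (a * Poly_Mapping.lookup w m)) (val \<Phi> m) \<alpha>)"
    by (subst lval_superset[of "Poly_Mapping.keys w"]) (auto simp: in_keys_iff)
  also have "\<dots> = act x0 (poly_in GenX a) (\<lambda>\<alpha>. lval \<Phi> w \<alpha>) \<alpha>"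
    unfolding lval_def act_sum_right by (simp add: act_poly_mult)
  finally show ?thesis by simp
qed

text \<open>Every relation of the generic fibre becomes, after clearing denominators, a relation
  between the power series obtained from a solution.\<close>

lemma relspace_lval:
  assumes sol: "\<And>i. i \<in> I \<Longrightarrow> solution (\<Phi> i)" and v: "v \<in> relspace A \<beta>"
  shows "\<exists>q w. q \<noteq> 0 \<and> (\<forall>m. Fract q 1 * Poly_Mapping.lookup v m = Fract (Poly_Mapping.lookup w m) 1) \<and>
    (\<forall>i\<in>I. \<forall>\<alpha>. lval (\<Phi> i) w \<alpha> = 0)" (is "?Z v")
proof -
  have "ps.subspace {v. ?Z v}"
    unfolding ps.subspace_def
  proof (intro conjI ballI allI)
    show "0 \<in> {v. ?Z v}"
      by (rule CollectI, intro exI[of _ 1] exI[of _ 0]) (simp add: lval_0 Zero_fract_def)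
  next
    fix v v' assume "v \<in> {v. ?Z v}" "v' \<in> {v. ?Z v}"
    then obtain q w q' w' where
      q: "q \<noteq> 0" "\<And>m. Fract q 1 * Poly_Mapping.lookup v m = Fract (Poly_Mapping.lookup w m) 1"
        "\<And>i \<alpha>. i \<in> I \<Longrightarrow> lval (\<Phi> i) w \<alpha> = 0" and
      q': "q' \<noteq> 0" "\<And>m. Fract q' 1 * Poly_Mapping.lookup v' m = Fract (Poly_Mapping.lookup w' m) 1"
        "\<And>i \<alpha>. i \<in> I \<Longrightarrow> lval (\<Phi> i) w' \<alpha> = 0" by blast
    have "Fract (q * q') 1 * Poly_Mapping.lookup (v + v') m =
        Fract (Poly_Mapping.lookup (pscale q' w + pscale q w') m) 1" for m
    proof -
      have "Fract (q * q') 1 * Poly_Mapping.lookup (v + v') m =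
          Fract q' 1 * (Fract q 1 * Poly_Mapping.lookup v m) + Fract q 1 * (Fract q' 1 * Poly_Mapping.lookup v' m)"
        by (simp add: lookup_add distrib_left mult.assoc[symmetric] mult.commute)
      then show ?thesis by (simp add: q(2) q'(2) lookup_add)
    qed
    moreover have "lval (\<Phi> i) (pscale q' w + pscale q w') \<alpha> = 0" if "i \<in> I" for i \<alpha>
    proof -
      have "lval (\<Phi> i) w = (\<lambda>_. 0)" "lval (\<Phi> i) w' = (\<lambda>_. 0)" using q(3) q'(3) that by (simp_all add: fun_eq_iff)
      then show ?thesis by (simp add: lval_add lval_scale act_zero)
    qed
    moreover have "q * q' \<noteq> 0" using q q' by simp
    ultimately show "v + v' \<in> {v. ?Z v}" by blast
  next
    fix c :: "('n, 'k) mpoly fract" and v assume "v \<in> {v. ?Z v}"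
    then obtain q w where
      q: "q \<noteq> 0" "\<And>m. Fract q 1 * Poly_Mapping.lookup v m = Fract (Poly_Mapping.lookup w m) 1"
        "\<And>i \<alpha>. i \<in> I \<Longrightarrow> lval (\<Phi> i) w \<alpha> = 0" by blast
    obtain a b where c: "c = Fract a b" "b \<noteq> 0" by (cases c) auto
    have "Fract (q * b) 1 * Poly_Mapping.lookup (pscale c v) m = Fract (Poly_Mapping.lookup (pscale a w) m) 1" for m
    proof -
      have bc: "Fract b 1 * c = Fract a 1" using c by (simp add: eq_fract)
      have "Fract (q * b) 1 * Poly_Mapping.lookup (pscale c v) m =
          (Fract b 1 * c) * (Fract q 1 * Poly_Mapping.lookup v m)"
      proof -
        have "Fract (q * b) 1 = Fract q 1 * Fract b 1" by simp
        then have "Fract (q * b) 1 * (c * Poly_Mapping.lookup v m) =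
            Fract q 1 * Fract b 1 * (c * Poly_Mapping.lookup v m)" by (rule arg_cong)
        then show ?thesis unfolding lookup_pscale by (simp only: mult.assoc mult.left_commute)
      qed
      then show ?thesis unfolding bc q(2) by simp
    qed
    moreover have "lval (\<Phi> i) (pscale a w) \<alpha> = 0" if "i \<in> I" for i \<alpha>
    proof -
      have "lval (\<Phi> i) w = (\<lambda>_. 0)" using q(3) that by (simp add: fun_eq_iff)
      then show ?thesis by (simp add: lval_scale act_zero)
    qed
    moreover have "q * b \<noteq> 0" using q c by simp
    ultimately show "pscale c v \<in> {v. ?Z v}" by blast
  qed
  moreover have "base_change_relations (\<lambda>p. Fract p 1) (xmodule A \<beta>) \<subseteq> {v. ?Z v}"
  proof -
    have fs: "Fract 1 1 * Poly_Mapping.lookup (Poly_Mapping.single m (Fract p 1)) m' =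
        Fract (Poly_Mapping.lookup (Poly_Mapping.single m p) m') 1" for m m' :: "('n, 'k) free_alg set set" and p :: "('n, 'k) mpoly"
      by (simp add: lookup_single when_def One_fract_def[symmetric] Zero_fract_def)
    have fd: "Fract 1 1 * Poly_Mapping.lookup (v - v') m' = Fract (Poly_Mapping.lookup (w - w') m') 1"
      if "Fract 1 1 * Poly_Mapping.lookup v m' = Fract (Poly_Mapping.lookup w m') 1"
         "Fract 1 1 * Poly_Mapping.lookup v' m' = Fract (Poly_Mapping.lookup w' m') 1"
      for m' :: "('n, 'k) free_alg set set" and v v' and w w' :: "('n, 'k) free_alg set set \<Rightarrow>\<^sub>0 ('n, 'k) mpoly"
      using that by (simp add: lookup_minus right_diff_distrib)
    have one: "act x0 (poly_in GenX 1) f = f" for f :: "'n multiset \<Rightarrow> 'k"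
    proof -
      have "poly_in GenX 1 = (1 :: ('n, 'k) free_alg)"
        using poly_in_single[of GenX 0 "1 :: 'k"] by (simp add: monomial_in_wd letters_0 wd_Nil)
      then show ?thesis using act_wd[of x0 "[]" f] by (simp add: wd_Nil)
    qed
    have sing1: "Poly_Mapping.single m (1 :: ('n, 'k) mpoly fract) = Poly_Mapping.single m (Fract 1 1)"
      for m :: "('n, 'k) free_alg set set" by (simp add: One_fract_def)
    have "?Z (Poly_Mapping.single (hclass A \<beta> (P + P')) 1 - Poly_Mapping.single (hclass A \<beta> P) 1
        - Poly_Mapping.single (hclass A \<beta> P') 1)" for P P'
      unfolding sing1
      by (rule exI[of _ 1], rule exI[of _ "Poly_Mapping.single (hclass A \<beta> (P + P')) 1
          - Poly_Mapping.single (hclass A \<beta> P) 1 - Poly_Mapping.single (hclass A \<beta> P') 1"])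
         (auto simp: lval_diff lval_single one val_hclass[OF sol] act_add intro!: fd fs)
    moreover have "?Z (Poly_Mapping.single (hclass A \<beta> (poly_in GenX p * P)) 1
        - Poly_Mapping.single (hclass A \<beta> P) (Fract p 1))" for p P
      unfolding sing1
      by (rule exI[of _ 1], rule exI[of _ "Poly_Mapping.single (hclass A \<beta> (poly_in GenX p * P)) 1
          - Poly_Mapping.single (hclass A \<beta> P) p"])
         (auto simp: lval_diff lval_single one val_hclass[OF sol] act_mult intro!: fd fs)
    ultimately show ?thesis
      unfolding base_change_relations_def carrier_xmodule
      by (auto simp only: add_xmodule smult_xmodule Un_iff mem_Collect_eq image_iff)
  qed
  ultimately have "relspace A \<beta> \<subseteq> {v. ?Z v}"
    unfolding relspace_def by (intro ps.span_minimal)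
  then show ?thesis using v by blast
qed

text \<open>Solutions \<open>\<Phi> k\<close> and monomials \<open>js i\<close> such that the derivative \<open>js i\<close> of \<open>\<Phi> k\<close> is nonzero at \<open>x0\<close> exactly
  for \<open>i = k\<close> show that the monomials are linearly independent in the generic fibre.\<close>

lemma rank_ge:
  assumes I: "finite I" and sol: "\<And>i. i \<in> I \<Longrightarrow> solution (\<Phi> i)"
    and diag: "\<And>i k. i \<in> I \<Longrightarrow> k \<in> I \<Longrightarrow> \<Phi> k (mset (js i)) \<noteq> 0 \<longleftrightarrow> i = k"
  shows "card I \<le> holonomic_rank (hypergeometric_module A \<beta>)"
proof -
  define f where "f k i = act x0 (wd (map GenD (js i))) (\<Phi> k)" for k i
  have f0: "f k i {#} = \<Phi> k (mset (js i))" for k i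
  proof -
    have "foldr (gen_act x0) (map GenD js) \<Phi> \<alpha> = \<Phi> (\<alpha> + mset js)" for js \<alpha> and \<Phi> :: "'n multiset \<Rightarrow> 'k"
      by (induction js arbitrary: \<alpha>) simp_all
    then show ?thesis by (simp add: f_def)
  qed
  define m where "m i = hclass A \<beta> (wd (map GenD (js i)))" for i
  have em: "em \<beta> (js i) = Poly_Mapping.single (m i) 1" for i
    by (simp add: em_def tv_def m_def)
  have val: "val (\<Phi> k) (m i) = f k i" if "k \<in> I" for k i
    unfolding m_def f_def by (rule val_hclass[OF sol[OF that]])
  have inj: "inj_on m I"
  proof (rule inj_onI)
    fix i k assume ik: "i \<in> I" "k \<in> I" "m i = m k"
    then have "f k i = f k k" using val[OF ik(2)] by metis
    then show "i = k" using diag[of i k] diag[of k k] ik f0 by metis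
  qed
  obtain R where R: "finite R"
    "{v. Poly_Mapping.keys v \<subseteq> carrier (xmodule A \<beta>)} \<subseteq> ps.span (relspace A \<beta> \<union> em \<beta> ` R)"
    using generic_fibre_fin_dim by blast
  have emW: "em \<beta> ` S \<subseteq> {v. Poly_Mapping.keys v \<subseteq> carrier (xmodule A \<beta>)}" for S
    using keys_tv[of A \<beta>] by (auto simp: em_def)
  have fd: "vectorspace.fin_dim ring_of (quotient_module (free_module (carrier (xmodule A \<beta>))) (relspace A \<beta>))"
    by (rule fin_dim_quotient[OF subspace_relspace relspace_subset finite_imageI[OF R(1)] emW R(2)])
  show ?thesis
    unfolding holonomic_rank_eq
  proof (rule dim_quotient_ge[OF subspace_relspace relspace_subset I _ fd])
    show "(\<lambda>i. em \<beta> (js i)) ` I \<subseteq> {v. Poly_Mapping.keys v \<subseteq> carrier (xmodule A \<beta>)}"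
      using emW[of "js ` I"] by (auto simp only: image_subset_iff)
    fix c assume "(\<Sum>i\<in>I. pscale (c i) (em \<beta> (js i))) \<in> relspace A \<beta>"
    from relspace_lval[where I = I and \<Phi> = \<Phi>, OF sol this] obtain q w where q: "q \<noteq> 0"
      and w: "\<And>x. Fract q 1 * Poly_Mapping.lookup (\<Sum>i\<in>I. pscale (c i) (em \<beta> (js i))) x = Fract (Poly_Mapping.lookup w x) 1"
      and lv: "\<And>i \<alpha>. i \<in> I \<Longrightarrow> lval (\<Phi> i) w \<alpha> = 0" by blast
    have look: "Poly_Mapping.lookup (\<Sum>i\<in>I. pscale (c i) (em \<beta> (js i))) x = (\<Sum>i\<in>I. if m i = x then c i else 0)" for x
      by (simp add: lookup_sum em lookup_single when_def if_distrib cong: if_cong)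
    have wc: "Fract (Poly_Mapping.lookup w (m k)) 1 = Fract q 1 * c k" if "k \<in> I" for k
    proof -
      have "(\<Sum>i\<in>I. if m i = m k then c i else 0) = (\<Sum>i\<in>I. if i = k then c i else 0)"
        using inj that by (intro sum.cong) (auto dest: inj_onD)
      then show ?thesis using w[of "m k"] that I by (simp add: look)
    qed
    have keys: "Poly_Mapping.keys w \<subseteq> m ` I"
    proof
      fix x assume "x \<in> Poly_Mapping.keys w"
      then have nz: "Poly_Mapping.lookup w x \<noteq> 0" by (simp add: in_keys_iff)
      show "x \<in> m ` I"
      proof (rule ccontr)
        assume "x \<notin> m ` I"
        then have "(\<Sum>i\<in>I. if m i = x then c i else 0) = 0" by (intro sum.neutral) auto
        then have "Fract (Poly_Mapping.lookup w x) 1 = Fract 0 1"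
          using w[of x] by (simp add: look Zero_fract_def)
        then show False using nz by (simp add: eq_fract)
      qed
    qed
    have "Poly_Mapping.lookup w (m i) = 0" if "i \<in> I" for i
    proof (rule act_independent[OF I, where f = f and ?x0.0 = x0 and p = "\<lambda>i. Poly_Mapping.lookup w (m i)"])
      show "i \<in> I" by fact
      show "f k i {#} \<noteq> 0 \<longleftrightarrow> i = k" if "i \<in> I" "k \<in> I" for i k
        using diag[OF that] by (simp add: f0)
      fix k \<alpha> assume k: "k \<in> I"
      have "0 = lval (\<Phi> k) w \<alpha>" using lv[OF k] by simp
      also have "\<dots> = (\<Sum>x\<in>m ` I. act x0 (poly_in GenX (Poly_Mapping.lookup w x)) (val (\<Phi> k) x) \<alpha>)"
        by (rule lval_superset) (use I keys in auto)
      also have "\<dots> = (\<Sum>i\<in>I. act x0 (poly_in GenX (Poly_Mapping.lookup w (m i))) (f k i) \<alpha>)"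
        using k by (simp add: sum.reindex[OF inj] val)
      finally show "(\<Sum>i\<in>I. act x0 (poly_in GenX (Poly_Mapping.lookup w (m i))) (f k i) \<alpha>) = 0" by simp
    qed
    then have "Fract q 1 * c i = 0" if "i \<in> I" for i using wc[OF that] that by (simp add: Zero_fract_def)
    moreover have "Fract q 1 \<noteq> 0" using q by (simp add: Zero_fract_def eq_fract)
    ultimately show "\<forall>i\<in>I. c i = 0" by simp
  qed
qed

lemma rank_le:
  assumes "finite R"
    and "\<And>js. \<exists>r\<in>R. \<exists>n n'. (\<forall>v. kc (mset (map vtx n @ js)) v = kc (mset (map vtx n' @ r)) v) \<and>
      (\<forall>v m. m < count (mset n) v \<longrightarrow> bc \<beta> v \<noteq> of_rat (kc (mset js) v) + of_nat m)"
  shows "holonomic_rank (hypergeometric_module A \<beta>) \<le> card R"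
proof -
  have emW: "em \<beta> ` S \<subseteq> {v. Poly_Mapping.keys v \<subseteq> carrier (xmodule A \<beta>)}" for S
    using keys_tv[of A \<beta>] by (auto simp: em_def)
  have "holonomic_rank (hypergeometric_module A \<beta>) \<le> card (em \<beta> ` R)"
    unfolding holonomic_rank_eq
    by (rule dim_quotient_le[OF subspace_relspace relspace_subset finite_imageI[OF assms(1)] emW
          generic_fibre_spanned[OF assms(2)]])
  then show ?thesis using card_image_le[OF assms(1), of "em \<beta>"] by simp
qed

end

end

section \<open>The rank in terms of the parameter\<close>

lemma exists_count: "\<exists>n. \<forall>v. count n v = f v" for f :: "'d::finite \<Rightarrow> nat"
  by (rule exI[of _ "\<Sum>v\<in>UNIV. replicate_mset (f v) v"])
     (simp add: count_sum if_distrib cong: if_cong)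

context simplicial
begin

text \<open>Two elements of \<open>\<nat>A\<close> are equivalent if they differ by an element of the lattice spanned by
  the vertices.\<close>

definition eqv :: "'n multiset \<Rightarrow> 'n multiset \<Rightarrow> bool" where
  "eqv \<alpha> \<alpha>' \<longleftrightarrow> (\<forall>v. kc \<alpha> v - kc \<alpha>' v \<in> Ints)"

text \<open>The classes; there are as many as elements of \<open>\<int>A\<close> modulo the lattice of the vertices, because
  every class of \<open>\<int>A\<close> meets \<open>\<nat>A\<close>.\<close>

definition vclasses :: "'n multiset set set" where
  "vclasses = UNIV // {(\<alpha>, \<alpha>'). eqv \<alpha> \<alpha>'}"

lemma eqv_refl [simp]: "eqv \<alpha> \<alpha>"
  by (simp add: eqv_def)

lemma eqv_sym: "eqv \<alpha> \<alpha>' \<Longrightarrow> eqv \<alpha>' \<alpha>"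
  unfolding eqv_def by (metis Ints_minus minus_diff_eq)

lemma eqv_trans: "eqv \<alpha> \<alpha>' \<Longrightarrow> eqv \<alpha>' \<alpha>'' \<Longrightarrow> eqv \<alpha> \<alpha>''"
proof -
  assume "eqv \<alpha> \<alpha>'" "eqv \<alpha>' \<alpha>''"
  then have "(kc \<alpha> v - kc \<alpha>' v) + (kc \<alpha>' v - kc \<alpha>'' v) \<in> Ints" for v
    unfolding eqv_def by (intro Ints_add) blast+
  then show "eqv \<alpha> \<alpha>''" by (simp add: eqv_def)
qed

lemma equiv_eqv: "equiv UNIV {(\<alpha>, \<alpha>'). eqv \<alpha> \<alpha>'}"
  by (auto intro!: equivI refl_onI symI transI intro: eqv_sym eqv_trans)

lemma eqv_add_vtx: "eqv (add_mset (vtx v) \<alpha>) \<alpha>"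
  by (simp add: eqv_def kappa_vtx)

text \<open>The vertices \<open>v\<close> in whose direction the recursion that starts at \<open>\<alpha>\<close> breaks down.\<close>

definition breaks :: "'k::field_char_0 ^ 'd \<Rightarrow> 'n multiset \<Rightarrow> 'd set" where
  "breaks \<beta> \<alpha> = {v. \<exists>m. bc \<beta> v = of_rat (kc \<alpha> v) + of_nat m}"

text \<open>In every class, the sets \<open>breaks\<close> have a largest element.  As the sets are finite, this fails for a
  class if and only if it has two different maximal sets.\<close>

definition directed :: "'k::field_char_0 ^ 'd \<Rightarrow> bool" where
  "directed \<beta> \<longleftrightarrow> (\<forall>\<alpha>. \<exists>\<rho>. eqv \<rho> \<alpha> \<and> (\<forall>\<alpha>'. eqv \<alpha>' \<alpha> \<longrightarrow> breaks \<beta> \<alpha>' \<subseteq> breaks \<beta> \<rho>))"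

context
  fixes \<beta> :: "'k::field_char_0 ^ 'd"
begin

lemma exists_maximal:
  "\<exists>\<rho>. eqv \<rho> \<alpha> \<and> breaks \<beta> \<alpha> \<subseteq> breaks \<beta> \<rho> \<and> (\<forall>\<alpha>'. eqv \<alpha>' \<rho> \<longrightarrow> breaks \<beta> \<rho> \<subseteq> breaks \<beta> \<alpha>' \<longrightarrow> breaks \<beta> \<alpha>' = breaks \<beta> \<rho>)"
proof -
  let ?P = "\<lambda>\<rho>. eqv \<rho> \<alpha> \<and> breaks \<beta> \<alpha> \<subseteq> breaks \<beta> \<rho>"
  have b: "\<forall>\<rho>. ?P \<rho> \<longrightarrow> card (breaks \<beta> \<rho>) < Suc CARD('d)"
    by (auto simp: less_Suc_eq_le intro: card_mono)
  obtain \<rho> where \<rho>: "?P \<rho>" "\<forall>\<rho>'. ?P \<rho>' \<longrightarrow> card (breaks \<beta> \<rho>') \<le> card (breaks \<beta> \<rho>)"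
    using ex_has_greatest_nat[of ?P \<alpha> "\<lambda>\<rho>. card (breaks \<beta> \<rho>)" "Suc CARD('d)"] b by auto
  have "breaks \<beta> \<alpha>' = breaks \<beta> \<rho>" if "eqv \<alpha>' \<rho>" "breaks \<beta> \<rho> \<subseteq> breaks \<beta> \<alpha>'" for \<alpha>'
  proof -
    have "?P \<alpha>'" using \<rho>(1) that eqv_trans by blast
    then show ?thesis using \<rho>(2) that(2) by (metis card_seteq finite)
  qed
  then show ?thesis using \<rho> by blast
qed

text \<open>If \<open>\<rho>\<close> has the largest set in its class, write the difference to an element \<open>\<alpha>\<close> of the class as
  \<open>\<rho> - \<alpha> = n - n'\<close> with disjoint nonnegative combinations \<open>n\<close>, \<open>n'\<close> of the vertices.  A vanishing factor
  on the way from \<open>\<alpha>\<close> to \<open>\<alpha> + n\<close> in direction \<open>v\<close> would put \<open>v\<close> into \<open>breaks \<beta> \<alpha>\<close> but not into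
  \<open>breaks \<beta> \<rho>\<close>.\<close>

lemma rank_le_classes:
  assumes "directed \<beta>" and fin: "finite vclasses"
  shows "holonomic_rank (hypergeometric_module A \<beta>) \<le> card vclasses"
proof -
  obtain r where r: "\<And>\<alpha>. eqv (r \<alpha>) \<alpha>" "\<And>\<alpha> \<alpha>'. eqv \<alpha>' \<alpha> \<Longrightarrow> breaks \<beta> \<alpha>' \<subseteq> breaks \<beta> (r \<alpha>)"
    using assms(1) unfolding directed_def by metis
  obtain l where l: "\<And>\<alpha> :: 'n multiset. mset (l \<alpha>) = \<alpha>" using ex_mset by metis
  define rep where "rep C = l (r (SOME \<alpha>. \<alpha> \<in> C))" for C
  have "holonomic_rank (hypergeometric_module A \<beta>) \<le> card (rep ` vclasses)"
  proof (rule rank_le)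
    show "finite (rep ` vclasses)" using fin by simp
    fix js
    define C where "C = {(\<alpha>, \<alpha>'). eqv \<alpha> \<alpha>'} `` {mset js}"
    have C: "C \<in> vclasses" unfolding C_def vclasses_def by (rule quotientI) simp
    have "(SOME \<alpha>. \<alpha> \<in> C) \<in> C" by (rule someI[of _ "mset js"]) (simp add: C_def)
    then have eq: "eqv (mset js) (SOME \<alpha>. \<alpha> \<in> C)" by (simp add: C_def)
    define \<rho> where "\<rho> = r (SOME \<alpha>. \<alpha> \<in> C)"
    have \<rho>: "eqv (mset js) \<rho>" "breaks \<beta> (mset js) \<subseteq> breaks \<beta> \<rho>"
      using r[of "SOME \<alpha>. \<alpha> \<in> C"] r(2)[OF eq] eq eqv_trans eqv_sym unfolding \<rho>_def by blast+
    have rep: "mset (rep C) = \<rho>" by (simp add: rep_def \<rho>_def l)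
    have "\<exists>z. kc \<rho> v - kc (mset js) v = of_int z" for v
      using eqv_sym[OF \<rho>(1)] by (auto simp: eqv_def elim: Ints_cases)
    then obtain z where z: "\<And>v. kc \<rho> v - kc (mset js) v = of_int (z v)" by metis
    obtain n where n: "\<And>v. count (mset n) v = nat (z v)" using exists_count[of "\<lambda>v. nat (z v)"] ex_mset by metis
    obtain n' where n': "\<And>v. count (mset n') v = nat (- z v)"
      using exists_count[of "\<lambda>v. nat (- z v)"] ex_mset by metis
    have "kc (mset (map vtx n @ js)) v = kc (mset (map vtx n' @ rep C)) v" for v
    proof -
      have "kc (mset (map vtx n @ js)) v = of_nat (nat (z v)) + kc (mset js) v"
        using kc_vtx[of "mset n" v] n by simp
      also have "\<dots> = of_nat (nat (- z v)) + kc \<rho> v"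
      proof (cases "z v \<ge> 0")
        case True
        then show ?thesis using z[of v] by simp
      next
        case False
        then show ?thesis using z[of v] by (simp add: algebra_simps)
      qed
      also have "\<dots> = kc (mset (map vtx n' @ rep C)) v"
        using kc_vtx[of "mset n'" v] n' rep by simp
      finally show ?thesis .
    qed
    moreover have "bc \<beta> v \<noteq> of_rat (kc (mset js) v) + of_nat m" if m: "m < count (mset n) v" for v m
    proof
      assume eq: "bc \<beta> v = of_rat (kc (mset js) v) + of_nat m"
      then have "v \<in> breaks \<beta> (mset js)" unfolding breaks_def by blast
      then have "v \<in> breaks \<beta> \<rho>" using \<rho>(2) by blast
      then obtain m' where "bc \<beta> v = of_rat (kc \<rho> v) + of_nat m'" by (auto simp: breaks_def)
      then have "(of_rat (kc (mset js) v + of_nat m) :: 'k) = of_rat (kc \<rho> v + of_nat m')"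
        using eq by (simp add: of_rat_add)
      then have "kc (mset js) v + of_nat m = kc \<rho> v + of_nat m'" by (simp only: of_rat_eq_iff)
      then have "of_int (z v) + of_nat m' = (of_nat m :: rat)" using z[of v] by (simp add: algebra_simps)
      then have "z v + int m' = int m" by linarith
      then show False using m n[of v] by simp
    qed
    ultimately show "\<exists>r\<in>rep ` vclasses. \<exists>n n'. (\<forall>v. kc (mset (map vtx n @ js)) v = kc (mset (map vtx n' @ r)) v) \<and>
      (\<forall>v m. m < count (mset n) v \<longrightarrow> bc \<beta> v \<noteq> of_rat (kc (mset js) v) + of_nat m)"
      using C by blast
  qed
  then show ?thesis using card_image_le[OF fin, of rep] by simp
qed

text \<open>The factor of the recursion, replaced by 1 where it vanishes.\<close>

definition factor :: "'d \<Rightarrow> rat \<Rightarrow> 'k" where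
  "factor v q = (if bc \<beta> v = of_rat q then 1 else bc \<beta> v - of_rat q)"

text \<open>A nowhere vanishing function that satisfies the recursion in one direction wherever it does not
  break down: the product of the factors at the points \<open>q - 1, q - 2, \<dots>\<close> that are nonnegative.\<close>

definition gam :: "'d \<Rightarrow> rat \<Rightarrow> 'k" where
  "gam v q = (\<Prod>i<nat \<lfloor>q\<rfloor>. factor v (frac q + of_nat i))"

lemma gam_nonzero: "gam v q \<noteq> 0"
  by (simp add: gam_def factor_def)

lemma gam_step: "q \<ge> 0 \<Longrightarrow> gam v (1 + q) = factor v q * gam v q"
proof -
  assume q: "q \<ge> 0"
  have "nat \<lfloor>1 + q\<rfloor> = Suc (nat \<lfloor>q\<rfloor>)" using q by (simp add: nat_add_distrib)
  moreover have "frac (1 + q) = frac q" by (simp add: frac_def)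
  moreover have "frac q + of_nat (nat \<lfloor>q\<rfloor>) = q" using q by (simp add: frac_def)
  ultimately show ?thesis by (simp add: gam_def)
qed

text \<open>The solution attached to \<open>\<rho>\<close>: the product of the functions \<open>gam\<close>, cut off outside the elements of
  the class of \<open>\<rho>\<close> that have the same set \<open>breaks\<close>.\<close>

definition basic :: "'n multiset \<Rightarrow> 'n multiset \<Rightarrow> 'k" where
  "basic \<rho> \<alpha> = (if eqv \<alpha> \<rho> \<and> breaks \<beta> \<alpha> = breaks \<beta> \<rho> then (\<Prod>v\<in>UNIV. gam v (kc \<alpha> v)) else 0)"

lemma basic_nonzero_iff: "basic \<rho> \<alpha> \<noteq> 0 \<longleftrightarrow> eqv \<alpha> \<rho> \<and> breaks \<beta> \<alpha> = breaks \<beta> \<rho>"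
  by (simp add: basic_def gam_nonzero)

text \<open>Adding a vertex \<open>v\<close> changes the set \<open>breaks\<close> only where the factor vanishes, and then it removes \<open>v\<close>
  from it.  By maximality the smaller set is not that of \<open>\<rho>\<close>, so that the cut-off is compatible with
  the recursion.\<close>

lemma solution_basic:
  assumes max: "\<And>\<alpha>'. eqv \<alpha>' \<rho> \<Longrightarrow> breaks \<beta> \<rho> \<subseteq> breaks \<beta> \<alpha>' \<Longrightarrow> breaks \<beta> \<alpha>' = breaks \<beta> \<rho>"
  shows "solution \<beta> (basic \<rho>)"
  unfolding solution_def
proof (intro conjI allI impI)
  fix \<alpha> \<alpha>' assume "\<forall>v. kc \<alpha> v = kc \<alpha>' v"
  then show "basic \<rho> \<alpha> = basic \<rho> \<alpha>'" by (simp add: basic_def eqv_def breaks_def)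
next
  fix \<alpha> v
  let ?\<alpha> = "add_mset (vtx v) \<alpha>"
  have kc: "kc ?\<alpha> w = (if w = v then 1 + kc \<alpha> w else kc \<alpha> w)" for w by (simp add: kappa_vtx)
  have eqv: "eqv ?\<alpha> \<rho> \<longleftrightarrow> eqv \<alpha> \<rho>"
    using eqv_add_vtx[of v \<alpha>] eqv_trans eqv_sym by blast
  show "basic \<rho> ?\<alpha> = (bc \<beta> v - of_rat (kc \<alpha> v)) * basic \<rho> \<alpha>"
  proof (cases "bc \<beta> v = of_rat (kc \<alpha> v)")
    case True
    have "basic \<rho> ?\<alpha> = 0"
    proof (rule ccontr)
      assume "basic \<rho> ?\<alpha> \<noteq> 0"
      then have m: "eqv \<alpha> \<rho>" "breaks \<beta> ?\<alpha> = breaks \<beta> \<rho>" using eqv by (auto simp: basic_nonzero_iff)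
      have "v \<in> breaks \<beta> \<alpha>" using True by (auto simp: breaks_def intro: exI[of _ 0])
      have notin: "v \<notin> breaks \<beta> ?\<alpha>"
      proof
        assume "v \<in> breaks \<beta> ?\<alpha>"
        then obtain k where "bc \<beta> v = of_rat (1 + kc \<alpha> v) + of_nat k"
          unfolding breaks_def kc by auto
        then have "(of_nat (Suc k) :: 'k) = 0" using True by (simp add: of_rat_add)
        then show False by (simp only: of_nat_eq_0_iff)
      qed
      have "breaks \<beta> ?\<alpha> \<subseteq> breaks \<beta> \<alpha>"
      proof
        fix w assume w: "w \<in> breaks \<beta> ?\<alpha>"
        then show "w \<in> breaks \<beta> \<alpha>" using notin by (cases "w = v") (auto simp: breaks_def kappa_vtx)
      qed
      then have "breaks \<beta> \<alpha> = breaks \<beta> \<rho>" using max[OF m(1)] m(2) by simp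
      then show False using \<open>v \<in> breaks \<beta> \<alpha>\<close> notin m(2) by simp
    qed
    then show ?thesis using True by simp
  next
    case False
    have "w \<in> breaks \<beta> ?\<alpha> \<longleftrightarrow> w \<in> breaks \<beta> \<alpha>" for w
    proof (cases "w = v")
      case [simp]: True
      have "(\<exists>m. bc \<beta> v = of_rat (kc \<alpha> v) + of_nat m) \<longleftrightarrow> (\<exists>m. bc \<beta> v = of_rat (1 + kc \<alpha> v) + of_nat m)"
      proof
        assume "\<exists>m. bc \<beta> v = of_rat (kc \<alpha> v) + of_nat m"
        then obtain m where m: "bc \<beta> v = of_rat (kc \<alpha> v) + of_nat m" by blast
        then have "m \<noteq> 0" using False by (intro notI) simp
        then obtain m' where "m = Suc m'" by (cases m) auto
        then show "\<exists>m. bc \<beta> v = of_rat (1 + kc \<alpha> v) + of_nat m"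
          using m by (intro exI[of _ m']) (simp add: of_rat_add)
      next
        assume "\<exists>m. bc \<beta> v = of_rat (1 + kc \<alpha> v) + of_nat m"
        then obtain m where "bc \<beta> v = of_rat (1 + kc \<alpha> v) + of_nat m" by blast
        then show "\<exists>m. bc \<beta> v = of_rat (kc \<alpha> v) + of_nat m"
          by (intro exI[of _ "Suc m"]) (simp add: of_rat_add)
      qed
      then show ?thesis unfolding breaks_def mem_Collect_eq kc by simp
    next
      case False
      then show ?thesis unfolding breaks_def mem_Collect_eq kc by simp
    qed
    then have breaks: "breaks \<beta> ?\<alpha> = breaks \<beta> \<alpha>" by blast
    have "(\<Prod>w\<in>UNIV. gam w (kc ?\<alpha> w)) = (\<Prod>w\<in>UNIV. (if w = v then factor v (kc \<alpha> v) else 1) * gam w (kc \<alpha> w))"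
      using gam_step[OF kc_nonneg] by (intro prod.cong refl) (simp add: kc del: kc_simps)
    also have "\<dots> = factor v (kc \<alpha> v) * (\<Prod>w\<in>UNIV. gam w (kc \<alpha> w))"
      by (simp add: prod.distrib)
    also have "factor v (kc \<alpha> v) = bc \<beta> v - of_rat (kc \<alpha> v)" using False by (simp add: factor_def)
    finally show ?thesis by (simp add: basic_def eqv breaks)
  qed
qed

text \<open>One element with maximal set is chosen in every class, and a second one, with a different
  maximal set, in a class that has no largest set.\<close>

lemma rank_gt_classes:
  assumes "\<not> directed \<beta>" and fin: "finite vclasses"
  shows "card vclasses < holonomic_rank (hypergeometric_module A \<beta>)"
proof -
  define maximal where "maximal \<rho> \<longleftrightarrow> (\<forall>\<alpha>'. eqv \<alpha>' \<rho> \<longrightarrow> breaks \<beta> \<rho> \<subseteq> breaks \<beta> \<alpha>' \<longrightarrow> breaks \<beta> \<alpha>' = breaks \<beta> \<rho>)" for \<rho>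
  have ex: "\<exists>\<rho>. eqv \<rho> \<alpha> \<and> breaks \<beta> \<alpha> \<subseteq> breaks \<beta> \<rho> \<and> maximal \<rho>" for \<alpha>
    unfolding maximal_def by (rule exists_maximal)
  have "\<forall>C\<in>vclasses. \<exists>\<rho>. \<rho> \<in> C \<and> maximal \<rho>"
  proof
    fix C assume "C \<in> vclasses"
    then obtain \<alpha> where C: "C = {(\<alpha>, \<alpha>'). eqv \<alpha> \<alpha>'} `` {\<alpha>}" unfolding vclasses_def by (rule quotientE)
    then show "\<exists>\<rho>. \<rho> \<in> C \<and> maximal \<rho>" using ex[of \<alpha>] eqv_sym by blast
  qed
  then obtain a where a: "\<And>C. C \<in> vclasses \<Longrightarrow> a C \<in> C" "\<And>C. C \<in> vclasses \<Longrightarrow> maximal (a C)" by metis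
  from assms(1) obtain \<alpha> where \<alpha>: "\<And>\<rho>. eqv \<rho> \<alpha> \<Longrightarrow> \<exists>\<alpha>'. eqv \<alpha>' \<alpha> \<and> \<not> breaks \<beta> \<alpha>' \<subseteq> breaks \<beta> \<rho>"
    unfolding directed_def by blast
  define C0 where "C0 = {(\<alpha>, \<alpha>'). eqv \<alpha> \<alpha>'} `` {\<alpha>}"
  have C0: "C0 \<in> vclasses" unfolding C0_def vclasses_def by (rule quotientI) simp
  have aC0: "eqv (a C0) \<alpha>" using a(1)[OF C0] by (auto simp: C0_def intro: eqv_sym)
  then obtain \<alpha>' where \<alpha>': "eqv \<alpha>' \<alpha>" "\<not> breaks \<beta> \<alpha>' \<subseteq> breaks \<beta> (a C0)" using \<alpha> by blast
  then obtain \<sigma> where \<sigma>: "eqv \<sigma> \<alpha>'" "breaks \<beta> \<alpha>' \<subseteq> breaks \<beta> \<sigma>" "maximal \<sigma>" using ex by blast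
  have ne: "breaks \<beta> \<sigma> \<noteq> breaks \<beta> (a C0)" using \<alpha>' \<sigma> by blast
  have same: "C = C'" if "C \<in> vclasses" "C' \<in> vclasses" "x \<in> C" "y \<in> C'" "eqv x y" for C C' x y
    using quotient_eqI[OF equiv_eqv, of C C' x y] that unfolding vclasses_def by auto
  have \<sigma>C0: "\<sigma> \<in> C0" using \<sigma>(1) \<alpha>'(1) by (auto simp: C0_def intro: eqv_sym eqv_trans)
  have "inj_on a vclasses" using a(1) same eqv_refl by (metis inj_onI)
  then have "card (a ` vclasses) = card vclasses" by (rule card_image)
  moreover have "\<sigma> \<notin> a ` vclasses" using same[OF C0 _ \<sigma>C0] a(1) ne eqv_refl by blast
  ultimately have card: "card (insert \<sigma> (a ` vclasses)) = Suc (card vclasses)" using fin by simp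
  obtain l where l: "\<And>\<alpha> :: 'n multiset. mset (l \<alpha>) = \<alpha>" using ex_mset by metis
  have "card (insert \<sigma> (a ` vclasses)) \<le> holonomic_rank (hypergeometric_module A \<beta>)"
  proof (rule rank_ge[where \<Phi> = basic and js = l])
    show "finite (insert \<sigma> (a ` vclasses))" using fin by simp
    show "solution \<beta> (basic i)" if "i \<in> insert \<sigma> (a ` vclasses)" for i
      using that a(2) \<sigma>(3) by (intro solution_basic) (auto simp: maximal_def)
    show "basic k (mset (l i)) \<noteq> 0 \<longleftrightarrow> i = k"
      if mem: "i \<in> insert \<sigma> (a ` vclasses)" "k \<in> insert \<sigma> (a ` vclasses)" for i k
    proof
      assume "basic k (mset (l i)) \<noteq> 0"
      then have ik: "eqv i k" "breaks \<beta> i = breaks \<beta> k" by (simp_all add: basic_nonzero_iff l)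
      show "i = k"
      proof (cases "i = \<sigma>")
        case True
        show ?thesis
        proof (rule ccontr)
          assume "i \<noteq> k"
          then obtain C where C: "C \<in> vclasses" "k = a C" using mem True \<open>i \<noteq> k\<close> by auto
          then have "C0 = C" using same[OF C0 C(1) \<sigma>C0 a(1)] ik True by simp
          then show False using C ik ne True by simp
        qed
      next
        case False
        then obtain C where C: "C \<in> vclasses" "i = a C" using mem by auto
        show ?thesis
        proof (cases "k = \<sigma>")
          case True
          then have "C = C0" using same[OF C(1) C0 a(1)[OF C(1)] \<sigma>C0] C ik by simp
          then show ?thesis using C ik ne True by simp
        next
          case False
          then obtain C' where C': "C' \<in> vclasses" "k = a C'" using mem by auto
          then show ?thesis using same[OF C(1) C'(1) a(1)[OF C(1)] a(1)[OF C'(1)]] C ik by simp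
        qed
      qed
    qed (simp add: basic_nonzero_iff l)
  qed
  then show ?thesis using card by simp
qed

end

end

section \<open>Faces of the simplex and the two conditions\<close>

context simplicial
begin

text \<open>The face spanned by a set of vertices.\<close>

definition face :: "'d set \<Rightarrow> (real ^ 'd) set" where
  "face W = {y. (\<forall>v. vc y $ v \<ge> 0) \<and> (\<Sum>v\<in>UNIV. vc y $ v) = 1 \<and> (\<forall>v. v \<notin> W \<longrightarrow> vc y $ v = 0)}"

lemma vc_axis: "vc (acol A (vtx w) :: 'a::field_char_0 ^ 'd) = axis w 1"
  by (simp add: vec_eq_iff vc_acol kappa_vtx axis_def)

lemma Bmat_sum: "(Bmat :: 'a::field_char_0 ^ 'd ^ 'd) *v x = (\<Sum>v\<in>UNIV. x $ v *s acol A (vtx v))"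
  by (simp add: vec_eq_iff matrix_vector_mult_def Bmat_def acol_def mult.commute)

lemma vc_expand: "(\<Sum>v\<in>UNIV. vc x $ v *s acol A (vtx v)) = (x :: 'a::field_char_0 ^ 'd)"
  using Bmat_sum[of "vc x"] by (simp add: Bmat_vc)

lemma vc_smult: "vc (c *s x) = c *s (vc x :: 'a::field_char_0 ^ 'd)"
  by (simp add: vc_def vector_scalar_commute)

lemma inj_acol_vtx: "inj (\<lambda>v. acol A (vtx v) :: real ^ 'd)"
  by (rule injI) (metis axis_eq_axis vc_axis zero_neq_one)

lemma face_hull: "face W = convex hull ((\<lambda>v. acol A (vtx v)) ` W)"
proof
  show "face W \<subseteq> convex hull ((\<lambda>v. acol A (vtx v)) ` W)"
  proof
    fix y assume y: "y \<in> face W"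
    have "y = (\<Sum>v\<in>UNIV. vc y $ v *s acol A (vtx v))" by (rule vc_expand[symmetric])
    also have "\<dots> = (\<Sum>v\<in>W. vc y $ v *\<^sub>R acol A (vtx v))"
      using y by (intro sum.mono_neutral_cong_right) (auto simp: face_def scalar_mult_eq_scaleR)
    also have "\<dots> \<in> convex hull ((\<lambda>v. acol A (vtx v)) ` W)"
    proof (rule convex_sum)
      have "(\<Sum>v\<in>W. vc y $ v) = (\<Sum>v\<in>UNIV. vc y $ v)"
        using y by (intro sum.mono_neutral_left) (auto simp: face_def)
      then show "(\<Sum>v\<in>W. vc y $ v) = 1" using y by (simp add: face_def)
      show "acol A (vtx v) \<in> convex hull ((\<lambda>v. acol A (vtx v)) ` W)" if "v \<in> W" for v
        using that by (intro hull_inc) blast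
    qed (use y in \<open>auto simp: face_def convex_convex_hull\<close>)
    finally show "y \<in> convex hull ((\<lambda>v. acol A (vtx v)) ` W)" .
  qed
  show "convex hull ((\<lambda>v. acol A (vtx v)) ` W) \<subseteq> face W"
  proof (rule hull_minimal)
    show "(\<lambda>v. acol A (vtx v)) ` W \<subseteq> face W"
      by (auto simp: face_def vc_axis axis_def)
    show "convex (face W)"
    proof (rule convexI)
      fix x y :: "real ^ 'd" and a b :: real
      assume xy: "x \<in> face W" "y \<in> face W" "0 \<le> a" "0 \<le> b" "a + b = 1"
      have "vc (a *\<^sub>R x + b *\<^sub>R y) = a *s vc x + b *s vc y"
        by (simp add: vc_add vc_smult flip: scalar_mult_eq_scaleR)
      then show "a *\<^sub>R x + b *\<^sub>R y \<in> face W"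
        using xy by (simp add: face_def sum.distrib flip: sum_distrib_left)
    qed
  qed
qed

lemma acol_in_face: "acol A j \<in> face W \<longleftrightarrow> (\<forall>v. v \<notin> W \<longrightarrow> \<kappa> j v = 0)"
proof -
  have "(\<Sum>v\<in>UNIV. of_rat (\<kappa> j v) :: real) = 1"
    using sum1[of j] by (simp flip: of_rat_sum)
  then show ?thesis using nonneg by (auto simp: face_def vc_acol)
qed

lemma conv_A_face: "conv_A A = face UNIV"
proof
  show "conv_A A \<subseteq> face UNIV"
    unfolding conv_A_def by (rule hull_minimal) (auto simp: acol_in_face, simp add: face_hull convex_convex_hull)
  show "face UNIV \<subseteq> conv_A A"
    unfolding conv_A_def face_hull by (rule hull_mono) auto
qed

lemma affine_independent_vertices: "\<not> affine_dependent (range (\<lambda>v. acol A (vtx v) :: real ^ 'd))"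
proof -
  have "independent (range (\<lambda>v. acol A (vtx v) :: real ^ 'd))"
  proof (rule independent_if_scalars_zero)
    show "finite (range (\<lambda>v. acol A (vtx v) :: real ^ 'd))" by simp
    fix f :: "real ^ 'd \<Rightarrow> real" and x :: "real ^ 'd"
    assume f: "(\<Sum>x\<in>range (\<lambda>v. acol A (vtx v)). f x *\<^sub>R x) = 0" and x: "x \<in> range (\<lambda>v. acol A (vtx v))"
    have "0 = (\<Sum>v\<in>UNIV. f (acol A (vtx v)) *s (acol A (vtx v) :: real ^ 'd))"
      using f by (simp add: sum.reindex[OF inj_acol_vtx] scalar_mult_eq_scaleR)
    then have "0 = (Bmat *v (\<chi> v. f (acol A (vtx v))) :: real ^ 'd)" by (simp add: Bmat_sum)
    then have "vc 0 = (\<chi> v. f (acol A (vtx v)))" by (metis vc_Bmat)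
    then have "(\<chi> v. f (acol A (vtx v))) = 0" by (simp add: vc_def)
    then show "f x = 0" using x by (auto simp: vec_eq_iff)
  qed
  then show ?thesis using affine_dependent_imp_dependent by blast
qed

lemma face_of_iff: "\<tau> face_of conv_A A \<longleftrightarrow> (\<exists>W. \<tau> = face W)"
proof -
  have "\<tau> face_of conv_A A \<longleftrightarrow> (\<exists>c\<subseteq>range (\<lambda>v. acol A (vtx v)). \<tau> = convex hull c)"
    unfolding conv_A_face face_hull
    by (rule face_of_convex_hull_affine_independent[OF affine_independent_vertices])
  also have "\<dots> \<longleftrightarrow> (\<exists>W. \<tau> = face W)"
    unfolding face_hull subset_image_iff by auto
  finally show ?thesis .
qed

lemma face_INT: "S \<noteq> {} \<Longrightarrow> (\<Inter>i\<in>S. face (W i)) = face (\<Inter>i\<in>S. W i)"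
  by (auto simp: face_def)

lemma face_Int: "face W \<inter> face W' = face (W \<inter> W')"
  by (auto simp: face_def)

lemma cols_in_face: "cols_in A (face W) = {j. \<forall>v. v \<notin> W \<longrightarrow> \<kappa> j v = 0}"
  by (simp add: cols_in_def acol_in_face)

lemma kspan_face: "kspan A (cols_in A (face W)) = {x :: 'k::field_char_0 ^ 'd. \<forall>v. v \<notin> W \<longrightarrow> vc x $ v = 0}"
  unfolding kspan_def
proof
  show "vec.span (acol A ` cols_in A (face W)) \<subseteq> {x :: 'k ^ 'd. \<forall>v. v \<notin> W \<longrightarrow> vc x $ v = 0}"
  proof (rule vec.span_minimal)
    show "acol A ` cols_in A (face W) \<subseteq> {x :: 'k ^ 'd. \<forall>v. v \<notin> W \<longrightarrow> vc x $ v = 0}"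
      by (auto simp: cols_in_face vc_acol)
    have "vc 0 = (0 :: 'k ^ 'd)" by (simp add: vc_def)
    then show "vec.subspace {x :: 'k ^ 'd. \<forall>v. v \<notin> W \<longrightarrow> vc x $ v = 0}"
      by (simp add: vec.subspace_def vc_add vc_smult)
  qed
  show "{x :: 'k ^ 'd. \<forall>v. v \<notin> W \<longrightarrow> vc x $ v = 0} \<subseteq> vec.span (acol A ` cols_in A (face W))"
  proof
    fix x :: "'k ^ 'd" assume x: "x \<in> {x. \<forall>v. v \<notin> W \<longrightarrow> vc x $ v = 0}"
    have "(\<Sum>v\<in>UNIV. vc x $ v *s acol A (vtx v)) \<in> vec.span (acol A ` cols_in A (face W))"
    proof (rule vec.span_sum)
      fix v
      show "vc x $ v *s acol A (vtx v) \<in> vec.span (acol A ` cols_in A (face W))"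
      proof (cases "v \<in> W")
        case True
        then have "vtx v \<in> cols_in A (face W)" by (auto simp: cols_in_face kappa_vtx)
        then show ?thesis by (intro vec.span_scale vec.span_base) blast
      next
        case False
        then have "vc x $ v *s acol A (vtx v) = (0 :: 'k ^ 'd)" using x by simp
        then show ?thesis by (simp only: vec.span_zero)
      qed
    qed
    then show "x \<in> vec.span (acol A ` cols_in A (face W))" by (simp add: vc_expand)
  qed
qed

lemma NA_asum: "NA A = range (asum :: 'n multiset \<Rightarrow> 'a::ring_1 ^ 'd)"
proof -
  have *: "(\<Sum>j\<in>UNIV. of_nat (count \<alpha> j) *s acol A j) = (asum \<alpha> :: 'a ^ 'd)" for \<alpha>
  proof (induction \<alpha>)
    case (add k \<alpha>)
    have "(\<Sum>j\<in>UNIV. of_nat (count (add_mset k \<alpha>) j) *s acol A j) =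
        (\<Sum>j\<in>UNIV. (if j = k then acol A k else 0) + of_nat (count \<alpha> j) *s (acol A j :: 'a ^ 'd))"
      by (intro sum.cong) (auto simp: vector_sadd_rdistrib)
    then show ?case using add by (simp add: sum.distrib)
  qed simp
  show ?thesis
  proof
    show "NA A \<subseteq> range (asum :: 'n multiset \<Rightarrow> 'a ^ 'd)"
    proof
      fix x :: "'a ^ 'd" assume "x \<in> NA A"
      then obtain c where c: "x = (\<Sum>j\<in>UNIV. of_nat (c j) *s acol A j)" by (auto simp: NA_def)
      obtain \<alpha> :: "'n multiset" where "\<forall>j. count \<alpha> j = c j" using exists_count[of c] by blast
      then show "x \<in> range asum" using c *[of \<alpha>] by auto
    qed
    show "range (asum :: 'n multiset \<Rightarrow> 'a ^ 'd) \<subseteq> NA A"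
      unfolding NA_def using *[symmetric] by blast
  qed
qed

text \<open>The set \<open>\<nat>A + \<int>(A \<inter> \<tau>)\<close> for the face \<open>\<tau>\<close> spanned by \<open>W\<close>.  Subtracting vertices of \<open>\<tau>\<close> suffices,
  because a multiple of every column in \<open>\<tau>\<close> is a sum of such vertices.\<close>

definition vdiff :: "'d set \<Rightarrow> ('a::field_char_0 ^ 'd) set" where
  "vdiff W = {asum \<alpha> - asum (image_mset vtx n) | \<alpha> n. set_mset n \<subseteq> W}"

lemma vdiff_add: "x \<in> vdiff W \<Longrightarrow> y \<in> vdiff W \<Longrightarrow> x + y \<in> vdiff W"
proof -
  assume "x \<in> vdiff W" "y \<in> vdiff W"
  then obtain \<alpha> n \<alpha>' n' where "x = asum \<alpha> - asum (image_mset vtx n)" "y = asum \<alpha>' - asum (image_mset vtx n')"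
    "set_mset n \<subseteq> W" "set_mset n' \<subseteq> W" by (auto simp: vdiff_def)
  then have "x + y = asum (\<alpha> + \<alpha>') - asum (image_mset vtx (n + n'))" "set_mset (n + n') \<subseteq> W" by simp_all
  then show ?thesis unfolding vdiff_def by blast
qed

lemma vdiff_acol: "asum \<alpha> \<in> vdiff W"
  unfolding vdiff_def by (rule CollectI, rule exI[of _ \<alpha>], rule exI[of _ "{#}"]) simp

lemma vdiff_minus_acol:
  assumes "j \<in> cols_in A (face W)"
  shows "- acol A j \<in> (vdiff W :: ('a::field_char_0 ^ 'd) set)"
proof -
  obtain m f where m: "m > 0" and f: "\<And>j v. of_nat m * \<kappa> j v = of_nat (f j v)"
    by (rule common_denominator) blast
  obtain n where n: "\<And>v. count n v = f j v" using exists_count[of "f j"] by blast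
  have "set_mset n \<subseteq> W"
  proof
    fix v assume "v \<in># n"
    then have "f j v \<noteq> 0" using n[of v] by (metis count_eq_zero_iff)
    then have "\<kappa> j v \<noteq> 0" using f[of j v] by auto
    then show "v \<in> W" using assms by (auto simp: cols_in_face)
  qed
  moreover have "kc (replicate_mset m j) v = kc (image_mset vtx n) v" for v
    by (simp add: kc_replicate kc_vtx n f)
  then have "asum (replicate_mset m j) = (asum (image_mset vtx n) :: 'a ^ 'd)" by (simp add: asum_eq_iff)
  moreover have "asum (replicate_mset m j) = acol A j + (asum (replicate_mset (m - 1) j) :: 'a ^ 'd)"
    using m by (cases m) simp_all
  ultimately have "- acol A j = asum (replicate_mset (m - 1) j) - (asum (image_mset vtx n) :: 'a ^ 'd)"
    by (simp add: algebra_simps)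
  then show ?thesis using \<open>set_mset n \<subseteq> W\<close> unfolding vdiff_def by blast
qed

lemma Zspan_vdiff: "Zspan A (cols_in A (face W)) \<subseteq> (vdiff W :: ('a::field_char_0 ^ 'd) set)"
proof
  fix z :: "'a ^ 'd" assume "z \<in> Zspan A (cols_in A (face W))"
  then obtain c where z: "z = (\<Sum>j\<in>cols_in A (face W). of_int (c j) *s acol A j)" by (auto simp: Zspan_def)
  have zero: "0 \<in> (vdiff W :: ('a ^ 'd) set)" using vdiff_acol[of "{#}"] by simp
  have nat: "of_nat k *s x \<in> vdiff W" if "x \<in> vdiff W" for k and x :: "'a ^ 'd"
    using that zero by (induction k) (simp_all add: vector_sadd_rdistrib vdiff_add)
  have "of_int c *s acol A j \<in> (vdiff W :: ('a ^ 'd) set)" if j: "j \<in> cols_in A (face W)" for c j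
  proof (cases "c \<ge> 0")
    case True
    then obtain k where "c = int k" using nonneg_int_cases by blast
    then show ?thesis using nat[OF vdiff_acol[of "{#j#}"], of k] by simp
  next
    case False
    then obtain k where k: "c = - int k" by (metis int_cases2 of_nat_0_le_iff)
    have "of_int c *s acol A j = of_nat k *s (- acol A j :: 'a ^ 'd)" by (simp add: k vec_eq_iff)
    then show ?thesis using nat[OF vdiff_minus_acol[OF j], of k] by simp
  qed
  then have "(\<Sum>j\<in>S. of_int (c j) *s acol A j) \<in> (vdiff W :: ('a ^ 'd) set)" if "S \<subseteq> cols_in A (face W)" for S
    using finite_subset[OF that] that
    by (induction S rule: infinite_finite_induct) (auto intro: zero vdiff_add)
  then show "z \<in> vdiff W" unfolding z by blast
qed

lemma Zspan_0: "0 \<in> (Zspan A J :: ('a::ring_1 ^ 'd) set)"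
  unfolding Zspan_def by (rule CollectI, rule exI[of _ "\<lambda>_. 0"]) simp

lemma Zspan_diff: "x \<in> Zspan A J \<Longrightarrow> y \<in> Zspan A J \<Longrightarrow> x - y \<in> (Zspan A J :: ('a::ring_1 ^ 'd) set)"
proof -
  assume "x \<in> Zspan A J" "y \<in> Zspan A J"
  then obtain c d where "x = (\<Sum>j\<in>J. of_int (c j) *s acol A j)" "y = (\<Sum>j\<in>J. of_int (d j) *s acol A j)"
    by (auto simp: Zspan_def)
  then have "x - y = (\<Sum>j\<in>J. of_int (c j - d j) *s acol A j)"
    by (simp add: vec_eq_iff left_diff_distrib flip: sum_subtractf)
  then show ?thesis unfolding Zspan_def by (intro CollectI exI conjI TrueI)
qed

lemma Zspan_add: "x \<in> Zspan A J \<Longrightarrow> y \<in> Zspan A J \<Longrightarrow> x + y \<in> (Zspan A J :: ('a::ring_1 ^ 'd) set)"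
proof -
  assume x: "x \<in> Zspan A J" and y: "y \<in> Zspan A J"
  from Zspan_diff[OF x Zspan_diff[OF Zspan_0 y]] show ?thesis by simp
qed

lemma asum_vertices_Zspan:
  assumes "set_mset n \<subseteq> W"
  shows "asum (image_mset vtx n) \<in> (Zspan A (cols_in A (face W)) :: ('a::ring_1 ^ 'd) set)"
  using assms
proof (induction n)
  case empty
  show ?case by (simp add: Zspan_0)
next
  case (add v n)
  have "vtx v \<in> cols_in A (face W)" using add.prems by (auto simp: cols_in_face kappa_vtx)
  moreover have "(\<Sum>j\<in>cols_in A (face W). of_int (if j = vtx v then 1 else 0) *s acol A j) =
      (\<Sum>j\<in>cols_in A (face W). if j = vtx v then (acol A (vtx v) :: 'a ^ 'd) else 0)"
    by (intro sum.cong) auto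
  ultimately have "(\<Sum>j\<in>cols_in A (face W). of_int (if j = vtx v then 1 else 0) *s acol A j) = (acol A (vtx v) :: 'a ^ 'd)"
    by simp
  note this[symmetric]
  then have "(acol A (vtx v) :: 'a ^ 'd) \<in> Zspan A (cols_in A (face W))"
    unfolding Zspan_def by (intro CollectI exI conjI TrueI)
  then show ?case using add by (auto intro: Zspan_add)
qed

text \<open>Membership in \<open>E\<^sub>\<tau>(\<beta>)\<close>, without quotients and the cancellation of representatives.\<close>

lemma E_face_iff:
  fixes \<beta> v :: "'k::field_char_0 ^ 'd"
  assumes v: "\<And>w. w \<notin> W \<Longrightarrow> vc v $ w = 0"
  shows "Zclass A (face W) v \<in> E_face A (face W) \<beta> \<longleftrightarrow> \<beta> - v \<in> vdiff W"
proof
  assume "Zclass A (face W) v \<in> E_face A (face W) \<beta>"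
  then obtain v' a z where v': "Zclass A (face W) v = Zclass A (face W) v'" and a: "a \<in> NA A"
    and z: "z \<in> Zspan A (cols_in A (face W))" and eq: "\<beta> - v' = a + z"
    unfolding E_face_def by blast
  have "v + 0 \<in> Zclass A (face W) v" unfolding Zclass_def using Zspan_0 by blast
  then obtain z' where z': "v = v' + z'" "z' \<in> Zspan A (cols_in A (face W))"
    unfolding v' unfolding Zclass_def by auto
  have "\<beta> - v = a + (z - z')" using eq z' by (simp add: algebra_simps)
  moreover have "a \<in> vdiff W" using a vdiff_acol by (auto simp: NA_asum)
  moreover have "z - z' \<in> vdiff W" using Zspan_vdiff Zspan_diff[OF z z'(2)] by blast
  ultimately show "\<beta> - v \<in> vdiff W" by (simp add: vdiff_add)
next
  assume "\<beta> - v \<in> vdiff W"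
  then obtain \<alpha> n where n: "\<beta> - v = asum \<alpha> - asum (image_mset vtx n)" "set_mset n \<subseteq> W"
    by (auto simp: vdiff_def)
  have "- asum (image_mset vtx n) \<in> (Zspan A (cols_in A (face W)) :: ('k ^ 'd) set)"
    using Zspan_diff[OF Zspan_0 asum_vertices_Zspan[OF n(2)]] by simp
  moreover have "(asum \<alpha> :: 'k ^ 'd) \<in> NA A" by (simp add: NA_asum)
  moreover have "\<beta> - v = asum \<alpha> + - asum (image_mset vtx n)" using n(1) by simp
  ultimately have "\<exists>a\<in>NA A. \<exists>z\<in>Zspan A (cols_in A (face W)). \<beta> - v = a + z" by blast
  moreover have "v \<in> kspan A (cols_in A (face W))" using v by (simp add: kspan_face)
  ultimately show "Zclass A (face W) v \<in> E_face A (face W) \<beta>" unfolding E_face_def by blast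
qed

text \<open>A vector belongs to \<open>vdiff W\<close> as soon as its coordinates differ from those of an element of
  \<open>\<nat>A\<close> by integers that are nonnegative outside \<open>W\<close>.\<close>

lemma vdiffI:
  fixes x :: "'k::field_char_0 ^ 'd"
  assumes z: "\<And>w. vc x $ w = of_rat (kc \<alpha> w) + of_int (z w)" and nn: "\<And>w. w \<notin> W \<Longrightarrow> z w \<ge> 0"
  shows "x \<in> vdiff W"
proof -
  obtain p where p: "\<And>w. count p w = nat (z w)" using exists_count[of "\<lambda>w. nat (z w)"] by blast
  obtain n where n: "\<And>w. count n w = nat (- z w)" using exists_count[of "\<lambda>w. nat (- z w)"] by blast
  have "vc x = vc (asum (\<alpha> + image_mset vtx p) - asum (image_mset vtx n))"
  proof (rule vec_eq_iff[THEN iffD2], rule allI)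
    fix w
    have "(of_int (z w) :: 'k) = of_nat (nat (z w)) - of_nat (nat (- z w))"
      by (cases "z w \<ge> 0") simp_all
    then show "vc x $ w = vc (asum (\<alpha> + image_mset vtx p) - asum (image_mset vtx n)) $ w"
      by (simp add: vc_diff vc_add vc_asum z kc_vtx p n)
  qed
  then have "x = asum (\<alpha> + image_mset vtx p) - asum (image_mset vtx n)" by (simp only: vc_inj)
  moreover have "set_mset n \<subseteq> W"
  proof
    fix w assume "w \<in># n"
    then have "nat (- z w) \<noteq> 0" using n[of w] by (metis count_eq_zero_iff)
    then show "w \<in> W" using nn[of w] by force
  qed
  ultimately show ?thesis unfolding vdiff_def by blast
qed

lemma vdiffE:
  fixes x :: "'k::field_char_0 ^ 'd"
  assumes "x \<in> vdiff W"
  obtains \<alpha> n where "\<And>w. vc x $ w = of_rat (kc \<alpha> w) - of_nat (n w)" "\<And>w. w \<notin> W \<Longrightarrow> n w = 0"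
proof -
  from assms obtain \<alpha> n where n: "x = asum \<alpha> - asum (image_mset vtx n)" "set_mset n \<subseteq> W"
    by (auto simp: vdiff_def)
  show ?thesis
  proof (rule that)
    show "vc x $ w = of_rat (kc \<alpha> w) - of_nat (count n w)" for w
      by (simp add: n(1) vc_diff vc_asum kc_vtx)
    show "count n w = 0" if "w \<notin> W" for w
      using n(2) that by (auto simp: count_eq_zero_iff)
  qed
qed

context
  fixes \<beta> :: "'k::field_char_0 ^ 'd"
begin

text \<open>If \<open>\<lambda>\<close> belongs to all \<open>E\<^sub>\<tau>\<^sub>i(\<beta>)\<close>, this is witnessed by elements \<open>\<alpha> i\<close> of one and the same class, with
  \<open>breaks \<beta> (\<alpha> i)\<close> containing the complement of \<open>\<tau>\<^sub>i\<close>.  The element with the largest set witnesses the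
  membership for the intersection.\<close>

lemma directed_imp_condition_i:
  assumes "directed \<beta>"
  shows "condition_i A \<beta>"
  unfolding condition_i_def
proof (intro allI impI)
  fix l :: nat and \<tau> :: "nat \<Rightarrow> (real ^ 'd) set" and v :: "'k ^ 'd"
  assume l: "l \<ge> 1" and faces: "\<forall>i\<in>{1..l}. \<tau> i face_of conv_A A"
    and v: "v \<in> kspan A (cols_in A (\<Inter>i\<in>{1..l}. \<tau> i))"
    and E: "\<forall>i\<in>{1..l}. Zclass A (\<tau> i) v \<in> E_face A (\<tau> i) \<beta>"
  obtain Ws where Ws: "\<And>i. i \<in> {1..l} \<Longrightarrow> \<tau> i = face (Ws i)" using faces unfolding face_of_iff by metis
  define W where "W = (\<Inter>i\<in>{1..l}. Ws i)"
  have "(\<Inter>i\<in>{1..l}. \<tau> i) = (\<Inter>i\<in>{1..l}. face (Ws i))" using Ws by (intro INF_cong) auto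
  also have "\<dots> = face W" unfolding W_def using l by (intro face_INT) simp
  finally have W: "(\<Inter>i\<in>{1..l}. \<tau> i) = face W" .
  have v0: "vc v $ w = 0" if "w \<notin> W" for w using v that unfolding W kspan_face by blast
  have "\<exists>\<alpha> n. (\<forall>w. vc (\<beta> - v) $ w = of_rat (kc \<alpha> w) - of_nat (n w)) \<and> (\<forall>w. w \<notin> Ws i \<longrightarrow> n w = 0)"
    if i: "i \<in> {1..l}" for i
  proof -
    have "\<beta> - v \<in> vdiff (Ws i)"
    proof (rule E_face_iff[THEN iffD1])
      show "vc v $ w = 0" if "w \<notin> Ws i" for w
        using v0[of w] that i unfolding W_def by blast
      show "Zclass A (face (Ws i)) v \<in> E_face A (face (Ws i)) \<beta>"
        using E i Ws[OF i] by metis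
    qed
    then show ?thesis by (rule vdiffE) blast
  qed
  then obtain \<alpha> n where \<alpha>: "\<And>i w. i \<in> {1..l} \<Longrightarrow> vc (\<beta> - v) $ w = of_rat (kc (\<alpha> i) w) - of_nat (n i w)"
    and n: "\<And>i w. i \<in> {1..l} \<Longrightarrow> w \<notin> Ws i \<Longrightarrow> n i w = 0" by metis
  have diff: "kc (\<alpha> i) w - kc (\<alpha> 1) w = of_nat (n i w) - of_nat (n 1 w)" if "i \<in> {1..l}" for i w
  proof -
    have "(of_rat (kc (\<alpha> i) w - of_nat (n i w)) :: 'k) = of_rat (kc (\<alpha> 1) w - of_nat (n 1 w))"
      using \<alpha>[OF that, of w] \<alpha>[of 1 w] l by (simp add: of_rat_diff)
    then have "kc (\<alpha> i) w - of_nat (n i w) = kc (\<alpha> 1) w - of_nat (n 1 w)" by (simp only: of_rat_eq_iff)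
    then show ?thesis by (simp add: algebra_simps)
  qed
  obtain \<rho> where \<rho>: "eqv \<rho> (\<alpha> 1)" "\<And>\<alpha>'. eqv \<alpha>' (\<alpha> 1) \<Longrightarrow> breaks \<beta> \<alpha>' \<subseteq> breaks \<beta> \<rho>"
    using assms unfolding directed_def by blast
  have mem: "w \<in> breaks \<beta> \<rho>" if w: "w \<notin> W" for w
  proof -
    from w obtain i where i: "i \<in> {1..l}" "w \<notin> Ws i" by (auto simp: W_def)
    have "eqv (\<alpha> i) (\<alpha> 1)" using diff[OF i(1)] by (simp add: eqv_def)
    moreover have "w \<in> breaks \<beta> (\<alpha> i)"
      using \<alpha>[OF i(1), of w] n[OF i] v0[OF w] by (auto simp: breaks_def bc_def vc_diff intro!: exI[of _ 0])
    ultimately show ?thesis using \<rho>(2) by blast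
  qed
  have "\<exists>z. vc (\<beta> - v) $ w = of_rat (kc \<rho> w) + of_int z \<and> (w \<notin> W \<longrightarrow> z \<ge> 0)" for w
  proof (cases "w \<in> W")
    case False
    then obtain m where "bc \<beta> w = of_rat (kc \<rho> w) + of_nat m" using mem by (auto simp: breaks_def)
    then show ?thesis using v0[OF False] by (intro exI[of _ "int m"]) (simp add: vc_diff bc_def)
  next
    case True
    have "kc \<rho> w - kc (\<alpha> 1) w \<in> Ints" using \<rho>(1) by (simp add: eqv_def)
    then obtain z where "kc \<rho> w - kc (\<alpha> 1) w = of_int z" by (rule Ints_cases)
    then have "kc (\<alpha> 1) w = kc \<rho> w - of_int z" by simp
    then show ?thesis using True \<alpha>[of 1 w] l
      by (intro exI[of _ "- z - int (n 1 w)"]) (simp add: of_rat_diff)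
  qed
  then obtain z where "\<And>w. vc (\<beta> - v) $ w = of_rat (kc \<rho> w) + of_int (z w)" "\<And>w. w \<notin> W \<Longrightarrow> z w \<ge> 0" by metis
  then have "\<beta> - v \<in> vdiff W" by (rule vdiffI)
  then show "Zclass A (\<Inter>i\<in>{1..l}. \<tau> i) v \<in> E_face A (\<Inter>i\<in>{1..l}. \<tau> i) \<beta>"
    unfolding W using v0 by (simp add: E_face_iff)
qed

lemma condition_i_imp_ii: "condition_i A \<beta> \<Longrightarrow> condition_ii A \<beta>"
  unfolding condition_ii_def
proof (intro allI impI)
  fix \<tau>\<^sub>1 \<tau>\<^sub>2 and v :: "'k ^ 'd"
  assume i: "condition_i A \<beta>"
    and \<tau>: "\<tau>\<^sub>1 face_of conv_A A" "\<tau>\<^sub>2 face_of conv_A A" and v: "v \<in> kspan A (cols_in A (\<tau>\<^sub>1 \<inter> \<tau>\<^sub>2))"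
    and E: "Zclass A \<tau>\<^sub>1 v \<in> E_face A \<tau>\<^sub>1 \<beta>" "Zclass A \<tau>\<^sub>2 v \<in> E_face A \<tau>\<^sub>2 \<beta>"
  define \<tau> where "\<tau> i = (if i = 1 then \<tau>\<^sub>1 else \<tau>\<^sub>2)" for i :: nat
  have two: "{1..2::nat} = {1, 2}" by auto
  have int: "(\<Inter>i\<in>{1..2}. \<tau> i) = \<tau>\<^sub>1 \<inter> \<tau>\<^sub>2" unfolding two \<tau>_def by auto
  have "Zclass A (\<Inter>i\<in>{1..2}. \<tau> i) v \<in> E_face A (\<Inter>i\<in>{1..2}. \<tau> i) \<beta>"
    using i[unfolded condition_i_def, rule_format, of 2 \<tau> v] \<tau> v E unfolding int
    unfolding two \<tau>_def by simp
  then show "Zclass A (\<tau>\<^sub>1 \<inter> \<tau>\<^sub>2) v \<in> E_face A (\<tau>\<^sub>1 \<inter> \<tau>\<^sub>2) \<beta>" by (simp only: int)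
qed

text \<open>If \<open>\<rho>\<close> has a maximal set and \<open>\<sigma>\<close> is another element of its class, the second condition is applied to
  the faces spanned by the complements \<open>W1\<close>, \<open>W2\<close> of \<open>breaks \<beta> \<rho>\<close> and \<open>breaks \<beta> \<sigma>\<close>.  It yields an element
  of the class whose set contains the union of both, whence \<open>breaks \<beta> \<sigma> \<subseteq> breaks \<beta> \<rho>\<close>.\<close>

lemma condition_ii_imp_directed:
  assumes ii: "condition_ii A \<beta>"
  shows "directed \<beta>"
  unfolding directed_def
proof
  fix \<alpha>
  obtain \<rho> where \<rho>: "eqv \<rho> \<alpha>" "\<And>\<alpha>'. eqv \<alpha>' \<rho> \<Longrightarrow> breaks \<beta> \<rho> \<subseteq> breaks \<beta> \<alpha>' \<Longrightarrow> breaks \<beta> \<alpha>' = breaks \<beta> \<rho>"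
    using exists_maximal[of \<alpha> \<beta>] by blast
  have "breaks \<beta> \<sigma> \<subseteq> breaks \<beta> \<rho>" if \<sigma>: "eqv \<sigma> \<alpha>" for \<sigma>
  proof -
    have \<sigma>\<rho>: "eqv \<sigma> \<rho>" using \<sigma> \<rho>(1) eqv_sym eqv_trans by blast
    define W1 W2 where "W1 = - breaks \<beta> \<rho>" and "W2 = - breaks \<beta> \<sigma>"
    \<comment> \<open>The coordinates of \<open>\<beta> - v\<close>: those of \<open>\<beta>\<close> outside the common face, as \<open>v\<close> is to be supported on
      it; on the common face, those of \<open>\<rho>\<close>.\<close>
    define y :: "'k ^ 'd" where "y = (\<chi> w. if w \<in> W1 \<inter> W2 then of_rat (kc \<rho> w) else bc \<beta> w)"
    define v where "v = \<beta> - Bmat *v y"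
    have vcy: "vc (\<beta> - v) $ w = y $ w" for w by (simp add: v_def vc_Bmat)
    have v0: "vc v $ w = 0" if "w \<notin> W1 \<inter> W2" for w
      using that by (auto simp: v_def vc_diff vc_Bmat y_def bc_def)
    have "\<exists>z. kc \<sigma> w = kc \<rho> w + of_int z" for w
      using \<sigma>\<rho> unfolding eqv_def by (metis Ints_cases diff_eq_eq add.commute)
    then obtain z where z: "\<And>w. kc \<sigma> w = kc \<rho> w + of_int (z w)" by metis
    have "\<exists>m. y $ w = of_rat (kc \<rho> w) + of_int m \<and> (w \<notin> W1 \<longrightarrow> m \<ge> 0)" for w
    proof (cases "w \<in> W1")
      case False
      then obtain m where "bc \<beta> w = of_rat (kc \<rho> w) + of_nat m" by (auto simp: W1_def breaks_def)
      then show ?thesis using False by (intro exI[of _ "int m"]) (simp add: y_def)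
    next
      case True
      show ?thesis
      proof (cases "w \<in> W2")
        case True
        then show ?thesis using \<open>w \<in> W1\<close> by (intro exI[of _ 0]) (simp add: y_def)
      next
        case False
        then obtain m where "bc \<beta> w = of_rat (kc \<sigma> w) + of_nat m" by (auto simp: W2_def breaks_def)
        then show ?thesis using False \<open>w \<in> W1\<close>
          by (intro exI[of _ "z w + int m"]) (simp add: y_def z of_rat_add)
      qed
    qed
    then obtain m1 where "\<And>w. vc (\<beta> - v) $ w = of_rat (kc \<rho> w) + of_int (m1 w)" "\<And>w. w \<notin> W1 \<Longrightarrow> m1 w \<ge> 0"
      unfolding vcy by metis
    then have d1: "\<beta> - v \<in> vdiff W1" by (rule vdiffI)
    have "\<exists>m. y $ w = of_rat (kc \<sigma> w) + of_int m \<and> (w \<notin> W2 \<longrightarrow> m \<ge> 0)" for w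
    proof (cases "w \<in> W2")
      case False
      then obtain m where "bc \<beta> w = of_rat (kc \<sigma> w) + of_nat m" by (auto simp: W2_def breaks_def)
      then show ?thesis using False by (intro exI[of _ "int m"]) (simp add: y_def)
    next
      case True
      show ?thesis
      proof (cases "w \<in> W1")
        case True
        then show ?thesis using \<open>w \<in> W2\<close> by (intro exI[of _ "- z w"]) (simp add: y_def z of_rat_add)
      next
        case False
        then obtain m where "bc \<beta> w = of_rat (kc \<rho> w) + of_nat m" by (auto simp: W1_def breaks_def)
        then show ?thesis using False \<open>w \<in> W2\<close>
          by (intro exI[of _ "int m - z w"]) (simp add: y_def z of_rat_add)
      qed
    qed
    then obtain m2 where "\<And>w. vc (\<beta> - v) $ w = of_rat (kc \<sigma> w) + of_int (m2 w)" "\<And>w. w \<notin> W2 \<Longrightarrow> m2 w \<ge> 0"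
      unfolding vcy by metis
    then have d2: "\<beta> - v \<in> vdiff W2" by (rule vdiffI)
    have "Zclass A (face W1 \<inter> face W2) v \<in> E_face A (face W1 \<inter> face W2) \<beta>"
    proof (rule ii[unfolded condition_ii_def, rule_format])
      show "face W1 face_of conv_A A" "face W2 face_of conv_A A" by (auto simp: face_of_iff)
      show "v \<in> kspan A (cols_in A (face W1 \<inter> face W2))" using v0 by (simp add: face_Int kspan_face)
      show "Zclass A (face W1) v \<in> E_face A (face W1) \<beta>" using d1 v0 by (subst E_face_iff) auto
      show "Zclass A (face W2) v \<in> E_face A (face W2) \<beta>" using d2 v0 by (subst E_face_iff) auto
    qed
    then have "\<beta> - v \<in> vdiff (W1 \<inter> W2)" using v0 unfolding face_Int by (subst (asm) E_face_iff) auto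
    then obtain \<gamma> n where \<gamma>: "\<And>w. y $ w = of_rat (kc \<gamma> w) - of_nat (n w)" and n: "\<And>w. w \<notin> W1 \<inter> W2 \<Longrightarrow> n w = 0"
      unfolding vcy[symmetric] by (rule vdiffE) blast
    have sub: "w \<in> breaks \<beta> \<gamma>" if "w \<notin> W1 \<inter> W2" for w
    proof -
      have "bc \<beta> w = of_rat (kc \<gamma> w) + of_nat 0" using \<gamma>[of w] n[OF that] that by (auto simp: y_def)
      then show ?thesis unfolding breaks_def by blast
    qed
    have "kc \<gamma> w - kc \<rho> w \<in> Ints" for w
    proof -
      obtain m where "y $ w = of_rat (kc \<rho> w) + of_int m"
        using \<open>\<And>w. \<exists>m. y $ w = of_rat (kc \<rho> w) + of_int m \<and> (w \<notin> W1 \<longrightarrow> m \<ge> 0)\<close> by blast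
      then have "(of_rat (kc \<gamma> w - kc \<rho> w) :: 'k) = of_rat (of_int (m + int (n w)))"
        using \<gamma>[of w] by (simp add: of_rat_diff of_rat_add algebra_simps)
      then have "kc \<gamma> w - kc \<rho> w = of_int (m + int (n w))" by (simp only: of_rat_eq_iff)
      then show ?thesis by (metis Ints_of_int)
    qed
    then have "eqv \<gamma> \<rho>" by (simp add: eqv_def)
    then have "breaks \<beta> \<gamma> = breaks \<beta> \<rho>" using sub by (intro \<rho>(2)) (auto simp: W1_def)
    then show ?thesis using sub by (auto simp: W2_def)
  qed
  then show "\<exists>\<rho>. eqv \<rho> \<alpha> \<and> (\<forall>\<alpha>'. eqv \<alpha>' \<alpha> \<longrightarrow> breaks \<beta> \<alpha>' \<subseteq> breaks \<beta> \<rho>)" using \<rho>(1) by blast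
qed

lemma conditions_iff: "condition_i A \<beta> \<longleftrightarrow> directed \<beta>" "condition_i A \<beta> \<longleftrightarrow> condition_ii A \<beta>"
  using directed_imp_condition_i condition_i_imp_ii condition_ii_imp_directed by blast+

end

end

section \<open>Lattice indices and volumes\<close>

subsection \<open>Linear images and fundamental domains\<close>

text \<open>A copy of a finite type that carries a well-order; it serves to transfer the transformation
  rule for linear maps to an arbitrary finite index type.\<close>

typedef 'd ordered_copy = "UNIV :: 'd set" by simp

instance ordered_copy :: (finite) finite
proof
  have "range Abs_ordered_copy = (UNIV :: 'a ordered_copy set)"
    by (metis Rep_ordered_copy_inverse surjI)
  then show "finite (UNIV :: 'a ordered_copy set)" by (metis finite finite_imageI)
qed

text \<open>An arbitrary injection into the natural numbers; it defines the order.\<close>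

definition copy_rank :: "'d::finite ordered_copy \<Rightarrow> nat" where
  "copy_rank x = (SOME f :: 'd \<Rightarrow> nat. inj f) (Rep_ordered_copy x)"

lemma inj_copy_rank: "inj copy_rank"
proof -
  have "\<exists>f :: 'a \<Rightarrow> nat. inj f"
    using finite_imp_inj_to_nat_seg[of "UNIV :: 'a set"] by auto
  then have i: "inj (SOME f :: 'a \<Rightarrow> nat. inj f)" by (rule someI_ex)
  show ?thesis
  proof (rule injI)
    fix x y :: "'a ordered_copy" assume "copy_rank x = copy_rank y"
    then have "Rep_ordered_copy x = Rep_ordered_copy y" unfolding copy_rank_def by (rule injD[OF i])
    then show "x = y" by (simp only: Rep_ordered_copy_inject)
  qed
qed

instantiation ordered_copy :: (finite) wellorder
begin

definition less_eq_ordered_copy :: "'a ordered_copy \<Rightarrow> 'a ordered_copy \<Rightarrow> bool" where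
  "x \<le> y \<longleftrightarrow> copy_rank x \<le> copy_rank y"

definition less_ordered_copy :: "'a ordered_copy \<Rightarrow> 'a ordered_copy \<Rightarrow> bool" where
  "x < y \<longleftrightarrow> copy_rank x < copy_rank y"

instance
proof
  fix x y z :: "'a ordered_copy" and P
  show "x \<le> y \<Longrightarrow> y \<le> x \<Longrightarrow> x = y"
    using inj_copy_rank by (auto simp: less_eq_ordered_copy_def dest: injD)
  show "P x" if "\<And>x. (\<And>y. y < x \<Longrightarrow> P y) \<Longrightarrow> P x"
    using that unfolding less_ordered_copy_def by (rule measure_induct_rule[of copy_rank])
qed (auto simp: less_eq_ordered_copy_def less_ordered_copy_def)

end

text \<open>The two mutually inverse identifications of the coordinate spaces.\<close>

definition reindex :: "real ^ 'd::finite ordered_copy \<Rightarrow> real ^ 'd" where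
  "reindex x = (\<chi> i. x $ Abs_ordered_copy i)"

definition unreindex :: "real ^ 'd::finite \<Rightarrow> real ^ 'd ordered_copy" where
  "unreindex x = (\<chi> i. x $ Rep_ordered_copy i)"

lemma reindex_inverse [simp]: "reindex (unreindex x) = x" "unreindex (reindex y) = y"
  by (simp_all add: reindex_def unreindex_def vec_eq_iff Abs_ordered_copy_inverse Rep_ordered_copy_inverse)

lemma linear_reindex: "linear reindex" "linear unreindex"
  by (auto intro!: linearI simp: reindex_def unreindex_def vec_eq_iff)

lemma prod_Basis_vec: "(\<Prod>b\<in>(Basis :: (real ^ 'm::finite) set). f b) = (\<Prod>i\<in>UNIV. f (axis i 1))"
proof -
  have B: "(Basis :: (real ^ 'm) set) = range (\<lambda>i. axis i 1)" by (auto simp: Basis_vec_def)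
  have "inj (\<lambda>i :: 'm. axis i (1 :: real))" by (auto simp: inj_def axis_eq_axis)
  then show ?thesis unfolding B by (subst prod.reindex) (simp_all add: comp_def)
qed

lemma bij_Abs_ordered_copy: "bij (Abs_ordered_copy :: 'd \<Rightarrow> _)"
  by (rule bijI[OF injI surjI[of _ Rep_ordered_copy]])
     (auto simp: Abs_ordered_copy_inject Rep_ordered_copy_inverse)

lemma measurable_reindex: "reindex \<in> borel_measurable (lborel :: (real ^ 'd::finite ordered_copy) measure)"
proof -
  have "continuous_on UNIV (reindex :: real ^ 'd ordered_copy \<Rightarrow> _)"
    by (rule linear_continuous_on) (use linear_reindex(1) in \<open>simp add: linear_conv_bounded_linear\<close>)
  then show ?thesis by (simp add: borel_measurable_continuous_onI)
qed

lemma lborel_reindex: "distr lborel borel (reindex :: _ \<Rightarrow> real ^ 'd::finite) = lborel"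
proof (rule lborel_eqI[symmetric])
  fix l u :: "real ^ 'd" assume lu: "\<And>b. b \<in> Basis \<Longrightarrow> l \<bullet> b \<le> u \<bullet> b"
  have le: "l $ i \<le> u $ i" for i
    using lu[of "axis i 1"] by (simp add: inner_axis axis_in_Basis_iff)
  have meas: "reindex \<in> borel_measurable (lborel :: (real ^ 'd ordered_copy) measure)"
    by (rule measurable_reindex)
  have "reindex -` box l u = box (unreindex l) (unreindex u)"
    by (auto simp: mem_box_cart reindex_def unreindex_def)
       (metis Abs_ordered_copy_inverse UNIV_I Rep_ordered_copy_inverse)+
  then have "emeasure (distr lborel borel reindex) (box l u) = emeasure lborel (box (unreindex l) (unreindex u))"
    using meas by (subst emeasure_distr) auto
  also have "\<dots> = (\<Prod>b\<in>Basis. (unreindex u - unreindex l) \<bullet> b)"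
  proof (rule emeasure_lborel_box)
    fix b :: "real ^ 'd ordered_copy" assume "b \<in> Basis"
    then obtain i where "b = axis i 1" by (auto simp: Basis_vec_def)
    then show "unreindex l \<bullet> b \<le> unreindex u \<bullet> b" using le by (simp add: inner_axis unreindex_def)
  qed
  also have "(\<Prod>b\<in>Basis. (unreindex u - unreindex l) \<bullet> b) = (\<Prod>b\<in>Basis. (u - l) \<bullet> b)"
    unfolding prod_Basis_vec
    by (subst prod.reindex_bij_betw[OF bij_Abs_ordered_copy, symmetric])
       (simp add: inner_axis unreindex_def Abs_ordered_copy_inverse)
  finally show "emeasure (distr lborel borel reindex) (box l u) = ennreal (\<Prod>b\<in>Basis. (u - l) \<bullet> b)" .
qed simp

text \<open>A linear map scales volumes by a constant, here for coordinate spaces over an arbitrary finite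
  index type; the constant is an absolute determinant, but this value plays no role below.\<close>

lemma linear_image_scale:
  fixes T :: "real ^ 'd::finite \<Rightarrow> real ^ 'd"
  assumes T: "linear T"
  obtains c where "\<And>S. bounded S \<Longrightarrow> S \<in> sets borel \<Longrightarrow> T ` S \<in> sets borel \<Longrightarrow>
    measure lborel (T ` S) = c * measure lborel S"
proof
  fix S assume S: "bounded S" "S \<in> sets borel" "T ` S \<in> sets borel"
  have meas: "reindex \<in> borel_measurable (lborel :: (real ^ 'd ordered_copy) measure)"
    by (rule measurable_reindex)
  have vim: "reindex -` X = unreindex ` X" for X :: "(real ^ 'd) set"
    by (auto simp: image_iff intro: exI) (metis reindex_inverse)
  have pre: "measure lborel X = measure lborel (unreindex ` X)" "unreindex ` X \<in> sets borel"
    if "X \<in> sets borel" for X :: "(real ^ 'd) set"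
  proof -
    have "measure (distr lborel borel reindex) X = measure lborel (reindex -` X \<inter> space lborel)"
      by (rule measure_distr) (use that meas in auto)
    then show "measure lborel X = measure lborel (unreindex ` X)" by (simp add: lborel_reindex vim)
    show "unreindex ` X \<in> sets borel"
      using measurable_sets[OF meas that] by (simp add: vim)
  qed
  define T' where "T' = unreindex \<circ> T \<circ> reindex"
  have T': "linear T'" unfolding T'_def by (intro linear_compose T linear_reindex)
  have "unreindex ` (T ` S) = T' ` (unreindex ` S)" by (simp add: T'_def image_image)
  moreover have "bounded (unreindex ` S)"
    using S(1) linear_reindex(2) by (intro bounded_linear_image) (auto simp: linear_conv_bounded_linear)
  moreover have "unreindex ` S \<in> sets lebesgue" using pre(2)[OF S(2)] by simp
  ultimately have "measure lebesgue (unreindex ` (T ` S)) = \<bar>det (matrix T')\<bar> * measure lebesgue (unreindex ` S)"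
    using measure_lebesgue_linear_transformation[OF _ _ T'] by metis
  moreover have "measure lebesgue X = measure lborel X" if "X \<in> sets borel" for X :: "(real ^ 'd ordered_copy) set"
    using that by (simp add: measure_completion)
  ultimately show "measure lborel (T ` S) = \<bar>det (matrix (unreindex \<circ> T \<circ> reindex))\<bar> * measure lborel S"
    using pre[OF S(2)] pre[OF S(3)] by (simp add: T'_def)
qed

text \<open>Two fundamental domains of the same lattice have the same volume.\<close>

lemma fundamental_domains:
  fixes F1 F2 L :: "(real ^ 'd::finite) set"
  assumes [measurable]: "F1 \<in> sets borel" "F2 \<in> sets borel" and L: "countable L" "\<And>l. l \<in> L \<Longrightarrow> - l \<in> L"
    and F1: "\<And>x. \<exists>!l. l \<in> L \<and> x - l \<in> F1" and F2: "\<And>x. \<exists>!l. l \<in> L \<and> x - l \<in> F2"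
  shows "emeasure lborel F1 = emeasure lborel F2"
proof -
  \<comment> \<open>Both sets are cut into countably many pieces that are translates of each other by elements of \<open>L\<close>.\<close>
  define X where "X l = F1 \<inter> (\<lambda>x. x - l) -` F2" for l
  define Y where "Y l = F2 \<inter> (\<lambda>y. y + l) -` F1" for l
  have XY: "X l \<in> sets borel" "Y l \<in> sets borel" for l
  proof -
    have "(\<lambda>x. x - l) -` F2 \<inter> space borel \<in> sets borel" "(\<lambda>x. x + l) -` F1 \<inter> space borel \<in> sets borel"
      using measurable_sets[of "\<lambda>x. x - l" borel borel F2] measurable_sets[of "\<lambda>x. x + l" borel borel F1]
      by simp_all
    then show "X l \<in> sets borel" "Y l \<in> sets borel" by (simp_all add: X_def Y_def)
  qed
  have "F1 = (\<Union>l\<in>L. X l)"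
  proof
    show "F1 \<subseteq> (\<Union>l\<in>L. X l)"
    proof
      fix x assume x: "x \<in> F1"
      obtain l where "l \<in> L" "x - l \<in> F2" using F2 by blast
      then show "x \<in> (\<Union>l\<in>L. X l)" using x by (auto simp: X_def)
    qed
  qed (auto simp: X_def)
  moreover have "disjoint_family_on X L"
  proof (unfold disjoint_family_on_def, intro ballI impI)
    fix l l' assume l: "l \<in> L" "l' \<in> L" "l \<noteq> l'"
    show "X l \<inter> X l' = {}"
    proof (rule ccontr)
      assume "X l \<inter> X l' \<noteq> {}"
      then obtain x where "x - l \<in> F2" "x - l' \<in> F2" by (auto simp: X_def)
      then show False using F2[of x] l by blast
    qed
  qed
  moreover have "emeasure lborel (\<Union>l\<in>L. X l) = (\<integral>\<^sup>+l. emeasure lborel (X l) \<partial>count_space L)"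
    if "disjoint_family_on X L"
    by (rule emeasure_UN_countable) (simp_all add: XY L(1) that)
  ultimately have 1: "emeasure lborel F1 = (\<integral>\<^sup>+l. emeasure lborel (X l) \<partial>count_space L)"
    by simp
  have "F2 = (\<Union>l\<in>L. Y l)"
  proof
    show "F2 \<subseteq> (\<Union>l\<in>L. Y l)"
    proof
      fix y assume y: "y \<in> F2"
      obtain l where "l \<in> L" "y - l \<in> F1" using F1 by blast
      then show "y \<in> (\<Union>l\<in>L. Y l)" using y L(2) by (intro UN_I[of "- l"]) (auto simp: Y_def)
    qed
  qed (auto simp: Y_def)
  moreover have "disjoint_family_on Y L"
  proof (unfold disjoint_family_on_def, intro ballI impI)
    fix l l' assume l: "l \<in> L" "l' \<in> L" "l \<noteq> l'"
    show "Y l \<inter> Y l' = {}"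
    proof (rule ccontr)
      assume "Y l \<inter> Y l' \<noteq> {}"
      then obtain y where "y + l \<in> F1" "y + l' \<in> F1" by (auto simp: Y_def)
      then have "y - (- l) \<in> F1" "y - (- l') \<in> F1" by simp_all
      then have "- l = - l'" using F1[of y] L(2) l by blast
      then show False using l by simp
    qed
  qed
  moreover have "emeasure lborel (\<Union>l\<in>L. Y l) = (\<integral>\<^sup>+l. emeasure lborel (Y l) \<partial>count_space L)"
    if "disjoint_family_on Y L"
    by (rule emeasure_UN_countable) (simp_all add: XY L(1) that)
  ultimately have 2: "emeasure lborel F2 = (\<integral>\<^sup>+l. emeasure lborel (Y l) \<partial>count_space L)"
    by simp
  have "emeasure lborel (X l) = emeasure lborel (Y l)" for l
  proof -
    have "emeasure lborel (Y l) = emeasure (distr lborel borel ((+) (- l))) (Y l)" by (simp add: lborel_distr_plus)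
    also have "\<dots> = emeasure lborel ((+) (- l) -` Y l \<inter> space lborel)" by (rule emeasure_distr) (simp_all add: XY)
    also have "(+) (- l) -` Y l \<inter> space lborel = X l" by (auto simp: X_def Y_def)
    finally show ?thesis by simp
  qed
  then show ?thesis using 1 2 by simp
qed

lemma unit_cube:
  defines "Q \<equiv> {t :: real ^ 'd::finite. \<forall>i. 0 \<le> t $ i \<and> t $ i < 1}"
  shows "Q \<in> sets borel" "bounded Q" "emeasure lborel Q = 1" "measure lborel Q = 1"
proof -
  have "Q = (\<Inter>i. {t. 0 \<le> t $ i} \<inter> {t. t $ i < 1})" by (auto simp: Q_def)
  moreover have "(\<Inter>i. {t :: real ^ 'd. 0 \<le> t $ i} \<inter> {t. t $ i < 1}) \<in> sets borel" by measurable
  ultimately show Q: "Q \<in> sets borel" by simp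
  have sub: "box 0 (\<chi> i. 1) \<subseteq> Q" "Q \<subseteq> cbox 0 (\<chi> i. 1)"
    by (auto simp: Q_def mem_box_cart less_imp_le)
  show "bounded Q" by (rule bounded_subset[OF bounded_cbox sub(2)])
  have ba: "b \<in> Basis \<Longrightarrow> \<exists>i. b = axis i 1" for b :: "real ^ 'd" by (auto simp: Basis_vec_def)
  have one: "(\<Prod>b\<in>Basis. ((\<chi> i. 1) - (0 :: real ^ 'd)) \<bullet> b) = 1"
    by (simp add: prod_Basis_vec inner_axis)
  have le: "(0 :: real ^ 'd) \<bullet> b \<le> (\<chi> i. 1) \<bullet> b" if "b \<in> Basis" for b :: "real ^ 'd"
    using ba[OF that] by (auto simp: inner_axis)
  have "emeasure lborel (box 0 (\<chi> i. (1 :: real)) :: (real ^ 'd) set) = 1"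
    using emeasure_lborel_box[OF le] one by simp
  moreover have "emeasure lborel (cbox 0 (\<chi> i. (1 :: real)) :: (real ^ 'd) set) = 1"
    using emeasure_lborel_cbox[OF le] one by simp
  ultimately show e: "emeasure lborel Q = 1"
    using emeasure_mono[OF sub(1), of lborel] emeasure_mono[OF sub(2), of lborel] Q
    by (intro antisym) auto
  then show "measure lborel Q = 1" by (simp add: measure_def)
qed

subsection \<open>The normalized volume counts classes\<close>

context simplicial
begin

text \<open>The coordinates of an integral vector with respect to the vertices.\<close>

definition cz :: "int ^ 'd \<Rightarrow> 'd \<Rightarrow> rat" where
  "cz z v = vc (\<chi> i. of_int (z $ i)) $ v"

lemma cz_add: "cz (z + y) v = cz z v + cz y v"
proof -
  have "(\<chi> i. of_int ((z + y) $ i)) = ((\<chi> i. of_int (z $ i)) + (\<chi> i. of_int (y $ i)) :: rat ^ 'd)"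
    by (simp add: vec_eq_iff)
  then show ?thesis by (simp add: cz_def vc_add)
qed

lemma cz_diff: "cz (z - y) v = cz z v - cz y v"
  using cz_add[of "z - y" y v] by simp

lemma cz_asum: "cz (asum \<alpha>) v = kc \<alpha> v"
  by (simp add: cz_def of_int_asum vc_asum)

lemma cz_inj: "(\<And>v. cz z v = cz y v) \<Longrightarrow> z = y"
proof -
  assume "\<And>v. cz z v = cz y v"
  then have "vc (\<chi> i. rat_of_int (z $ i)) = vc (\<chi> i. of_int (y $ i))" by (simp add: cz_def vec_eq_iff)
  then have "(\<chi> i. rat_of_int (z $ i)) = (\<chi> i. of_int (y $ i))" by (simp only: vc_inj)
  then show "z = y" by (simp add: vec_eq_iff)
qed

text \<open>The lattice element with prescribed integral coordinates.\<close>

definition lat :: "('d \<Rightarrow> int) \<Rightarrow> int ^ 'd" where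
  "lat m = (\<chi> i. \<Sum>v\<in>UNIV. m v * A $ i $ vtx v)"

lemma cz_lat: "cz (lat m) v = of_int (m v)"
proof -
  have "(\<chi> i. rat_of_int (lat m $ i)) = Bmat *v (\<chi> v. of_int (m v))"
    by (simp add: lat_def Bmat_def matrix_vector_mult_def vec_eq_iff mult.commute)
  then show ?thesis by (simp add: cz_def vc_Bmat)
qed

lemma integral_Zspan:
  assumes "\<And>v. cz y v \<in> Ints"
  shows "y \<in> Zspan A UNIV"
proof -
  from assms have "\<forall>v. \<exists>m. cz y v = of_int m" by (metis Ints_cases)
  then obtain m where m: "\<And>v. cz y v = of_int (m v)" by metis
  obtain p where p: "\<And>v. count p v = nat (m v)" using exists_count[of "\<lambda>v. nat (m v)"] by blast
  obtain n where n: "\<And>v. count n v = nat (- m v)" using exists_count[of "\<lambda>v. nat (- m v)"] by blast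
  have "y = asum (image_mset vtx p) - asum (image_mset vtx n)"
  proof (rule cz_inj)
    fix v
    have "rat_of_int (m v) = of_nat (nat (m v)) - of_nat (nat (- m v))" by (cases "m v \<ge> 0") simp_all
    then show "cz y v = cz (asum (image_mset vtx p) - asum (image_mset vtx n)) v"
      by (simp add: cz_diff cz_asum kc_vtx m p n)
  qed
  moreover have "cols_in A (face UNIV) = UNIV" by (auto simp: cols_in_face)
  ultimately show ?thesis
    using Zspan_diff[OF asum_vertices_Zspan[of p UNIV] asum_vertices_Zspan[of n UNIV]] by simp
qed

text \<open>Every element of \<open>\<int>A\<close> is congruent to one of \<open>\<nat>A\<close> modulo the lattice of the vertices.\<close>

lemma Zspan_class:
  assumes "y \<in> Zspan A UNIV"
  obtains \<alpha> n where "\<And>v. cz y v = kc \<alpha> v - of_nat (n v)"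
proof -
  from assms obtain c where y: "y = (\<Sum>j\<in>UNIV. of_int (c j) *s acol A j)" by (auto simp: Zspan_def)
  have "(\<chi> i. of_int (y $ i)) = (\<Sum>j\<in>UNIV. of_int (c j) *s acol A j :: rat ^ 'd)"
    by (simp add: y vec_eq_iff acol_def)
  moreover have "cols_in A (face UNIV) = UNIV" by (auto simp: cols_in_face)
  ultimately have "(\<chi> i. of_int (y $ i)) \<in> (Zspan A (cols_in A (face UNIV)) :: (rat ^ 'd) set)"
    unfolding Zspan_def by auto
  then have "(\<chi> i. of_int (y $ i)) \<in> (vdiff UNIV :: (rat ^ 'd) set)" using Zspan_vdiff by blast
  then show ?thesis
  proof (rule vdiffE)
    fix \<alpha> n assume "\<And>w. vc (\<chi> i. rat_of_int (y $ i)) $ w = of_rat (kc \<alpha> w) - of_nat (n w)"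
    then show ?thesis by (intro that[of \<alpha> n]) (simp add: cz_def)
  qed
qed

lemma asum_Zspan: "asum \<alpha> \<in> (Zspan A UNIV :: (int ^ 'd) set)"
proof (induction \<alpha>)
  case (add j \<alpha>)
  have "(\<Sum>i\<in>UNIV. of_int (if i = j then 1 else 0) *s acol A i) = (\<Sum>i\<in>UNIV. if i = j then (acol A j :: int ^ 'd) else 0)"
    by (intro sum.cong) auto
  then have "(acol A j :: int ^ 'd) = (\<Sum>i\<in>UNIV. of_int (if i = j then 1 else 0) *s acol A i)" by simp
  then have "(acol A j :: int ^ 'd) \<in> Zspan A UNIV" unfolding Zspan_def by (intro CollectI exI conjI TrueI)
  then show ?case using add by (auto intro: Zspan_add)
qed (simp add: Zspan_0)

text \<open>Reduction modulo the lattice of the vertices to the half-open parallelepiped.\<close>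

definition red :: "int ^ 'd \<Rightarrow> int ^ 'd" where
  "red z = z - lat (\<lambda>v. \<lfloor>cz z v\<rfloor>)"

lemma cz_red: "cz (red z) v = frac (cz z v)"
  by (simp add: red_def cz_diff cz_lat frac_def)

lemma frac_eq_iff_diff_Ints: "frac x = frac y \<longleftrightarrow> x - y \<in> Ints" for x y :: rat
proof
  assume "frac x = frac y"
  then have "x - y = of_int (\<lfloor>x\<rfloor> - \<lfloor>y\<rfloor>)" by (simp add: frac_def)
  then show "x - y \<in> Ints" by (metis Ints_of_int)
next
  assume "x - y \<in> Ints"
  then obtain m where "x - y = of_int m" by (rule Ints_cases)
  then have "x = y + of_int m" by simp
  then show "frac x = frac y" by (simp add: frac_def)
qed

lemma red_eq_iff: "red z = red y \<longleftrightarrow> (\<forall>v. cz z v - cz y v \<in> Ints)"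
  unfolding frac_eq_iff_diff_Ints[symmetric] cz_red[symmetric] using cz_inj[of "red z" "red y"] by auto

text \<open>Write \<open>L\<close> for the lattice of the vertices.  The filtration \<open>L \<subseteq> \<int>A \<subseteq> \<int>\<^sup>d\<close> gives a bijection
  \<open>\<int>\<^sup>d / \<int>A \<times> \<int>A / L \<cong> \<int>\<^sup>d / L\<close>, where \<open>\<int>A / L\<close> is represented by the classes of \<open>\<nat>A\<close>.\<close>

lemma index_bij:
  "\<exists>f. bij_betw f (range (\<lambda>v :: int ^ 'd. (+) v ` Zspan A UNIV) \<times> vclasses) (range red)"
proof -
  define coset where "coset v = (+) v ` Zspan A UNIV" for v :: "int ^ 'd"
  define s where "s X = (SOME v. coset v = X)" for X
  define a where "a C = (SOME \<alpha>. \<alpha> \<in> C)" for C :: "'n multiset set"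
  have coset_eq: "coset v = coset w \<longleftrightarrow> v - w \<in> Zspan A UNIV" for v w
  proof
    assume "coset v = coset w"
    moreover have "v + 0 \<in> coset v" unfolding coset_def using Zspan_0 by blast
    ultimately show "v - w \<in> Zspan A UNIV" by (auto simp: coset_def)
  next
    assume *: "v - w \<in> Zspan A UNIV"
    have sub: "coset x \<subseteq> coset y" if "x - y \<in> Zspan A UNIV" for x y
    proof
      fix u assume "u \<in> coset x"
      then obtain z where z: "u = x + z" "z \<in> Zspan A UNIV" by (auto simp: coset_def)
      then have "u = y + ((x - y) + z)" by simp
      then show "u \<in> coset y" unfolding coset_def using Zspan_add[OF that z(2)] by blast
    qed
    have "w - v \<in> Zspan A UNIV" using Zspan_diff[OF Zspan_0 *] by simp
    then show "coset v = coset w" using sub * by blast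
  qed
  have s: "coset (s X) = X" if "X \<in> range coset" for X
  proof -
    have "\<exists>v. coset v = X" using that by blast
    then show ?thesis unfolding s_def by (rule someI_ex)
  qed
  have a: "a C \<in> C" if C: "C \<in> vclasses" for C
  proof -
    have "C \<noteq> {}" using C equiv_eqv unfolding vclasses_def by (rule in_quotient_imp_non_empty[rotated])
    then show ?thesis unfolding a_def by (auto intro: someI)
  qed
  have same: "C = C'" if "C \<in> vclasses" "C' \<in> vclasses" "eqv (a C) (a C')" for C C'
    using quotient_eqI[OF equiv_eqv, of C C' "a C" "a C'"] that a unfolding vclasses_def by auto
  define f where "f = (\<lambda>(X, C). red (s X + asum (a C)))"
  have "bij_betw f (range coset \<times> vclasses) (range red)"
  proof (rule bij_betwI')
    fix p q assume p: "p \<in> range coset \<times> vclasses" and q: "q \<in> range coset \<times> vclasses"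
    obtain X C where pX: "p = (X, C)" "X \<in> range coset" "C \<in> vclasses" using p by auto
    obtain Y D where qY: "q = (Y, D)" "Y \<in> range coset" "D \<in> vclasses" using q by auto
    show "f p = f q \<longleftrightarrow> p = q"
    proof
      assume "f p = f q"
      then have int: "cz (s X + asum (a C)) v - cz (s Y + asum (a D)) v \<in> Ints" for v
        using red_eq_iff by (simp add: f_def pX qY)
      have "s X + asum (a C) - (s Y + asum (a D)) \<in> Zspan A UNIV"
        by (rule integral_Zspan) (simp only: cz_diff int)
      from Zspan_add[OF Zspan_diff[OF this asum_Zspan[of "a C"]] asum_Zspan[of "a D"]]
      have "s X - s Y \<in> Zspan A UNIV" by (simp add: algebra_simps)
      then have XY: "X = Y" using coset_eq[of "s X" "s Y"] s pX qY by metis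
      have "eqv (a C) (a D)" unfolding eqv_def
      proof
        fix v show "kc (a C) v - kc (a D) v \<in> Ints"
          using int[of v] by (simp add: XY cz_add cz_asum)
      qed
      then show "p = q" using XY same pX qY by simp
    qed simp
  next
    fix p assume "p \<in> range coset \<times> vclasses"
    then show "f p \<in> range red" by (auto simp: f_def)
  next
    fix r assume "r \<in> range red"
    then obtain z where r: "r = red z" by blast
    define X where "X = coset z"
    have X: "X \<in> range coset" by (simp add: X_def)
    have "z - s X \<in> Zspan A UNIV" using s[OF X] coset_eq[of z "s X"] by (simp add: X_def)
    then obtain \<alpha> n where \<alpha>: "\<And>v. cz (z - s X) v = kc \<alpha> v - of_nat (n v)" by (rule Zspan_class) blast
    define C where "C = {(\<alpha>, \<alpha>'). eqv \<alpha> \<alpha>'} `` {\<alpha>}"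
    have C: "C \<in> vclasses" unfolding C_def vclasses_def by (rule quotientI) simp
    have "eqv \<alpha> (a C)" using a[OF C] unfolding C_def by simp
    then have int: "kc \<alpha> v - kc (a C) v \<in> Ints" for v by (simp add: eqv_def)
    have "cz z v - cz (s X + asum (a C)) v \<in> Ints" for v
    proof -
      have "cz z v - cz (s X + asum (a C)) v = cz (z - s X) v - kc (a C) v"
        by (simp add: cz_add cz_diff cz_asum)
      also have "\<dots> = (kc \<alpha> v - kc (a C) v) - of_nat (n v)" by (simp add: \<alpha>)
      also have "\<dots> \<in> Ints" using int by simp
      finally show ?thesis .
    qed
    then have "red z = red (s X + asum (a C))" by (simp add: red_eq_iff)
    then have "r = f (X, C)" by (simp add: f_def r)
    then show "\<exists>p\<in>range coset \<times> vclasses. r = f p" using X C by blast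
  qed
  then show ?thesis unfolding coset_def by blast
qed

lemma index_card:
  assumes fin: "finite (range red)"
  shows "finite vclasses" "card (range red) = ZA_index A * card vclasses" "ZA_index A > 0"
proof -
  let ?X = "range (\<lambda>v :: int ^ 'd. (+) v ` Zspan A UNIV)"
  obtain f where f: "bij_betw f (?X \<times> vclasses) (range red)" using index_bij by blast
  then have finp: "finite (?X \<times> vclasses)" using fin bij_betw_finite by blast
  have ne: "vclasses \<noteq> {}" "?X \<noteq> {}" by (auto simp: vclasses_def quotient_def)
  from finp ne show "finite vclasses" using finite_cartesian_productD2 by blast
  have "finite ?X" using finp ne finite_cartesian_productD1 by blast
  then show "ZA_index A > 0" using ne by (simp add: ZA_index_def card_gt_0_iff)
  show "card (range red) = ZA_index A * card vclasses"
    using bij_betw_same_card[OF f] by (simp add: ZA_index_def card_cartesian_product)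
qed

text \<open>The linear map that takes the standard basis to the vertices.\<close>

definition Tmap :: "real ^ 'd \<Rightarrow> real ^ 'd" where
  "Tmap x = Bmat *v x"

text \<open>The half-open unit cube; its image under \<open>Tmap\<close> is the half-open parallelepiped spanned by the
  vertices.\<close>

definition icube :: "(real ^ 'd) set" where
  "icube = {t. \<forall>i. 0 \<le> t $ i \<and> t $ i < 1}"

text \<open>Integral vectors as real vectors.\<close>

definition intv :: "int ^ 'd \<Rightarrow> real ^ 'd" where
  "intv z = (\<chi> i. of_int (z $ i))"

lemma linear_Tmap: "linear Tmap"
  unfolding Tmap_def by (rule matrix_vector_mul_linear)

lemma linear_vc: "linear (vc :: real ^ 'd \<Rightarrow> _)"
  unfolding vc_def by (rule matrix_vector_mul_linear)

lemma vc_intv: "vc (intv z) $ v = of_rat (cz z v)"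
proof -
  have "intv z = Tmap (\<chi> v. of_rat (cz z v))"
  proof -
    have "rat_of_int (z $ i) = (\<Sum>v\<in>UNIV. rat_of_int (A $ i $ vtx v) * cz z v)" for i
      using arg_cong[OF Bmat_vc[of "\<chi> i. rat_of_int (z $ i)"], of "\<lambda>x. x $ i"]
      by (simp add: matrix_vector_mult_def Bmat_def cz_def)
    then have "real_of_rat (rat_of_int (z $ i)) = real_of_rat (\<Sum>v\<in>UNIV. rat_of_int (A $ i $ vtx v) * cz z v)" for i
      by simp
    then show ?thesis
      by (simp add: intv_def Tmap_def Bmat_def matrix_vector_mult_def vec_eq_iff of_rat_sum of_rat_mult)
  qed
  then show ?thesis by (simp add: Tmap_def vc_Bmat)
qed

lemma Tmap_icube: "Tmap ` icube = {y. \<forall>v. 0 \<le> vc y $ v \<and> vc y $ v < 1}"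
proof
  show "{y. \<forall>v. 0 \<le> vc y $ v \<and> vc y $ v < 1} \<subseteq> Tmap ` icube"
  proof
    fix y :: "real ^ 'd" assume "y \<in> {y. \<forall>v. 0 \<le> vc y $ v \<and> vc y $ v < 1}"
    then show "y \<in> Tmap ` icube"
      unfolding icube_def Tmap_def by (intro image_eqI[of _ _ "vc y"]) (simp_all add: Bmat_vc)
  qed
qed (auto simp: vc_Bmat Tmap_def icube_def)

lemma Tmap_icube_borel: "Tmap ` icube \<in> sets borel"
proof -
  have "continuous_on UNIV (vc :: real ^ 'd \<Rightarrow> _)"
    by (rule linear_continuous_on) (use linear_vc in \<open>simp add: linear_conv_bounded_linear\<close>)
  then have m: "(vc :: real ^ 'd \<Rightarrow> _) \<in> borel_measurable borel" by (rule borel_measurable_continuous_onI)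
  have "icube \<in> sets borel" using unit_cube(1)[where ?'d = 'd] by (simp add: icube_def)
  from measurable_sets[OF m this] have "vc -` icube \<inter> space borel \<in> sets borel" .
  also have "vc -` icube \<inter> space borel = Tmap ` icube" unfolding Tmap_icube by (auto simp: icube_def)
  finally show ?thesis .
qed

text \<open>The lattice of the vertices, as a set of real vectors.\<close>

definition vlat :: "(real ^ 'd) set" where
  "vlat = range (\<lambda>m. intv (lat m))"

lemma vc_lat: "vc (intv (lat m)) $ v = of_int (m v)"
  by (simp add: vc_intv cz_lat)

lemma vlat_countable: "countable vlat"
proof -
  have "countable (UNIV :: ('d \<Rightarrow> int) set)" by simp
  then show ?thesis unfolding vlat_def by blast
qed

lemma vlat_minus: "l \<in> vlat \<Longrightarrow> - l \<in> vlat"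
proof -
  assume "l \<in> vlat"
  then obtain m where "l = intv (lat m)" by (auto simp: vlat_def)
  then have "- l = intv (lat (\<lambda>v. - m v))"
    by (simp add: intv_def lat_def vec_eq_iff sum_negf)
  then show ?thesis by (auto simp: vlat_def)
qed

lemma domain_parallelepiped: "\<exists>!l. l \<in> vlat \<and> x - l \<in> Tmap ` icube"
proof (rule ex1I)
  let ?m = "\<lambda>v. \<lfloor>vc x $ v\<rfloor>"
  show "intv (lat ?m) \<in> vlat \<and> x - intv (lat ?m) \<in> Tmap ` icube"
    by (auto simp: vlat_def Tmap_icube vc_diff vc_lat) linarith
  fix l assume l: "l \<in> vlat \<and> x - l \<in> Tmap ` icube"
  then obtain m where m: "l = intv (lat m)" by (auto simp: vlat_def)
  have "m v = ?m v" for v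
  proof -
    have "0 \<le> vc x $ v - of_int (m v) \<and> vc x $ v - of_int (m v) < 1"
      using l by (simp add: m Tmap_icube vc_diff vc_lat)
    then show ?thesis by (intro floor_unique[symmetric]) linarith+
  qed
  then have "m = ?m" by blast
  then show "l = intv (lat ?m)" using m by simp
qed

text \<open>The union of the unit cubes at the lattice points of the half-open parallelepiped.  It is a
  fundamental domain of the lattice of the vertices, as is the parallelepiped itself; hence the
  volume of the latter is the number of its lattice points.\<close>

definition cubes :: "(real ^ 'd) set" where
  "cubes = (\<Union>r\<in>range red. (+) (intv r) ` icube)"

lemma mem_cubes: "y \<in> cubes \<longleftrightarrow> (\<chi> i. \<lfloor>y $ i\<rfloor>) \<in> range red"
proof
  assume "y \<in> cubes"
  then obtain r t where r: "r \<in> range red" "t \<in> icube" "y = intv r + t" by (auto simp: cubes_def)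
  then have "(\<chi> i. \<lfloor>y $ i\<rfloor>) = r" by (simp add: vec_eq_iff intv_def icube_def floor_eq_iff)
  then show "(\<chi> i. \<lfloor>y $ i\<rfloor>) \<in> range red" using r by simp
next
  assume r: "(\<chi> i. \<lfloor>y $ i\<rfloor>) \<in> range red"
  have "y - intv (\<chi> i. \<lfloor>y $ i\<rfloor>) \<in> icube" by (auto simp: icube_def intv_def) linarith
  then have "intv (\<chi> i. \<lfloor>y $ i\<rfloor>) + (y - intv (\<chi> i. \<lfloor>y $ i\<rfloor>)) \<in> (+) (intv (\<chi> i. \<lfloor>y $ i\<rfloor>)) ` icube" by blast
  then show "y \<in> cubes" unfolding cubes_def using r by (intro UN_I) auto
qed

lemma domain_cubes: "\<exists>!l. l \<in> vlat \<and> x - l \<in> cubes"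
proof -
  define z where "z = (\<chi> i. \<lfloor>x $ i\<rfloor>)"
  have fl: "(\<chi> i. \<lfloor>(x - intv y) $ i\<rfloor>) = z - y" for y
    by (simp add: vec_eq_iff intv_def z_def)
  let ?m = "\<lambda>v. \<lfloor>cz z v\<rfloor>"
  show ?thesis
  proof (rule ex1I)
    have "x - intv (lat ?m) \<in> cubes" unfolding mem_cubes fl by (simp flip: red_def)
    then show "intv (lat ?m) \<in> vlat \<and> x - intv (lat ?m) \<in> cubes" by (auto simp: vlat_def)
    fix l assume l: "l \<in> vlat \<and> x - l \<in> cubes"
    then obtain m where m: "l = intv (lat m)" by (auto simp: vlat_def)
    have "x - intv (lat m) \<in> cubes" using l m by simp
    then obtain w where w: "z - lat m = red w" unfolding mem_cubes fl by blast
    have "red z = red (red w)" unfolding red_eq_iff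
    proof
      fix v show "cz z v - cz (red w) v \<in> Ints"
        by (simp add: w[symmetric] cz_diff cz_lat)
    qed
    also have "red (red w) = red w"
      by (rule cz_inj) (simp add: cz_red)
    finally have "z - lat ?m = z - lat m" using w by (simp add: red_def)
    then show "l = intv (lat ?m)" using m by simp
  qed
qed

lemma emeasure_translate_icube: "(+) (intv r) ` icube \<in> sets borel" "emeasure lborel ((+) (intv r) ` icube) = 1"
proof -
  have icube: "icube \<in> sets borel" using unit_cube(1)[where ?'d = 'd] by (simp add: icube_def)
  have eq: "(+) (intv r) ` icube = (+) (- intv r) -` icube"
    by (auto simp: image_iff) (metis add.commute add_diff_cancel_left' diff_add_cancel uminus_add_conv_diff)
  have "(+) (- intv r) -` icube \<inter> space borel \<in> sets borel"
    by (rule measurable_sets[OF _ icube]) simp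
  then show "(+) (intv r) ` icube \<in> sets borel" by (simp add: eq)
  have "emeasure lborel icube = emeasure (distr lborel borel ((+) (- intv r))) icube" by (simp add: lborel_distr_plus)
  also have "\<dots> = emeasure lborel ((+) (- intv r) -` icube \<inter> space lborel)"
    by (rule emeasure_distr) (simp_all add: icube)
  finally have "emeasure lborel icube = emeasure lborel ((+) (- intv r) -` icube)" by simp
  moreover have "emeasure lborel icube = 1" using unit_cube(3)[where ?'d = 'd] by (simp add: icube_def)
  ultimately show "emeasure lborel ((+) (intv r) ` icube) = 1" unfolding eq by simp
qed

lemma emeasure_cubes: "cubes \<in> sets borel" "emeasure lborel cubes = emeasure (count_space (range red)) (range red)"
proof -
  have cnt: "countable (range red)"
  proof -
    have "countable (UNIV :: ('d \<Rightarrow> int) set)" by simp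
    then have "countable (range (vec_lambda :: ('d \<Rightarrow> int) \<Rightarrow> _))" by blast
    moreover have "range (vec_lambda :: ('d \<Rightarrow> int) \<Rightarrow> _) = UNIV" by (metis surjI vec_lambda_eta)
    ultimately show ?thesis by (metis countable_subset subset_UNIV)
  qed
  show "cubes \<in> sets borel"
    unfolding cubes_def using cnt emeasure_translate_icube(1) by (intro sets.countable_UN') auto
  have "disjoint_family_on (\<lambda>r. (+) (intv r) ` icube) (range red)"
  proof (unfold disjoint_family_on_def, intro ballI impI)
    fix r r' :: "int ^ 'd" assume "r \<noteq> r'"
    show "(+) (intv r) ` icube \<inter> (+) (intv r') ` icube = {}"
    proof (rule ccontr)
      assume "\<not> ?thesis"
      then obtain t t' where t: "t \<in> icube" "t' \<in> icube" "intv r + t = intv r' + t'" by auto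
      have "r $ i = r' $ i" for i
      proof -
        have "\<lfloor>(intv r + t) $ i\<rfloor> = r $ i" using t(1) by (simp add: intv_def icube_def floor_eq_iff)
        moreover have "\<lfloor>(intv r' + t') $ i\<rfloor> = r' $ i" using t(2) by (simp add: intv_def icube_def floor_eq_iff)
        ultimately show ?thesis using t(3) by simp
      qed
      then show False using \<open>r \<noteq> r'\<close> by (simp add: vec_eq_iff)
    qed
  qed
  then have "emeasure lborel cubes = (\<integral>\<^sup>+r. emeasure lborel ((+) (intv r) ` icube) \<partial>count_space (range red))"
    unfolding cubes_def using cnt emeasure_translate_icube(1) by (intro emeasure_UN_countable) auto
  then show "emeasure lborel cubes = emeasure (count_space (range red)) (range red)"
    by (simp add: emeasure_translate_icube(2))
qed

text \<open>The pyramid over \<open>conv(A)\<close> with apex 0 is the image of the standard simplex, whose volume is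
  \<open>1 / d!\<close>, and the linear map scales volumes by the number of lattice points of the half-open
  parallelepiped, which is \<open>[\<int>\<^sup>d : \<int>A]\<close> times the number of classes.\<close>

lemma normalized_vol_eq: "finite vclasses" "normalized_vol A = real (card vclasses)"
proof -
  obtain c where c: "\<And>S. bounded S \<Longrightarrow> S \<in> sets borel \<Longrightarrow> Tmap ` S \<in> sets borel \<Longrightarrow>
      measure lborel (Tmap ` S) = c * measure lborel S"
    using linear_image_scale[OF linear_Tmap] by blast
  have icube: "icube \<in> sets borel" "bounded icube" "measure lborel icube = 1"
    using unit_cube[where ?'d = 'd] by (simp_all add: icube_def)
  have bd: "bounded (Tmap ` icube)"
    using icube(2) linear_Tmap by (intro bounded_linear_image) (auto simp: linear_conv_bounded_linear)
  have eq: "emeasure lborel (Tmap ` icube) = emeasure (count_space (range red)) (range red)"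
    using fundamental_domains[OF Tmap_icube_borel emeasure_cubes(1) vlat_countable vlat_minus
        domain_parallelepiped domain_cubes] emeasure_cubes(2) by simp
  have "emeasure lborel (Tmap ` icube) < \<infinity>" by (rule emeasure_bounded_finite[OF bd])
  \<comment> \<open>The finiteness of the number of lattice points follows from that of the volume.\<close>
  then have fin: "finite (range red)" unfolding eq by (rule_tac ccontr) (simp add: emeasure_count_space)
  then have "measure lborel (Tmap ` icube) = card (range red)"
    unfolding measure_def eq by (simp add: emeasure_count_space)
  then have c_eq: "c = card (range red)" using c[OF icube(2,1) Tmap_icube_borel] icube(3) by simp
  note idx = index_card[OF fin]
  show "finite vclasses" by (rule idx(1))
  have "convex hull (insert 0 (conv_A A)) = Tmap ` (convex hull (insert 0 Basis))"
  proof -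
    have "Tmap ` (convex hull (insert 0 Basis)) = convex hull (Tmap ` insert 0 Basis)"
      by (rule convex_hull_linear_image[OF linear_Tmap])
    also have "Tmap ` insert 0 Basis = insert 0 (range (\<lambda>v. acol A (vtx v)))"
    proof -
      have B: "(Basis :: (real ^ 'd) set) = range (\<lambda>v. axis v 1)" by (auto simp: Basis_vec_def)
      have "Tmap (axis v 1) = acol A (vtx v)" for v
        by (simp add: Tmap_def matrix_vector_mult_axis Bmat_def acol_def)
      moreover have "Tmap 0 = 0" by (simp add: Tmap_def)
      ultimately show ?thesis unfolding B by (simp add: image_image)
    qed
    also have "convex hull (insert 0 (range (\<lambda>v. acol A (vtx v)))) = convex hull (insert 0 (conv_A A))"
      unfolding conv_A_face face_hull by (metis hull_insert)
    finally show ?thesis by simp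
  qed
  note hull = this
  let ?S = "convex hull (insert 0 Basis) :: (real ^ 'd) set"
  have cp: "compact ?S" by (intro finite_imp_compact_convex_hull) simp
  have cT: "compact (Tmap ` ?S)"
    by (rule compact_continuous_image[OF _ cp])
       (use linear_Tmap in \<open>simp add: linear_conv_bounded_linear linear_continuous_on\<close>)
  have "measure lebesgue (convex hull (insert 0 (conv_A A))) = measure lborel (Tmap ` ?S)"
    unfolding hull by (rule measure_completion) (use borel_compact[OF cT] in simp)
  also have "\<dots> = c * measure lborel ?S"
    by (rule c[OF compact_imp_bounded[OF cp] borel_compact[OF cp] borel_compact[OF cT]])
  also have "\<dots> = c / fact CARD('d)" by (simp add: content_std_simplex)
  finally have "measure lebesgue (convex hull (insert 0 (conv_A A))) = c / fact CARD('d)" .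
  then have "normalized_vol A = c / real (ZA_index A)"
    by (simp add: normalized_vol_def)
  then show "normalized_vol A = real (card vclasses)"
    using idx(2,3) by (simp add: c_eq)
qed

end

section \<open>The vertices of the simplex\<close>

text \<open>The columns of a matrix of full row rank over the rational numbers span the space over the real
  numbers.\<close>

lemma real_span_columns:
  fixes A :: "int ^ 'n::finite ^ 'd::finite"
  assumes "rank (map_matrix rat_of_int A) = CARD('d)"
  shows "span (range (acol A :: 'n \<Rightarrow> real ^ 'd)) = UNIV"
proof -
  let ?R = "map_matrix rat_of_int A"
  have entry: "?R $ i $ j = of_int (A $ i $ j)" for i j by (simp add: map_matrix_def)
  \<comment> \<open>The rows are independent because their span has dimension \<open>d\<close>.\<close>
  have rows_eq: "rows ?R = range (\<lambda>i. row i ?R)" by (auto simp: rows_def)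
  have "card (rows ?R) \<le> CARD('d)" unfolding rows_eq by (rule card_image_le) simp
  have dim: "vec.dim (rows ?R) = CARD('d)" using assms by (simp add: row_rank_def_gen)
  have fin: "finite (rows ?R)" unfolding rows_eq by simp
  have "vec.dim (rows ?R) \<le> card (rows ?R)" by (rule vec.dim_le_card) (auto simp: fin intro: vec.span_base)
  then have card: "card (rows ?R) = CARD('d)" using dim \<open>card (rows ?R) \<le> CARD('d)\<close> by simp
  have indep: "vec.independent (rows ?R)"
    by (rule vec.card_le_dim_spanning[of _ "vec.span (rows ?R)"])
       (use fin card dim vec.span_superset in \<open>auto simp: vec.dim_span\<close>)
  have inj: "inj (\<lambda>i. row i ?R)" using card unfolding rows_eq by (intro eq_card_imp_inj_on) simp_all
  have zero: "c i = 0" if "\<And>j. (\<Sum>i\<in>UNIV. c i * of_int (A $ i $ j)) = 0" for c :: "'d \<Rightarrow> rat" and i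
  proof -
    have "(\<Sum>i\<in>UNIV. c i *s row i ?R) = 0"
      using that by (simp add: vec_eq_iff row_def entry)
    then have "(\<Sum>r\<in>rows ?R. c (inv_into UNIV (\<lambda>i. row i ?R) r) *s r) = 0"
      unfolding rows_eq by (simp add: sum.reindex[OF inj] inv_f_f[OF inj])
    then have "c (inv_into UNIV (\<lambda>i. row i ?R) (row i ?R)) = 0"
      using vec.independentD[OF indep fin subset_refl, of "\<lambda>r. c (inv_into UNIV (\<lambda>i. row i ?R) r)" "row i ?R"]
      by (simp add: rows_eq)
    then show ?thesis by (simp add: inv_f_f[OF inj])
  qed
  \<comment> \<open>A rational vector orthogonal to all columns vanishes; hence the columns span \<open>\<rat>\<^sup>d\<close>.\<close>
  have "surj ((*v) ?R)"
  proof -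
    have "inj ((*v) (transpose ?R))"
    proof (rule injI)
      fix x y :: "rat ^ 'd" assume xy: "transpose ?R *v x = transpose ?R *v y"
      have "(x - y) $ i = 0" for i
      proof (rule zero)
        fix j
        have "(transpose ?R *v x) $ j = (transpose ?R *v y) $ j" using xy by simp
        then show "(\<Sum>i\<in>UNIV. (x - y) $ i * of_int (A $ i $ j)) = 0"
          by (simp add: matrix_vector_mult_def transpose_def entry algebra_simps sum_subtractf)
      qed
      then show "x = y" by (simp add: vec_eq_iff)
    qed
    then obtain B where "B ** transpose ?R = mat 1" using matrix_left_invertible_injective by blast
    then have "?R ** transpose B = mat 1" by (metis matrix_transpose_mul transpose_mat transpose_transpose)
    then show ?thesis using matrix_right_invertible_surjective by blast
  qed
  then have "\<exists>q. ?R *v q = axis i 1" for i by (metis surjD)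
  then obtain q where q: "\<And>i. ?R *v q i = axis i 1" by metis
  have "axis i 1 \<in> span (range (acol A :: 'n \<Rightarrow> real ^ 'd))" for i
  proof -
    have "(axis i 1 :: real ^ 'd) = (\<Sum>j\<in>UNIV. of_rat (q i $ j) *\<^sub>R acol A j)"
    proof (rule vec_eq_iff[THEN iffD2], rule allI)
      fix k
      have "(axis i 1 :: real ^ 'd) $ k = of_rat ((?R *v q i) $ k)" by (simp add: q axis_def)
      also have "\<dots> = (\<Sum>j\<in>UNIV. of_rat (q i $ j) *\<^sub>R acol A j) $ k"
        by (simp add: matrix_vector_mult_def entry of_rat_sum of_rat_mult acol_def mult.commute)
      finally show "(axis i 1 :: real ^ 'd) $ k = (\<Sum>j\<in>UNIV. of_rat (q i $ j) *\<^sub>R acol A j) $ k" .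
    qed
    also have "\<dots> \<in> span (range (acol A))" by (intro span_sum span_scale span_base) blast
    finally show ?thesis .
  qed
  then have "Basis \<subseteq> span (range (acol A :: 'n \<Rightarrow> real ^ 'd))" by (auto simp: Basis_vec_def)
  then have "span Basis \<subseteq> span (range (acol A :: 'n \<Rightarrow> real ^ 'd))" by (intro span_minimal) simp_all
  then show ?thesis by (simp add: span_Basis top.extremum_unique)
qed

text \<open>If the columns span the space, lie on a hyperplane off the origin, and have a simplex as
  convex hull, then the vertices of the simplex are columns that form a basis of the space.  The
  barycentric coordinates are rational because they solve a linear system with integral
  coefficients.\<close>

lemma exists_simplicial:
  fixes A :: "int ^ 'n::{finite,linorder} ^ 'd::finite"
  assumes rank: "rank (map_matrix rat_of_int A) = CARD('d)"
    and hyper: "\<exists>(h :: rat ^ 'd) c. c \<noteq> 0 \<and> (\<forall>j. (\<Sum>i\<in>UNIV. h $ i * acol A j $ i) = c)"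
    and simplex: "\<exists>m. m simplex (conv_A A)"
  shows "\<exists>vtx \<kappa>. simplicial A vtx \<kappa>"
proof -
  obtain C where C: "\<not> affine_dependent C" "conv_A A = convex hull C"
    using simplex by (auto simp: simplex_def)
  have finC: "finite C" by (rule aff_independent_finite[OF C(1)])
  have Ccol: "C \<subseteq> range (acol A)"
  proof
    fix x assume "x \<in> C"
    then have "x extreme_point_of (convex hull C)"
      using extreme_point_of_convex_hull_affine_independent[OF C(1)] by blast
    then show "x \<in> range (acol A)"
      using extreme_point_of_convex_hull[of x "range (acol A)"] C(2) by (simp add: conv_A_def)
  qed
  obtain h :: "rat ^ 'd" and c where c: "c \<noteq> 0" "\<And>j. (\<Sum>i\<in>UNIV. h $ i * acol A j $ i) = c"
    using hyper by blast
  define H :: "real ^ 'd" where "H = (\<chi> i. of_rat (h $ i))"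
  have H: "H \<bullet> acol A j = of_rat c" for j
  proof -
    have "H \<bullet> acol A j = of_rat (\<Sum>i\<in>UNIV. h $ i * acol A j $ i)"
      by (simp add: H_def inner_vec_def acol_def of_rat_sum of_rat_mult)
    then show ?thesis by (simp add: c)
  qed
  have HC: "H \<bullet> x = of_rat c" if "x \<in> C" for x using Ccol that H by auto
  \<comment> \<open>The functional \<open>H\<close> turns linear relations between vertices into affine ones.\<close>
  have indep: "independent C"
  proof (rule independent_if_scalars_zero[OF finC])
    fix f x assume f: "(\<Sum>x\<in>C. f x *\<^sub>R x) = 0" and x: "x \<in> C"
    have "0 = H \<bullet> (\<Sum>x\<in>C. f x *\<^sub>R x)" by (simp add: f)
    also have "\<dots> = (\<Sum>x\<in>C. f x) * of_rat c"
      by (simp add: inner_sum_right HC sum_distrib_right)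
    finally have "(\<Sum>x\<in>C. f x) = 0" using c(1) by simp
    then show "f x = 0" using C(1) f x unfolding affine_dependent_explicit_finite[OF finC] by blast
  qed
  have "range (acol A) \<subseteq> span C"
  proof -
    have "range (acol A) \<subseteq> convex hull C" unfolding C(2)[symmetric] conv_A_def by (rule hull_subset)
    also have "\<dots> \<subseteq> span C" by (rule hull_minimal[OF span_superset]) (simp add: subspace_imp_convex)
    finally show ?thesis .
  qed
  then have "span (range (acol A :: 'n \<Rightarrow> real ^ 'd)) \<subseteq> span C" by (rule span_minimal) simp
  then have spanC: "span C = UNIV" using real_span_columns[OF rank] by (simp add: top.extremum_unique)
  have "card C = CARD('d)"
    using dim_span_eq_card_independent[OF indep] spanC by (simp add: dim_UNIV)
  then obtain g where g: "bij_betw g (UNIV :: 'd set) C"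
    using finite_same_card_bij[of "UNIV :: 'd set" C] finC by auto
  have "\<forall>v. \<exists>j. acol A j = g v" using Ccol g by (metis UNIV_I bij_betwE imageE subsetD)
  then obtain vtx where vtx: "\<And>v. acol A (vtx v) = g v" by metis
  have injg: "inj g" and rg: "range g = C" using g by (auto simp: bij_betw_def)
  define B :: "real ^ 'd ^ 'd" where "B = (\<chi> i v. of_int (A $ i $ vtx v))"
  have Bv: "B *v x = (\<Sum>v\<in>UNIV. x $ v *\<^sub>R g v)" for x
    by (simp add: B_def matrix_vector_mult_def vec_eq_iff acol_def mult.commute flip: vtx)
  have injB: "x = 0" if "B *v x = 0" for x
  proof -
    have "(\<Sum>y\<in>C. x $ inv_into UNIV g y *\<^sub>R y) = 0"
      using that unfolding rg[symmetric] by (simp add: Bv sum.reindex[OF injg] inv_f_f[OF injg])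
    then have "\<forall>y\<in>C. x $ inv_into UNIV g y = 0"
      using independentD[OF indep finC subset_refl, where u = "\<lambda>y. x $ inv_into UNIV g y"] by blast
    then have "x $ inv_into UNIV g (g v) = 0" for v using rg by blast
    then show ?thesis by (simp add: vec_eq_iff inv_f_f[OF injg])
  qed
  have "invertible B"
    using injB by (simp add: invertible_left_inverse matrix_left_invertible_ker)
  then have "det B \<noteq> 0" by (simp add: invertible_det_nz)
  moreover have "det B = of_int (det (\<chi> i v. A $ i $ vtx v))" by (simp add: B_def det_def)
  ultimately have det: "det (\<chi> i v. A $ i $ vtx v) \<noteq> 0" by auto
  define Bq :: "rat ^ 'd ^ 'd" where "Bq = (\<chi> i v. of_int (A $ i $ vtx v))"
  have "det Bq = of_int (det (\<chi> i v. A $ i $ vtx v))" by (simp add: Bq_def det_def)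
  then have "invertible Bq" using det by (simp add: invertible_det_nz)
  then obtain Bi where Bi: "Bq ** Bi = mat 1" unfolding invertible_def by blast
  define \<kappa> where "\<kappa> j v = (Bi *v acol A j) $ v" for j v
  have coords: "rat_of_int (A $ i $ j) = (\<Sum>v\<in>UNIV. \<kappa> j v * rat_of_int (A $ i $ vtx v))" for i j
  proof -
    have "Bq *v (Bi *v acol A j) = acol A j" by (simp add: matrix_vector_mul_assoc Bi)
    then have "(Bq *v (Bi *v acol A j)) $ i = acol A j $ i" by simp
    then show ?thesis by (simp add: Bq_def matrix_vector_mult_def[of Bq] \<kappa>_def acol_def mult.commute)
        (simp add: matrix_vector_mult_def mult.commute)
  qed
  have bary: "(\<forall>v. \<kappa> j v \<ge> 0) \<and> (\<Sum>v\<in>UNIV. \<kappa> j v) = 1" for j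
  proof -
    have "(acol A j :: real ^ 'd) \<in> convex hull C"
      unfolding C(2)[symmetric] conv_A_def by (rule hull_inc) blast
    then obtain u where u: "\<And>x. x \<in> C \<Longrightarrow> 0 \<le> u x" "sum u C = 1" "(\<Sum>x\<in>C. u x *\<^sub>R x) = acol A j"
      unfolding convex_hull_finite[OF finC] by blast
    have "B *v (\<chi> v. of_rat (\<kappa> j v)) = acol A j"
    proof -
      have "real_of_int (A $ i $ j) = of_rat (\<Sum>v\<in>UNIV. \<kappa> j v * rat_of_int (A $ i $ vtx v))" for i
        by (simp flip: coords)
      then show ?thesis
        by (simp add: B_def matrix_vector_mult_def vec_eq_iff acol_def of_rat_sum of_rat_mult mult.commute)
    qed
    moreover have "B *v (\<chi> v. u (g v)) = acol A j"
      using u(3) unfolding rg[symmetric] by (simp add: Bv sum.reindex[OF injg])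
    ultimately have "B *v ((\<chi> v. of_rat (\<kappa> j v)) - (\<chi> v. u (g v))) = 0"
      by (simp add: matrix_vector_mult_diff_distrib)
    from injB[OF this] have k: "of_rat (\<kappa> j v) = u (g v)" for v by (simp add: vec_eq_iff)
    have "real_of_rat (\<kappa> j v) \<ge> 0" for v unfolding k using rg by (intro u(1)) blast
    moreover have "real_of_rat (\<Sum>v\<in>UNIV. \<kappa> j v) = 1"
      using u(2) unfolding rg[symmetric] by (simp add: of_rat_sum k sum.reindex[OF injg])
    ultimately show ?thesis by simp
  qed
  have "simplicial A vtx \<kappa>"
    by (rule simplicial.intro[OF coords spec[OF conjunct1[OF bary]] conjunct2[OF bary] det])
  then show ?thesis by blast
qed

theorem theorem6p6:
  fixes A :: "int ^ 'n::{finite,linorder} ^ 'd::finite"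
  assumes "rank (map_matrix rat_of_int A) = CARD('d)"
    and "\<exists>(h :: rat ^ 'd) c. c \<noteq> 0 \<and> (\<forall>j. (\<Sum>i\<in>UNIV. h $ i * acol A j $ i) = c)"
    and "\<exists>m. m simplex (conv_A A)"
  shows "(\<forall>\<beta> :: 'k::field_char_0 ^ 'd. condition_i A \<beta> \<longleftrightarrow> condition_ii A \<beta>) \<and>
    exceptional_set A = {\<beta> :: 'k ^ 'd. \<not> condition_i A \<beta>}"
proof -
  obtain vtx \<kappa> where "simplicial A vtx \<kappa>" using exists_simplicial[OF assms] by blast
  then interpret simplicial A vtx \<kappa> .
  have "real (holonomic_rank (hypergeometric_module A \<beta>)) > normalized_vol A \<longleftrightarrow> \<not> condition_i A \<beta>"
    for \<beta> :: "'k ^ 'd"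
  proof (cases "directed \<beta>")
    case True
    then show ?thesis
      using rank_le_classes[OF True normalized_vol_eq(1)] conditions_iff(1)[of \<beta>]
      by (simp add: normalized_vol_eq(2))
  next
    case False
    then show ?thesis
      using rank_gt_classes[OF False normalized_vol_eq(1)] conditions_iff(1)[of \<beta>]
      by (simp add: normalized_vol_eq(2))
  qed
  then show ?thesis
    unfolding exceptional_set_def using conditions_iff(2) by auto
qed

end
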